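(* Let $\Xi$, $\Xi_S$, $\Xi_F$, $\Pi$ and the involution $\iota\colon\Xi\to\Xi$ be as defined in the context. Then $\iota$ maps the topological Markov chain with adjacency matrix $\Pi$ to the same chain with reversed time, that is, $$\Pi_{\iota(j)\iota(k)}=\Pi_{kj}\qquad\text{for all }j,k\in\Xi.$$ Also, $\iota(\Xi_S)=\Xi_F$ and $\iota(\Xi_F)=\Xi_S$.
   Context: Setting. $G$ is a finitely generated non-elementary Fuchsian group acting on the hyperbolic disk $\mathbb D$, with closed fundamental domain $\mathcal R$, a finite-sided convex polygon with vertices in $\mathbb D\cup\partial\mathbb D$ and interior angle strictly less than $\pi$ at each vertex. A side of $\mathcal R$ is the closure in $\mathbb D$ of the geodesic arc joining two adjacent vertices (arcs contained in $\partial\mathbb D$ are not sides). $N(\mathcal R)$ is the number of sides. "Vertex" means a vertex in $\mathbb D$. The sides are paired: for each side $s$ there is a unique $e\in G$ such that $e(s)$ is also a side of $\mathcal R$ and $\mathcal R$, $e\mathcal R$ are adjacent along $e(s)$ ($e(s)=s$ allowed). $G_0$ is the set of these elements; it is a symmetric generating set. $\mathbf T=\{g\mathcal R:g\in G\}$, and $\partial\mathbf T$ is the union of the boundaries in $\mathbb D$ of all $g\mathcal R$. Standing assumptions: (i) even corners: the complete geodesic extending each side of $\mathcal R$ lies in $\partial\mathbf T$; $n(v)$ denotes the number of geodesic lines of $\partial\mathbf T$ through a vertex $v$; (ii) either $N(\mathcal R)\ge5$; or $N(\mathcal R)=4$ and either $\mathcal R$ is non-compact or $\mathcal R$ is compact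 and has no two opposite vertices $v,v'$ with $n(v)=n(v')=2$; or $N(\mathcal R)=3$ and $\mathcal R$ is non-compact. Labels. For $e\in G_0$, $s_e$ is the common side of $\mathcal R$ and $e^{-1}\mathcal R$ (its label interior to $\mathcal R$ is $e$, its exterior label is $e^{-1}$). Crossing $s_e$ from outside to inside $\mathcal R$, let $v_L(e)$, $v_R(e)$ be its left and right ends (undefined if the end is on $\partial\mathbb D$). Labels $l(e),r(e)\in G_0$ are defined by $v_R(l(e)^{-1})=v_L(e)$ and $v_L(r(e)^{-1})=v_R(e)$ (undefined if $v_L(e)$, resp. $v_R(e)$, is undefined). Labels $e_1,e_2$ are adjacent if $e_1=e_2$, or $v_L(e_1^{-1})=v_R(e_2^{-1})$, or $v_L(e_2^{-1})=v_R(e_1^{-1})$ (i.e. the sides of $\mathcal R$ with outgoing labels $e_1,e_2$ coincide or have a common vertex). States $\Xi$ (all labels in $G_0$, all indices $i_\pm\ge1$ integers): - $A_0(e)$; $A_L[i_-,i_+](e)$ if $v_L(e)$ is defined and $3\le i_-+i_+\le n(v_L(e))$; $A_R[i_-,i_+](e)$ if $v_R(e)$ is defined and $3\le i_-+i_+\le n(v_R(e))$; $A_{LR}[i_-,i_+](e)$ if $v_L(e),v_R(e)$ are defined, $2\le i_-\le n(v_L(e))-1$, $2\le i_+\le n(v_R(e))-1$; $A_{RL}[i_-,i_+](e)$ if both are defined, $2\le i_-\le n(v_R(e))-1$, $2\le i_+\le n(v_L(e))-1$. - $B(e_L,e_R)$ with $v_L(e_L^{-1})=v_R(e_R^{-1})$.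 - $C_k(e_L,e_R)$ with $1\le k\le n(e_L,e_R)-2$ and $l^{2k+1}(e_L^{-1})=e_R$, where $n(e_L,e_R):=n(v_R(e_L))=n(v_L(e_R))$ (the same notation is used for $B(e_L,e_R)$). - $D(e_L,e_R)$ with $v_R(e_L)=v_L(e_R)$. - $E_L(e_L,e_M,e_R)$ with $v_L(e_L^{-1})=v_R(e_M^{-1})$ and $v_R(e_M)=v_L(e_R)$; $E_R(e_L,e_M,e_R)$ with $v_R(e_L)=v_L(e_M)$ and $v_L(e_M^{-1})=v_R(e_R^{-1})$. (In these conditions all the vertices involved are required to be defined.) Special case: $N(\mathcal R)=3$ and $\mathcal R$ has a compact side; this compact side is then unique; let $g=g^{-1}$ be its label. In the special case the states $A_0(g)$, $A_\alpha[1,i_+](g)$, $A_\alpha[i_-,1](g)$ ($\alpha=L,R$) are excluded from $\Xi$. Start and end states: $\Xi_S$ consists of all $A_0(e),A_L[1,i_+](e),A_R[1,i_+](e),B(e_L,e_R)$ in $\Xi$; $\Xi_F$ consists of all $A_0(e),A_L[i_-,1](e),A_R[i_-,1](e),D(e_L,e_R)$ in $\Xi$. In the special case, for the label $g$, the states $A_{LR}[2,i_+](g),A_{RL}[2,i_+](g)$ are included in $\Xi_S$ in place of the states $A_0(g),A_L[1,i_+](g),A_R[1,i_+](g)$, and the states $A_{LR}[i_-,2](g),A_{RL}[i_-,2](g)$ are included in $\Xi_F$ in place of the states $A_0(g),A_L[i_-,1](g),A_R[i_-,1](g)$. Admissible transitions ($\Pi$ is the $\Xi\times\Xi$ matrix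 with $\Pi_{j,j'}=1$ if $j\to j'$ is in this list and $0$ otherwise; all states mentioned must belong to $\Xi$): - $A_0(e)\to A_0(e'),\ A_L[1,i_+](e'),\ A_R[1,i_+](e')$ for $e'$ non-adjacent to $e^{-1}$ and any admissible $i_+$; $A_0(e)\to B(e_L,e_R)$ for $e_L,e_R$ non-adjacent to $e^{-1}$. - If $i_+>1$: $A_L[i_-,i_+](e)\to A_L[i_-+1,i_+-1](l(e))$; and if moreover $i_+=2$, also $A_L[i_-,2](e)\to A_{LR}[i_-+1,j_+](l(e))$ for any admissible $j_+$ and $A_L[i_-,2](e)\to B(l(e),l(l(e)^{-1}))$. - $A_L[i_-,1](e)$ has the same transitions as $A_0(e)$. - $A_{RL}[i_-,i_+](e)$ has the transitions listed for $A_L[1,i_+](e)$ (by the same formulas). - $A_R$- and $A_{LR}$-states: same with left and right exchanged; i.e. for $i_+>1$: $A_R[i_-,i_+](e)\to A_R[i_-+1,i_+-1](r(e))$, and if $i_+=2$ also $\to A_{RL}[i_-+1,j_+](r(e))$ and $\to B(r(r(e)^{-1}),r(e))$; $A_R[i_-,1](e)$ as $A_0(e)$; $A_{LR}[i_-,i_+](e)$ as $A_R[1,i_+](e)$. - $B(e_L,e_R)\to C_1(r(e_L),l(e_R))$ if $n(e_L,e_R)\ge3$; if $n(e_L,e_R)=2$, $B(e_L,e_R)$ has the transitions listed below for $C_{n(e_L,e_R)-2}(e_L,e_R)$. - $C_i(e_L,e_R)\to C_{i+1}(r(e_L),l(e_R))$ for $i<n(e_L,e_R)-2$. - $C_{n(e_L,e_R)-2}(e_L,e_R)\to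 D(r(e_L),l(e_R)),\ E_L(r(r(e_L)^{-1}),r(e_L),l(e_R)),\ E_R(r(e_L),l(e_R),l(l(e_R)^{-1}))$. - $D(e_L,e_R)\to A_0(e'),A_L[1,i_+](e'),A_R[1,i_+](e')$ for $e'$ non-adjacent to $e_L^{-1},e_R^{-1}$, any admissible $i_+$; $D(e_L,e_R)\to B(e_L',e_R')$ where $e'_L,e'_R$ are either not adjacent to $e_L^{-1},e_R^{-1}$, or adjacent via a vertex $v$ with $n(v)>2$, or adjacent via two such vertices (in particular $e'_L,e'_R\notin\{e_L^{-1},e_R^{-1}\}$); $D(e_L,e_R)\to A_L[2,i_+](l(e_L)),\ A_{LR}[2,i_+](l(e_L))$ if $n(v_L(e_L))>2$, any admissible $i_+$; $D(e_L,e_R)\to A_R[2,i_+](r(e_R)),\ A_{RL}[2,i_+](r(e_R))$ if $n(v_R(e_R))>2$, any admissible $i_+$. - $E_L(e_L,e_M,e_R)$ has the same transitions as $B(e_L,e_M)$; $E_R(e_L,e_M,e_R)$ has the same transitions as $B(e_M,e_R)$. The involution $\iota\colon\Xi\to\Xi$ is given by $A_0(e)\leftrightarrow A_0(e^{-1})$; $A_\alpha[i_-,i_+](e)\leftrightarrow A_\alpha[i_+,i_-](e^{-1})$ for $\alpha=LR,RL$; $A_L[i_-,i_+](e)\leftrightarrow A_R[i_+,i_-](e^{-1})$; $B(e_L,e_R)\leftrightarrow D(e_R^{-1},e_L^{-1})$; $C_k(e_L,e_R)\leftrightarrow C_{n(e_L,e_R)-k-1}(e_R^{-1},e_L^{-1})$;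 $E_\alpha(e_L,e_M,e_R)\leftrightarrow E_\alpha(e_R^{-1},e_M^{-1},e_L^{-1})$ for $\alpha=L,R$. *)

theory Defs
  imports
    "HOL-Algebra.Bij"
    "HOL-Algebra.Generated_Groups"
    "HOL-Analysis.Isolated"
    "HOL-Complex_Analysis.Riemann_Mapping"
begin

abbreviation hdisc :: "complex set" where
  "hdisc \<equiv> ball 0 1"

text \<open>Isometries are restricted to the disc, so that they are elements of
  \<^term>\<open>BijGroup hdisc\<close>. Every orientation-preserving isometry of the hyperbolic disc is of the
  form \<open>disc_isometry t w\<close> with \<open>cmod w < 1\<close>; the point \<open>w\<close> and the unit complex number \<open>cis t\<close>
  are uniquely determined, and the isometry group carries the topology of the pairs \<open>(cis t, w)\<close>.\<close>

definition disc_isometry :: "real \<Rightarrow> complex \<Rightarrow> complex \<Rightarrow> complex" where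
  "disc_isometry t w = restrict (Moebius_function t w) hdisc"

definition fuchsian_group :: "(complex \<Rightarrow> complex) set \<Rightarrow> bool" where
  "fuchsian_group G \<longleftrightarrow>
     subgroup G (BijGroup hdisc) \<and>
     (\<forall>g\<in>G. \<exists>t w. cmod w < 1 \<and> g = disc_isometry t w) \<and>
     discrete {(cis t, w) | t w. cmod w < 1 \<and> disc_isometry t w \<in> G}"

definition finitely_generated :: "(complex \<Rightarrow> complex) set \<Rightarrow> bool" where
  "finitely_generated G \<longleftrightarrow> (\<exists>S. finite S \<and> S \<subseteq> G \<and> generate (BijGroup hdisc) S = G)"

definition limit_set :: "(complex \<Rightarrow> complex) set \<Rightarrow> complex set" where
  "limit_set G = {\<xi>. \<exists>z\<in>hdisc. \<xi> islimpt (\<lambda>g. g z) ` G}"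

definition non_elementary :: "(complex \<Rightarrow> complex) set \<Rightarrow> bool" where
  "non_elementary G \<longleftrightarrow> \<not> (finite (limit_set G) \<and> card (limit_set G) \<le> 2)"

text \<open>For \<open>b = 0\<close> the equation below describes a diameter; for \<open>b \<noteq> 0\<close> it describes the circle
  with centre \<open>c / b\<close> and squared radius \<open>(cmod c / b)\<^sup>2 - 1\<close>, which is orthogonal to the unit
  circle. With \<open>\<bar>b\<bar> < cmod c\<close> these are exactly the complete hyperbolic geodesics.\<close>

definition geodesic :: "real \<Rightarrow> complex \<Rightarrow> complex set" where
  "geodesic b c = {z \<in> hdisc. 2 * (c \<bullet> z) = b * (1 + (cmod z)\<^sup>2)}"

definition half_plane :: "real \<Rightarrow> complex \<Rightarrow> complex set" where
  "half_plane b c = {z \<in> hdisc. 2 * (c \<bullet> z) \<le> b * (1 + (cmod z)\<^sup>2)}"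

definition geodesic_line :: "complex set \<Rightarrow> bool" where
  "geodesic_line L \<longleftrightarrow> (\<exists>b c. \<bar>b\<bar> < cmod c \<and> L = geodesic b c)"

text \<open>Closed (in the disc) convex polygons, possibly with vertices or whole arcs at infinity.\<close>

definition convex_polygon :: "complex set \<Rightarrow> bool" where
  "convex_polygon P \<longleftrightarrow>
     (\<exists>H. finite H \<and> (\<forall>(b, c)\<in>H. \<bar>b\<bar> < cmod c) \<and> P = hdisc \<inter> (\<Inter>(b, c)\<in>H. half_plane b c)) \<and>
     interior P \<noteq> {}"

text \<open>Since different sides lie on different geodesics, all interior angles at vertices are
  strictly less than \<open>pi\<close>. Vertices are always vertices in the open disc.\<close>

definition sides :: "complex set \<Rightarrow> complex set set" where
  "sides P = {s. \<exists>b c. \<bar>b\<bar> < cmod c \<and> P \<subseteq> half_plane b c \<and> s = P \<inter> geodesic b c \<and>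
                       (\<exists>x\<in>s. \<exists>y\<in>s. x \<noteq> y)}"

definition vertices :: "complex set \<Rightarrow> complex set" where
  "vertices P = {v. \<exists>s\<in>sides P. \<exists>t\<in>sides P. s \<noteq> t \<and> v \<in> s \<and> v \<in> t}"

definition adjacent_along :: "complex set \<Rightarrow> complex set \<Rightarrow> complex set \<Rightarrow> bool" where
  "adjacent_along P Q s \<longleftrightarrow> P \<noteq> Q \<and> s \<in> sides P \<and> s \<in> sides Q"

text \<open>The isometry \<open>Moebius_function 0 v\<close> sends \<open>v\<close> to the origin and geodesics through \<open>v\<close> to
  diameters, so a positive value means that \<open>z\<close> lies to the left of the geodesic running
  from \<open>v\<close> to \<open>w\<close>.\<close>

definition turn :: "complex \<Rightarrow> complex \<Rightarrow> complex \<Rightarrow> real" where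
  "turn v w z = Im (cnj (Moebius_function 0 v w) * Moebius_function 0 v z)"

text \<open>Left and right are those of an observer crossing \<open>s\<close> from outside to inside \<open>P\<close>: seen from
  the left end, the side runs with the interior of \<open>P\<close> on its left.\<close>

definition left_end :: "complex set \<Rightarrow> complex set \<Rightarrow> complex \<Rightarrow> bool" where
  "left_end P s v \<longleftrightarrow> v \<in> s \<and> (\<forall>w\<in>s - {v}. \<forall>z\<in>interior P. turn v w z > 0)"

definition right_end :: "complex set \<Rightarrow> complex set \<Rightarrow> complex \<Rightarrow> bool" where
  "right_end P s v \<longleftrightarrow> v \<in> s \<and> (\<forall>w\<in>s - {v}. \<forall>z\<in>interior P. turn v w z < 0)"

definition fundamental_domain :: "(complex \<Rightarrow> complex) set \<Rightarrow> complex set \<Rightarrow> bool" where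
  "fundamental_domain G R \<longleftrightarrow>
     (\<Union>g\<in>G. g ` R) = hdisc \<and>
     (\<forall>g\<in>G. g \<noteq> \<one>\<^bsub>BijGroup hdisc\<^esub> \<longrightarrow> interior R \<inter> interior (g ` R) = {})"

type_synonym label = "complex \<Rightarrow> complex"

abbreviation linv :: "label \<Rightarrow> label" where
  "linv e \<equiv> inv\<^bsub>BijGroup hdisc\<^esub> e"

datatype 'l state =
    A_0 'l
  | A_L nat nat 'l
  | A_R nat nat 'l
  | A_LR nat nat 'l
  | A_RL nat nat 'l
  | B 'l 'l
  | C nat 'l 'l
  | D 'l 'l
  | E_L 'l 'l 'l
  | E_R 'l 'l 'l

locale tiling =
  fixes G :: "label set" and R :: "complex set"
begin

definition tile_boundary :: "complex set" where
  "tile_boundary = (\<Union>g\<in>G. frontier (g ` R) \<inter> hdisc)"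

definition num_lines :: "complex \<Rightarrow> nat" where
  "num_lines v = card {L. geodesic_line L \<and> L \<subseteq> tile_boundary \<and> v \<in> L}"

definition pairs_side :: "complex set \<Rightarrow> label \<Rightarrow> bool" where
  "pairs_side s e \<longleftrightarrow> e \<in> G \<and> e ` s \<in> sides R \<and> adjacent_along R (e ` R) (e ` s)"

definition labels :: "label set" where
  "labels = {e. \<exists>s\<in>sides R. pairs_side s e}"

definition side_of :: "label \<Rightarrow> complex set" where
  "side_of e = (THE s. adjacent_along R (linv e ` R) s)"

definition v_L :: "label \<Rightarrow> complex option" where
  "v_L e = (if \<exists>v. left_end R (side_of e) v then Some (THE v. left_end R (side_of e) v) else None)"

definition v_R :: "label \<Rightarrow> complex option" where
  "v_R e = (if \<exists>v. right_end R (side_of e) v then Some (THE v. right_end R (side_of e) v) else None)"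

definition l :: "label \<Rightarrow> label option" where
  "l e = (case v_L e of None \<Rightarrow> None
                      | Some v \<Rightarrow> Some (THE f. f \<in> labels \<and> v_R (linv f) = Some v))"

definition r :: "label \<Rightarrow> label option" where
  "r e = (case v_R e of None \<Rightarrow> None
                      | Some v \<Rightarrow> Some (THE f. f \<in> labels \<and> v_L (linv f) = Some v))"

definition l_iter :: "nat \<Rightarrow> label \<Rightarrow> label option" where
  "l_iter m e = ((\<lambda>x. Option.bind x l) ^^ m) (Some e)"

definition adjacent_via :: "complex \<Rightarrow> label \<Rightarrow> label \<Rightarrow> bool" where
  "adjacent_via v e1 e2 \<longleftrightarrow>
     (v_L (linv e1) = Some v \<and> v_R (linv e2) = Some v) \<or>
     (v_L (linv e2) = Some v \<and> v_R (linv e1) = Some v)"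

definition adjacent :: "label \<Rightarrow> label \<Rightarrow> bool" where
  "adjacent e1 e2 \<longleftrightarrow> e1 = e2 \<or> (\<exists>v. adjacent_via v e1 e2)"

text \<open>Used only for labels with \<open>v_R eL\<close> defined, as is the case in all \<open>B\<close>- and \<open>C\<close>-states.\<close>

definition n_lab :: "label \<Rightarrow> label \<Rightarrow> nat" where
  "n_lab eL eR = num_lines (the (v_R eL))"

text \<open>The label of the compact side when there are three sides, one of them compact.\<close>

definition special :: "label \<Rightarrow> bool" where
  "special g \<longleftrightarrow> g \<in> labels \<and> card (sides R) = 3 \<and> compact (side_of g)"

fun is_state :: "label state \<Rightarrow> bool" where
  "is_state (A_0 e) \<longleftrightarrow> e \<in> labels \<and> \<not> special e"
| "is_state (A_L i p e) \<longleftrightarrow> e \<in> labels \<and> 1 \<le> i \<and> 1 \<le> p \<and>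
     (\<exists>v. v_L e = Some v \<and> 3 \<le> i + p \<and> i + p \<le> num_lines v) \<and>
     \<not> (special e \<and> (i = 1 \<or> p = 1))"
| "is_state (A_R i p e) \<longleftrightarrow> e \<in> labels \<and> 1 \<le> i \<and> 1 \<le> p \<and>
     (\<exists>v. v_R e = Some v \<and> 3 \<le> i + p \<and> i + p \<le> num_lines v) \<and>
     \<not> (special e \<and> (i = 1 \<or> p = 1))"
| "is_state (A_LR i p e) \<longleftrightarrow> e \<in> labels \<and>
     (\<exists>v w. v_L e = Some v \<and> v_R e = Some w \<and>
            2 \<le> i \<and> i + 1 \<le> num_lines v \<and> 2 \<le> p \<and> p + 1 \<le> num_lines w)"
| "is_state (A_RL i p e) \<longleftrightarrow> e \<in> labels \<and>
     (\<exists>v w. v_L e = Some v \<and> v_R e = Some w \<and>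
            2 \<le> i \<and> i + 1 \<le> num_lines w \<and> 2 \<le> p \<and> p + 1 \<le> num_lines v)"
| "is_state (B eL eR) \<longleftrightarrow> eL \<in> labels \<and> eR \<in> labels \<and>
     (\<exists>v. v_L (linv eL) = Some v \<and> v_R (linv eR) = Some v)"
| "is_state (C k eL eR) \<longleftrightarrow> eL \<in> labels \<and> eR \<in> labels \<and>
     1 \<le> k \<and> k + 2 \<le> n_lab eL eR \<and> l_iter (2 * k + 1) (linv eL) = Some eR"
| "is_state (D eL eR) \<longleftrightarrow> eL \<in> labels \<and> eR \<in> labels \<and>
     (\<exists>v. v_R eL = Some v \<and> v_L eR = Some v)"
| "is_state (E_L eL eM eR) \<longleftrightarrow> eL \<in> labels \<and> eM \<in> labels \<and> eR \<in> labels \<and>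
     (\<exists>v. v_L (linv eL) = Some v \<and> v_R (linv eM) = Some v) \<and>
     (\<exists>v. v_R eM = Some v \<and> v_L eR = Some v)"
| "is_state (E_R eL eM eR) \<longleftrightarrow> eL \<in> labels \<and> eM \<in> labels \<and> eR \<in> labels \<and>
     (\<exists>v. v_R eL = Some v \<and> v_L eM = Some v) \<and>
     (\<exists>v. v_L (linv eM) = Some v \<and> v_R (linv eR) = Some v)"

definition \<Xi> :: "label state set" where
  "\<Xi> = {j. is_state j}"

definition \<Xi>_S :: "label state set" where
  "\<Xi>_S = \<Xi> \<inter>
     ({A_0 e | e. True} \<union> {A_L 1 p e | p e. True} \<union> {A_R 1 p e | p e. True} \<union>
      {B eL eR | eL eR. True} \<union>
      {A_LR 2 p g | p g. special g} \<union> {A_RL 2 p g | p g. special g})"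

definition \<Xi>_F :: "label state set" where
  "\<Xi>_F = \<Xi> \<inter>
     ({A_0 e | e. True} \<union> {A_L i 1 e | i e. True} \<union> {A_R i 1 e | i e. True} \<union>
      {D eL eR | eL eR. True} \<union>
      {A_LR i 2 g | i g. special g} \<union> {A_RL i 2 g | i g. special g})"

text \<open>The labels produced by \<open>l\<close> and \<open>r\<close> in a rule have to be defined for the rule to apply.
  The rules are formulas only: that both states belong to \<open>\<Xi>\<close> is required in \<open>trans_matrix\<close> below. Rules
  such as ``the same transitions as'' may thus pass through terms that are not states, for instance
  \<open>C 0 eL eR\<close>.\<close>

inductive admissible :: "label state \<Rightarrow> label state \<Rightarrow> bool" where
  A_0_A_0: "\<not> adjacent e' (linv e) \<Longrightarrow> admissible (A_0 e) (A_0 e')"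
| A_0_A_L: "\<not> adjacent e' (linv e) \<Longrightarrow> admissible (A_0 e) (A_L 1 p e')"
| A_0_A_R: "\<not> adjacent e' (linv e) \<Longrightarrow> admissible (A_0 e) (A_R 1 p e')"
| A_0_B: "\<not> adjacent eL (linv e) \<Longrightarrow> \<not> adjacent eR (linv e) \<Longrightarrow> admissible (A_0 e) (B eL eR)"

| A_L_A_L: "1 < p \<Longrightarrow> l e = Some f \<Longrightarrow> admissible (A_L i p e) (A_L (i + 1) (p - 1) f)"
| A_L_A_LR: "l e = Some f \<Longrightarrow> admissible (A_L i 2 e) (A_LR (i + 1) q f)"
| A_L_B: "l e = Some f \<Longrightarrow> l (linv f) = Some f' \<Longrightarrow> admissible (A_L i 2 e) (B f f')"
| A_L_end: "admissible (A_0 e) k \<Longrightarrow> admissible (A_L i 1 e) k"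
| A_RL: "admissible (A_L 1 p e) k \<Longrightarrow> admissible (A_RL i p e) k"

| A_R_A_R: "1 < p \<Longrightarrow> r e = Some f \<Longrightarrow> admissible (A_R i p e) (A_R (i + 1) (p - 1) f)"
| A_R_A_RL: "r e = Some f \<Longrightarrow> admissible (A_R i 2 e) (A_RL (i + 1) q f)"
| A_R_B: "r e = Some f \<Longrightarrow> r (linv f) = Some f' \<Longrightarrow> admissible (A_R i 2 e) (B f' f)"
| A_R_end: "admissible (A_0 e) k \<Longrightarrow> admissible (A_R i 1 e) k"
| A_LR: "admissible (A_R 1 p e) k \<Longrightarrow> admissible (A_LR i p e) k"

| B_C: "n_lab eL eR \<ge> 3 \<Longrightarrow> r eL = Some fL \<Longrightarrow> l eR = Some fR \<Longrightarrow>
     admissible (B eL eR) (C 1 fL fR)"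
| B_2: "n_lab eL eR = 2 \<Longrightarrow> admissible (C 0 eL eR) k \<Longrightarrow> admissible (B eL eR) k"

| C_C: "i + 2 < n_lab eL eR \<Longrightarrow> r eL = Some fL \<Longrightarrow> l eR = Some fR \<Longrightarrow>
     admissible (C i eL eR) (C (i + 1) fL fR)"
| C_D: "i + 2 = n_lab eL eR \<Longrightarrow> r eL = Some fL \<Longrightarrow> l eR = Some fR \<Longrightarrow>
     admissible (C i eL eR) (D fL fR)"
| C_E_L: "i + 2 = n_lab eL eR \<Longrightarrow> r eL = Some fL \<Longrightarrow> l eR = Some fR \<Longrightarrow>
     r (linv fL) = Some f \<Longrightarrow> admissible (C i eL eR) (E_L f fL fR)"
| C_E_R: "i + 2 = n_lab eL eR \<Longrightarrow> r eL = Some fL \<Longrightarrow> l eR = Some fR \<Longrightarrow>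
     l (linv fR) = Some f \<Longrightarrow> admissible (C i eL eR) (E_R fL fR f)"

| D_A_0: "\<not> adjacent e' (linv eL) \<Longrightarrow> \<not> adjacent e' (linv eR) \<Longrightarrow> admissible (D eL eR) (A_0 e')"
| D_A_L: "\<not> adjacent e' (linv eL) \<Longrightarrow> \<not> adjacent e' (linv eR) \<Longrightarrow> admissible (D eL eR) (A_L 1 p e')"
| D_A_R: "\<not> adjacent e' (linv eL) \<Longrightarrow> \<not> adjacent e' (linv eR) \<Longrightarrow> admissible (D eL eR) (A_R 1 p e')"
| D_B: "(\<And>a b. a \<in> {eL', eR'} \<Longrightarrow> b \<in> {linv eL, linv eR} \<Longrightarrow>
            \<not> adjacent a b \<or> (a \<noteq> b \<and> (\<forall>v. adjacent_via v a b \<longrightarrow> num_lines v > 2))) \<Longrightarrow>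
     admissible (D eL eR) (B eL' eR')"
| D_A_L2: "v_L eL = Some v \<Longrightarrow> num_lines v > 2 \<Longrightarrow> l eL = Some f \<Longrightarrow> admissible (D eL eR) (A_L 2 p f)"
| D_A_LR: "v_L eL = Some v \<Longrightarrow> num_lines v > 2 \<Longrightarrow> l eL = Some f \<Longrightarrow> admissible (D eL eR) (A_LR 2 p f)"
| D_A_R2: "v_R eR = Some v \<Longrightarrow> num_lines v > 2 \<Longrightarrow> r eR = Some f \<Longrightarrow> admissible (D eL eR) (A_R 2 p f)"
| D_A_RL: "v_R eR = Some v \<Longrightarrow> num_lines v > 2 \<Longrightarrow> r eR = Some f \<Longrightarrow> admissible (D eL eR) (A_RL 2 p f)"

| E_L: "admissible (B eL eM) k \<Longrightarrow> admissible (E_L eL eM eR) k"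
| E_R: "admissible (B eM eR) k \<Longrightarrow> admissible (E_R eL eM eR) k"

definition trans_matrix :: "label state \<Rightarrow> label state \<Rightarrow> nat" where
  "trans_matrix j k = (if j \<in> \<Xi> \<and> k \<in> \<Xi> \<and> admissible j k then 1 else 0)"

fun \<iota> :: "label state \<Rightarrow> label state" where
  "\<iota> (A_0 e) = A_0 (linv e)"
| "\<iota> (A_L i p e) = A_R p i (linv e)"
| "\<iota> (A_R i p e) = A_L p i (linv e)"
| "\<iota> (A_LR i p e) = A_LR p i (linv e)"
| "\<iota> (A_RL i p e) = A_RL p i (linv e)"
| "\<iota> (B eL eR) = D (linv eR) (linv eL)"
| "\<iota> (C k eL eR) = C (n_lab eL eR - k - 1) (linv eR) (linv eL)"
| "\<iota> (D eL eR) = B (linv eR) (linv eL)"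
| "\<iota> (E_L eL eM eR) = E_L (linv eR) (linv eM) (linv eL)"
| "\<iota> (E_R eL eM eR) = E_R (linv eR) (linv eM) (linv eL)"

end

locale even_corner_tiling = tiling +
  assumes fuchsian: "fuchsian_group G" "finitely_generated G" "non_elementary G"
    and polygon: "convex_polygon R"
    and fundamental: "fundamental_domain G R"
    and pairing: "\<And>s. s \<in> sides R \<Longrightarrow> \<exists>!e. pairs_side s e"
    and even_corners: "\<And>s L. s \<in> sides R \<Longrightarrow> geodesic_line L \<Longrightarrow> s \<subseteq> L \<Longrightarrow> L \<subseteq> tile_boundary"
    and side_count:
      "card (sides R) \<ge> 5 \<or>
       (card (sides R) = 4 \<and>
          (\<not> compact R \<or>
           (compact R \<and>
            \<not> (\<exists>v\<in>vertices R. \<exists>v'\<in>vertices R. v \<noteq> v' \<and> \<not> (\<exists>s\<in>sides R. v \<in> s \<and> v' \<in> s) \<and>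
                 num_lines v = 2 \<and> num_lines v' = 2)))) \<or>
       (card (sides R) = 3 \<and> \<not> compact R)"

end

theory Submission
  imports Defs
begin

text \<open>Reversing time means to invert all labels and to exchange left and right. The rules of the
  Markov chain that concern a vertex move forward by the maps \<open>l\<close> and \<open>r\<close>, that is, to the other
  side of the polygon at the vertex, and \<open>l e = Some f\<close> is equivalent to
  \<open>r (linv f) = Some (linv e)\<close> (\<open>l_props\<close>, \<open>r_props\<close>). The remaining rules are governed by
  adjacency, which is symmetric. Hence every rule read backwards is another rule; this is verified
  rule by rule up to \<open>reverse_admissible\<close>. Since \<open>\<iota>\<close> is an involution, one implication suffices.

  The facts about labels that this needs are geometric. An end of a side in the disc is a vertex, at
  which exactly one side of the polygon ends on the left and exactly one on the right
  (\<open>next_side_exists\<close>, \<open>side_at_end_unique\<close>); so \<open>l\<close> and \<open>r\<close> are what their definitions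
  suggest. A label \<open>e\<close> maps its side to the side of \<open>linv e\<close> and exchanges left and right ends, because
  adjacent tiles lie on opposite sides of their common side (\<open>end_of_linv\<close>). The number of
  lines at a vertex is invariant under the group (\<open>num_lines_image\<close>).

  The one deeper fact is needed for \<open>\<iota>\<close> to preserve the condition on \<open>C\<close>-states: iterating \<open>l\<close> exactly
  \<open>2 * n\<close> times at a vertex with \<open>n\<close> lines leads back to the initial label (\<open>l_iter_period\<close>). This is
  where even corners enter. Around the vertex each tile fills a sector between two consecutive ones
  of the \<open>2 * n\<close> rays of the \<open>n\<close> lines, so that \<open>2 * n\<close> steps make a full turn (\<open>full_turn\<close>).

  All convexity arguments take place in the Klein model, where geodesics are straight.\<close>

section \<open>The Klein model of the hyperbolic plane\<close>

text \<open>The change of coordinates from the conformal disc to the projective one. It makes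
  geodesics into Euclidean chords and half planes into Euclidean half planes, so that convexity,
  triangles and orientation can be treated by Euclidean linear algebra.\<close>

definition klein :: "complex \<Rightarrow> complex" where
  "klein z = (2 / (1 + (cmod z)\<^sup>2)) *\<^sub>R z"

lemma half_plane_klein: "z \<in> half_plane b c \<longleftrightarrow> z \<in> hdisc \<and> c \<bullet> klein z \<le> b"
proof -
  have "1 + (cmod z)\<^sup>2 > 0" by (simp add: add_pos_nonneg)
  then show ?thesis
    by (auto simp: half_plane_def klein_def inner_scaleR_right field_simps)
qed

lemma geodesic_klein: "z \<in> geodesic b c \<longleftrightarrow> z \<in> hdisc \<and> c \<bullet> klein z = b"
proof -
  have "1 + (cmod z)\<^sup>2 > 0" by (simp add: add_pos_nonneg)
  then show ?thesis
    by (auto simp: geodesic_def klein_def inner_scaleR_right field_simps)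
qed

lemma cmod_klein: "cmod (klein z) = 2 * cmod z / (1 + (cmod z)\<^sup>2)"
proof -
  have "1 + (cmod z)\<^sup>2 > 0" by (simp add: add_pos_nonneg)
  then show ?thesis by (simp add: klein_def)
qed

text \<open>The identity behind the inverse of \<open>klein\<close>: it expresses
  \<open>cmod z\<close> through \<open>sqrt (1 - (cmod (klein z))\<^sup>2)\<close>.\<close>

lemma one_minus_cmod_klein: "1 - (cmod (klein z))\<^sup>2 = ((1 - (cmod z)\<^sup>2) / (1 + (cmod z)\<^sup>2))\<^sup>2"
proof -
  have *: "1 - 4 * q / (1 + q)\<^sup>2 = ((1 - q) / (1 + q))\<^sup>2" if "1 + q > 0" for q :: real
    using that by (simp add: power_divide diff_divide_eq_iff) (simp add: power2_eq_square algebra_simps)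
  show ?thesis
    unfolding cmod_klein using *[of "(cmod z)\<^sup>2"] by (simp add: power_divide add_pos_nonneg power_mult_distrib)
qed

lemma klein_in_hdisc: "z \<in> hdisc \<Longrightarrow> klein z \<in> hdisc"
proof -
  assume "z \<in> hdisc"
  then have "cmod z < 1" by simp
  then have "(cmod z)\<^sup>2 < 1" by (simp add: power_less_one_iff abs_square_less_1)
  moreover have "1 + (cmod z)\<^sup>2 > 0" by (simp add: add_pos_nonneg)
  ultimately have "1 - (cmod (klein z))\<^sup>2 > 0"
    unfolding one_minus_cmod_klein by simp
  then have "cmod (klein z) < 1" by (simp add: abs_square_less_1)
  then show ?thesis by simp
qed

lemma klein_inverse:
  assumes "z \<in> hdisc"
  shows "klein z /\<^sub>R (1 + sqrt (1 - (cmod (klein z))\<^sup>2)) = z"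
proof -
  have c: "(cmod z)\<^sup>2 < 1" using assms by (simp add: abs_square_less_1)
  have p: "1 + (cmod z)\<^sup>2 > 0" by (simp add: add_pos_nonneg)
  have "sqrt (1 - (cmod (klein z))\<^sup>2) = (1 - (cmod z)\<^sup>2) / (1 + (cmod z)\<^sup>2)"
    unfolding one_minus_cmod_klein using c p by (simp add: real_sqrt_divide)
  then have "1 + sqrt (1 - (cmod (klein z))\<^sup>2) = 2 / (1 + (cmod z)\<^sup>2)"
    using p by (simp add: field_simps)
  then have "klein z /\<^sub>R (1 + sqrt (1 - (cmod (klein z))\<^sup>2)) =
      (inverse (2 / (1 + (cmod z)\<^sup>2)) * (2 / (1 + (cmod z)\<^sup>2))) *\<^sub>R z"
    by (simp only: klein_def[of z] scaleR_scaleR)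
  moreover have "inverse (2 / (1 + (cmod z)\<^sup>2)) * (2 / (1 + (cmod z)\<^sup>2)) = 1" using p by simp
  ultimately show ?thesis by (simp only: scaleR_one)
qed

lemma inj_on_klein: "inj_on klein hdisc"
  by (metis inj_onI klein_inverse)

lemma klein_surj: "klein ` hdisc = hdisc"
proof
  show "klein ` hdisc \<subseteq> hdisc" using klein_in_hdisc by blast
  show "hdisc \<subseteq> klein ` hdisc"
  proof
    fix y :: complex assume "y \<in> hdisc"
    then have y: "(cmod y)\<^sup>2 < 1" by (simp add: abs_square_less_1)
    define s where "s = sqrt (1 - (cmod y)\<^sup>2)"
    have s: "s > 0" "s\<^sup>2 = 1 - (cmod y)\<^sup>2" using y by (auto simp: s_def)
    define z where "z = y /\<^sub>R (1 + s)"
    have cz: "cmod z = cmod y / (1 + s)" using s(1) by (simp add: z_def field_simps)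
    have q: "(cmod z)\<^sup>2 = (1 - s) / (1 + s)"
    proof -
      have "(cmod y)\<^sup>2 = (1 - s) * (1 + s)" using s(2) by algebra
      then show ?thesis unfolding cz using s(1) by (simp add: power_divide power2_eq_square)
    qed
    have "(1 - s) / (1 + s) < 1" using s(1) by (simp add: field_simps)
    then have "(cmod z)\<^sup>2 < 1" unfolding q .
    then have "z \<in> hdisc" by (simp add: abs_square_less_1)
    have "1 + (1 - s) / (1 + s) = 2 / (1 + s)" using s(1) by (simp add: field_simps)
    then have "klein z = (2 / (2 / (1 + s)) * inverse (1 + s)) *\<^sub>R y"
      unfolding klein_def q by (simp only: z_def scaleR_scaleR)
    moreover have "2 / (2 / (1 + s)) * inverse (1 + s) = 1" using s(1) by (simp add: field_simps)
    ultimately have "klein z = y" by (simp only: scaleR_one)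
    with \<open>z \<in> hdisc\<close> show "y \<in> klein ` hdisc" by blast
  qed
qed

lemma continuous_on_klein: "continuous_on S klein"
proof -
  have "1 + (cmod z)\<^sup>2 \<noteq> 0" for z by (metis add_pos_nonneg less_irrefl zero_le_power2 zero_less_one)
  then show ?thesis unfolding klein_def by (intro continuous_intros) auto
qed

text \<open>Images of open subsets of \<open>U\<close> are open by invariance of domain, so a
  continuous injection commutes with taking interiors.\<close>

lemma interior_image_open:
  fixes f :: "'a::euclidean_space \<Rightarrow> 'a"
  assumes U: "open U" "continuous_on U f" "inj_on f U" and P: "P \<subseteq> U" and fU: "f ` U \<subseteq> U"
  shows "interior (f ` P) = f ` interior P"
proof
  have "interior P \<subseteq> U" using P interior_subset by blast
  then have "open (f ` interior P)"
    by (intro invariance_of_domain open_interior)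
       (use U in \<open>auto intro: continuous_on_subset inj_on_subset\<close>)
  then show "f ` interior P \<subseteq> interior (f ` P)"
    by (simp add: image_mono interior_maximal interior_subset)
  have "open (U \<inter> f -` interior (f ` P))"
    using continuous_open_preimage[OF U(2,1) open_interior] by blast
  moreover have "U \<inter> f -` interior (f ` P) \<subseteq> P"
  proof
    fix x assume x: "x \<in> U \<inter> f -` interior (f ` P)"
    then obtain y where "y \<in> P" "f x = f y" using interior_subset by fastforce
    then show "x \<in> P" using x P U(3) by (metis IntD1 inj_onD subsetD)
  qed
  ultimately have "U \<inter> f -` interior (f ` P) \<subseteq> interior P" by (simp add: interior_maximal)
  moreover have "interior (f ` P) \<subseteq> f ` U" using P interior_subset by blast
  ultimately show "interior (f ` P) \<subseteq> f ` interior P" by blast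
qed

lemma interior_klein_image: "P \<subseteq> hdisc \<Longrightarrow> interior (klein ` P) = klein ` interior P"
  by (rule interior_image_open[of hdisc])
     (auto simp: continuous_on_klein inj_on_klein intro: klein_in_hdisc[simplified])

definition cross :: "complex \<Rightarrow> complex \<Rightarrow> real" where
  "cross a b = Re a * Im b - Im a * Re b"

text \<open>The orientation of the triangle \<open>p w z\<close> seen in the Klein model. It is
  affine in each argument there, which the function \<open>turn\<close> is not.\<close>

definition ori :: "complex \<Rightarrow> complex \<Rightarrow> complex \<Rightarrow> real" where
  "ori p w z = cross (klein w - klein p) (klein z - klein p)"

text \<open>Both sides are positive multiples of one and the same determinant, whose rows
  \<open>(1 + (cmod x)\<^sup>2, 2 * Re x, 2 * Im x)\<close>, for
  \<open>x = v, w, z\<close>, are homogeneous coordinates of the Klein model.\<close>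

lemma turn_ori:
  assumes "v \<in> hdisc" "w \<in> hdisc" "z \<in> hdisc"
  shows "\<exists>d>0. turn v w z = d * ori v w z"
proof -
  have ne: "1 - cnj v * x \<noteq> 0" if "x \<in> hdisc" for x
  proof
    assume "1 - cnj v * x = 0"
    then have "cmod v * cmod x = 1" by (metis complex_mod_cnj eq_iff_diff_eq_0 norm_mult norm_one)
    moreover have "cmod v * cmod x < 1"
      using assms(1) that by (metis dist_0_norm mem_ball mult_strict_mono' norm_ge_zero mult_1)
    ultimately show False by simp
  qed
  define dw where "dw = (cmod (1 - cnj v * w))\<^sup>2"
  define dz where "dz = (cmod (1 - cnj v * z))\<^sup>2"
  have pos: "dw > 0" "dz > 0" using ne assms by (auto simp: dw_def dz_def)
  define X where "X x = 1 + (cmod x)\<^sup>2" for x :: complex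
  have Xpos: "X x > 0" for x by (simp add: X_def add_pos_nonneg)
  have kl: "klein x = (2 / X x) *\<^sub>R x" for x by (simp add: klein_def X_def)
  \<comment> \<open>a quarter of the determinant of the homogeneous coordinates\<close>
  define om where "om = X v * Im (cnj w * z) + X w * Im (cnj z * v) + X z * Im (cnj v * w)"
  have 1: "ori v w z = 4 * om / (X v * X w * X z)"
    using Xpos[of v] Xpos[of w] Xpos[of z]
    by (simp add: ori_def cross_def kl om_def field_simps)
  have 2: "turn v w z = (1 - (cmod v)\<^sup>2) * om / (dw * dz)"
  proof -
    have q: "a / b = a * cnj b / of_real ((cmod b)\<^sup>2)" for a b :: complex
      by (metis complex_div_cnj)
    have "turn v w z = Im (cnj ((w - v) * (1 - v * cnj w)) * ((z - v) * (1 - v * cnj z))) / (dw * dz)"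
      unfolding turn_def Moebius_function_simple
      unfolding q[of "w - v"] q[of "z - v"] dw_def[symmetric] dz_def[symmetric]
      using pos by (simp add: mult.commute)
    also have "Im (cnj ((w - v) * (1 - v * cnj w)) * ((z - v) * (1 - v * cnj z))) = (1 - (cmod v)\<^sup>2) * om"
      unfolding om_def X_def cmod_power2 by simp algebra
    finally show ?thesis .
  qed
  have v1: "1 - (cmod v)\<^sup>2 > 0" using assms(1) by (simp add: abs_square_less_1)
  show ?thesis
  proof (intro exI conjI)
    show "(1 - (cmod v)\<^sup>2) * (X v * X w * X z) / (4 * dw * dz) > 0"
      using v1 pos Xpos[of v] Xpos[of w] Xpos[of z] by simp
    show "turn v w z = (1 - (cmod v)\<^sup>2) * (X v * X w * X z) / (4 * dw * dz) * ori v w z"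
      unfolding 1 2 using pos Xpos[of v] Xpos[of w] Xpos[of z] by (simp add: field_simps)
  qed
qed

lemma turn_sign:
  assumes "v \<in> hdisc" "w \<in> hdisc" "z \<in> hdisc"
  shows "turn v w z > 0 \<longleftrightarrow> ori v w z > 0" "turn v w z < 0 \<longleftrightarrow> ori v w z < 0"
  using turn_ori[OF assms] by (auto simp: zero_less_mult_iff mult_less_0_iff)

section \<open>Sides and ends of sides of convex polygons\<close>

lemma cross_scaleR [simp]: "cross (a *\<^sub>R x) y = a * cross x y" "cross x (a *\<^sub>R y) = a * cross x y"
  by (simp_all add: cross_def algebra_simps)

text \<open>Cramer's rule: the coordinates of a vector in the basis \<open>d, d'\<close> are
  quotients of cross products.\<close>

lemma cross_basis: "cross d d' *\<^sub>R y = cross y d' *\<^sub>R d + cross d y *\<^sub>R d'"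
  by (simp add: complex_eq_iff cross_def algebra_simps)

text \<open>Lagrange's identity in the plane.\<close>

lemma inner_cross: "cross d c * cross d x = (d \<bullet> d) * (c \<bullet> x) - (c \<bullet> d) * (d \<bullet> x)"
  unfolding cross_def inner_complex_def by algebra

text \<open>In the plane a vector orthogonal to \<open>d\<close> is a multiple of \<open>d\<close>
  turned by a right angle. This translates between the description of a line by a normal vector
  and by two of its points.\<close>

lemma normal_cross:
  assumes "c \<bullet> d = 0" "d \<noteq> 0" "c \<noteq> 0"
  obtains \<rho> where "\<rho> \<noteq> 0" "\<And>x. c \<bullet> x = \<rho> * cross d x"
proof
  have dd: "d \<bullet> d \<noteq> 0" "c \<bullet> c \<noteq> 0" using assms by auto
  have *: "cross d c * cross d x = (d \<bullet> d) * (c \<bullet> x)" for x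
    using assms(1) by (simp add: inner_cross)
  show "cross d c / (d \<bullet> d) \<noteq> 0" using *[of c] dd by auto
  show "c \<bullet> x = cross d c / (d \<bullet> d) * cross d x" for x
    using *[of x] dd by (simp add: field_simps)
qed

lemma ori_self [simp]: "ori p w p = 0" "ori p w w = 0" "ori p p z = 0"
  by (simp_all add: ori_def cross_def)

lemma ori_swap: "ori w p z = - ori p w z" "ori p z w = - ori p w z"
  by (simp_all add: ori_def cross_def algebra_simps)

lemma klein_eq_iff: "x \<in> hdisc \<Longrightarrow> y \<in> hdisc \<Longrightarrow> klein x = klein y \<longleftrightarrow> x = y"
  by (metis inj_onD inj_on_klein)

lemma geodesic_ori:
  assumes "\<bar>b\<bar> < cmod c" "p \<in> geodesic b c" "w \<in> geodesic b c" "p \<noteq> w"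
  obtains \<rho> where "\<rho> \<noteq> 0" "\<And>x. c \<bullet> klein x - b = \<rho> * ori p w x"
proof -
  have p: "p \<in> hdisc" "w \<in> hdisc" "c \<bullet> klein p = b" "c \<bullet> klein w = b"
    using assms geodesic_klein by auto
  have "c \<bullet> (klein w - klein p) = 0" "klein w - klein p \<noteq> 0" "c \<noteq> 0"
    using p assms klein_eq_iff by (auto simp: inner_diff_right)
  then obtain \<rho> where "\<rho> \<noteq> 0" and \<rho>: "\<And>x. c \<bullet> x = \<rho> * cross (klein w - klein p) x"
    by (rule normal_cross) blast
  have "c \<bullet> klein x - b = \<rho> * ori p w x" for x
    using \<rho>[of "klein x - klein p"] p(3) by (simp add: ori_def inner_diff_right)
  with \<open>\<rho> \<noteq> 0\<close> show ?thesis by (rule that)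
qed

lemma half_plane_subset: "half_plane b c \<subseteq> hdisc"
  by (auto simp: half_plane_def)

lemma polygon_subset: "convex_polygon P \<Longrightarrow> P \<subseteq> hdisc"
  unfolding convex_polygon_def by blast

lemma polygon_interior: "convex_polygon P \<Longrightarrow> interior P \<noteq> {}"
  unfolding convex_polygon_def by blast

lemma klein_polygon:
  assumes "P = hdisc \<inter> (\<Inter>(b, c)\<in>H. half_plane b c)"
  shows "klein ` P = hdisc \<inter> (\<Inter>(b, c)\<in>H. {y. c \<bullet> y \<le> b})"
proof -
  have "klein ` P \<subseteq> hdisc \<inter> (\<Inter>(b, c)\<in>H. {y. c \<bullet> y \<le> b})"
    using assms klein_in_hdisc by (auto simp: half_plane_klein)
  moreover have "y \<in> klein ` P" if "y \<in> hdisc \<inter> (\<Inter>(b, c)\<in>H. {y. c \<bullet> y \<le> b})" for y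
  proof -
    have "y \<in> klein ` hdisc" using that unfolding klein_surj by (rule IntD1)
    then obtain z where "z \<in> hdisc" "y = klein z" by (elim imageE)
    moreover have "z \<in> P"
      unfolding assms using that \<open>z \<in> hdisc\<close> \<open>y = klein z\<close>
      by (auto simp: half_plane_klein case_prod_beta)
    ultimately show ?thesis by simp
  qed
  ultimately show ?thesis by blast
qed

lemma convex_klein_polygon:
  assumes "convex_polygon P"
  shows "convex (klein ` P)"
proof -
  obtain H where "P = hdisc \<inter> (\<Inter>(b, c)\<in>H. half_plane b c)"
    using assms unfolding convex_polygon_def by blast
  then have *: "klein ` P = hdisc \<inter> (\<Inter>(b, c)\<in>H. {y. c \<bullet> y \<le> b})" by (rule klein_polygon)
  show ?thesis unfolding *
    by (intro convex_Int convex_ball convex_INT) (auto simp: convex_halfspace_le)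
qed

lemma polygon_in_closure_interior:
  assumes "convex_polygon P" "x \<in> P"
  shows "klein x \<in> closure (klein ` interior P)"
proof -
  have "interior (klein ` P) = klein ` interior P"
    by (rule interior_klein_image[OF polygon_subset[OF assms(1)]])
  moreover have "closure (interior (klein ` P)) = closure (klein ` P)"
    by (rule convex_closure_interior[OF convex_klein_polygon[OF assms(1)]])
       (simp only: calculation image_is_empty polygon_interior[OF assms(1)] not_False_eq_True)
  ultimately have "closure (klein ` interior P) = closure (klein ` P)" by simp
  moreover have "klein x \<in> closure (klein ` P)"
    by (rule subsetD[OF closure_subset]) (rule imageI[OF assms(2)])
  ultimately show ?thesis by simp
qed

text \<open>Every point of a polygon is a limit of interior points, because the Klein image is
  convex with non-empty interior; weak inequalities on the interior therefore extend to the
  sides.\<close>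

lemma ori_nonneg_on_polygon:
  assumes "convex_polygon P" "\<And>z. z \<in> interior P \<Longrightarrow> \<sigma> * ori p w z \<ge> 0" "x \<in> P"
  shows "\<sigma> * ori p w x \<ge> 0"
proof -
  let ?S = "{y. \<sigma> * cross (klein w - klein p) (y - klein p) \<ge> 0}"
  have "closed ?S" unfolding cross_def by (intro closed_Collect_le continuous_intros)
  moreover have "klein ` interior P \<subseteq> ?S" using assms(2) by (auto simp: ori_def)
  ultimately have "closure (klein ` interior P) \<subseteq> ?S" by (simp add: closure_minimal)
  then show ?thesis using polygon_in_closure_interior[OF assms(1,3)] by (auto simp: ori_def)
qed

lemma interior_half_plane_strict:
  assumes "P \<subseteq> half_plane b c" "\<bar>b\<bar> < cmod c" "z \<in> interior P"
  shows "c \<bullet> klein z < b"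
proof -
  have "P \<subseteq> hdisc" using assms(1) half_plane_subset by (rule order_trans)
  then have "klein z \<in> interior (klein ` P)" using assms(3) by (simp add: interior_klein_image)
  moreover have "klein ` P \<subseteq> {y. c \<bullet> y \<le> b}" using assms(1) by (auto simp: half_plane_klein)
  ultimately have "klein z \<in> interior {y. c \<bullet> y \<le> b}" using interior_mono[THEN subsetD] by metis
  moreover have "c \<noteq> 0" using assms(2) by auto
  ultimately show ?thesis by simp
qed

lemma sides_subset: "s \<in> sides P \<Longrightarrow> s \<subseteq> P"
  unfolding sides_def by blast

lemma side_other_point:
  assumes "s \<in> sides P"
  obtains w where "w \<in> s" "w \<noteq> p"
proof -
  obtain x y where "x \<in> s" "y \<in> s" "x \<noteq> y" using assms by (auto simp: sides_def)
  then show ?thesis using that by metis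
qed

text \<open>A side is determined by any two of its points: it is cut out of the polygon by the
  line through them, and the polygon lies on one side \<open>\<sigma>\<close> of this line. It is
  the interface through which sides are used below.\<close>

lemma side_ori:
  assumes P: "convex_polygon P" and s: "s \<in> sides P" and pw: "p \<in> s" "w \<in> s" "p \<noteq> w"
  obtains \<sigma> :: real where "\<sigma> \<in> {1, -1}" "s = {x \<in> P. ori p w x = 0}"
    "\<And>z. z \<in> interior P \<Longrightarrow> \<sigma> * ori p w z > 0" "\<And>x. x \<in> P \<Longrightarrow> \<sigma> * ori p w x \<ge> 0"
proof -
  obtain b c where bc: "\<bar>b\<bar> < cmod c" "P \<subseteq> half_plane b c" "s = P \<inter> geodesic b c"
    using s unfolding sides_def by auto
  have "p \<in> geodesic b c" "w \<in> geodesic b c" using pw bc(3) by auto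
  then obtain \<rho> where \<rho>: "\<rho> \<noteq> 0" "\<And>x. c \<bullet> klein x - b = \<rho> * ori p w x"
    using geodesic_ori[OF bc(1) _ _ pw(3)] by metis
  have s': "s = {x \<in> P. ori p w x = 0}"
  proof -
    have "x \<in> geodesic b c \<longleftrightarrow> ori p w x = 0" if "x \<in> P" for x
      using \<rho>(1) \<rho>(2)[of x] subsetD[OF polygon_subset[OF P] that]
      by (simp add: geodesic_klein) (metis diff_eq_diff_eq diff_self mult_eq_0_iff)
    then show ?thesis using bc(3) by blast
  qed
  have i: "- sgn \<rho> * ori p w z > 0" if "z \<in> interior P" for z
  proof -
    have "\<rho> * ori p w z < 0" using interior_half_plane_strict[OF bc(2,1) that] \<rho>(2)[of z] by simp
    then show ?thesis using \<rho>(1) by (auto simp: sgn_if mult_less_0_iff)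
  qed
  show ?thesis
  proof (rule that[of "- sgn \<rho>"])
    show "- sgn \<rho> \<in> {1, -1}" using \<rho>(1) by (auto simp: sgn_if)
    show "- sgn \<rho> * ori p w x \<ge> 0" if "x \<in> P" for x
      using ori_nonneg_on_polygon[OF P less_imp_le[OF i] that] .
  qed (fact s' i)+
qed

text \<open>Left and right ends in a single notion, with \<open>\<sigma> = 1\<close> for left
  and \<open>\<sigma> = - 1\<close> for right: mirror images of an argument are then covered by
  the argument itself.\<close>

definition end_of :: "real \<Rightarrow> complex set \<Rightarrow> complex set \<Rightarrow> complex \<Rightarrow> bool" where
  "end_of \<sigma> P s v \<longleftrightarrow> v \<in> s \<and> (\<forall>w\<in>s - {v}. \<forall>z\<in>interior P. \<sigma> * ori v w z > 0)"

lemma ends_end_of: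
  assumes "P \<subseteq> hdisc" "s \<subseteq> P"
  shows "left_end P s v \<longleftrightarrow> end_of 1 P s v" "right_end P s v \<longleftrightarrow> end_of (- 1) P s v"
proof -
  have turn: "turn v w z > 0 \<longleftrightarrow> ori v w z > 0" "turn v w z < 0 \<longleftrightarrow> ori v w z < 0"
    if "v \<in> s" "w \<in> s" "z \<in> interior P" for v w z
  proof -
    have "v \<in> hdisc" "w \<in> hdisc" "z \<in> hdisc"
      using that subsetD[OF assms(1)] subsetD[OF assms(2)] subsetD[OF interior_subset[of P]] by metis+
    then show "turn v w z > 0 \<longleftrightarrow> ori v w z > 0" "turn v w z < 0 \<longleftrightarrow> ori v w z < 0"
      by (rule turn_sign)+
  qed
  show "left_end P s v \<longleftrightarrow> end_of 1 P s v"
    unfolding left_end_def end_of_def by (intro conj_cong ball_cong refl) (simp add: turn)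
  show "right_end P s v \<longleftrightarrow> end_of (- 1) P s v"
    unfolding right_end_def end_of_def by (intro conj_cong ball_cong refl) (simp add: turn)
qed

lemma end_of_unique:
  assumes P: "convex_polygon P" and v: "end_of \<sigma> P s v" "end_of \<sigma> P s v'"
  shows "v = v'"
proof (rule ccontr)
  assume "v \<noteq> v'"
  obtain z where z: "z \<in> interior P" using polygon_interior[OF P] by blast
  have "\<sigma> * ori v v' z > 0" "\<sigma> * ori v' v z > 0" using v z \<open>v \<noteq> v'\<close> by (auto simp: end_of_def)
  then show False by (simp add: ori_swap(1)[of v' v])
qed

lemma end_of_nonneg:
  assumes "convex_polygon P" "end_of \<sigma> P s v" "w \<in> s" "x \<in> P"
  shows "\<sigma> * ori v w x \<ge> 0"
proof (cases "w = v")
  case False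
  then show ?thesis
    using assms by (intro ori_nonneg_on_polygon[OF assms(1) _ assms(4)]) (auto simp: end_of_def intro: less_imp_le)
qed simp

lemma side_line:
  assumes "convex_polygon P" "s \<in> sides P" "p \<in> s" "w \<in> s" "p \<noteq> w"
  shows "s = {x \<in> P. ori p w x = 0}"
  by (rule side_ori[OF assms], assumption)

text \<open>With points \<open>w\<close> and \<open>w'\<close> on the two sides, neither can lie
  strictly beyond the other as seen from \<open>v\<close>, so \<open>v, w, w'\<close> are
  collinear.\<close>

lemma side_at_end_unique:
  assumes P: "convex_polygon P" and st: "s \<in> sides P" "t \<in> sides P"
    and e: "end_of \<sigma> P s v" "end_of \<sigma> P t v"
  shows "s = t"
proof -
  obtain w where w: "w \<in> s" "w \<noteq> v" using side_other_point[OF st(1)] by metis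
  obtain w' where w': "w' \<in> t" "w' \<noteq> v" using side_other_point[OF st(2)] by metis
  have v: "v \<in> s" "v \<in> t" using e by (auto simp: end_of_def)
  obtain z where z: "z \<in> interior P" using polygon_interior[OF P] by auto
  have "\<sigma> * ori v w z > 0" using e w z by (auto simp: end_of_def)
  then have "\<sigma> \<noteq> 0" by auto
  have in_P: "w \<in> P" "w' \<in> P" using w w' subsetD[OF sides_subset] st by metis+
  have "\<sigma> * ori v w w' \<ge> 0" "\<sigma> * ori v w' w \<ge> 0"
    using end_of_nonneg[OF P e(1) w(1) in_P(2)] end_of_nonneg[OF P e(2) w'(1) in_P(1)] .
  then have "ori v w w' = 0" using \<open>\<sigma> \<noteq> 0\<close> by (simp add: ori_swap(2)[of v w' w])
  then have "w' \<in> s" using side_line[OF P st(1) v(1) w(1) w(2)[symmetric]] in_P by auto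
  then show ?thesis
    using side_line[OF P st(1) v(1) _ w'(2)[symmetric]] side_line[OF P st(2) v(2) w'(1) w'(2)[symmetric]]
    by simp
qed

lemma triangle_interior:
  assumes P: "convex_polygon P" and V: "p \<in> P" "w \<in> P" "z \<in> P" and nd: "ori p w z \<noteq> 0"
    and abc: "a > 0" "b > 0" "a + b < 1"
  obtains x where "x \<in> interior P" "klein x = klein p + a *\<^sub>R (klein w - klein p) + b *\<^sub>R (klein z - klein p)"
proof -
  let ?T = "convex hull {klein p, klein w, klein z}"
  have "\<not> collinear {klein p, klein w, klein z}"
  proof
    assume "collinear {klein p, klein w, klein z}"
    then have "collinear {0, klein w - klein p, klein z - klein p}"
      using collinear_3[of "klein w" "klein p" "klein z"] by (simp add: insert_commute)
    then have "klein w - klein p = 0 \<or> klein z - klein p = 0 \<or>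
        (\<exists>k. klein z - klein p = k *\<^sub>R (klein w - klein p))"
      by (simp add: collinear_lemma)
    then show False using nd unfolding ori_def by (elim disjE exE) (simp_all add: cross_def)
  qed
  then have *: "interior ?T = {v. \<exists>x y u. 0 < x \<and> 0 < y \<and> 0 < u \<and> x + y + u = 1 \<and>
      x *\<^sub>R klein p + y *\<^sub>R klein w + u *\<^sub>R klein z = v}"
    by (rule interior_convex_hull_3_minimal) simp
  let ?y = "klein p + a *\<^sub>R (klein w - klein p) + b *\<^sub>R (klein z - klein p)"
  have "?y \<in> interior ?T"
    unfolding * using abc
    by (intro CollectI exI[of _ "1 - a - b"] exI[of _ a] exI[of _ b]) (simp add: algebra_simps)
  moreover have "?T \<subseteq> klein ` P"
    using V by (intro hull_minimal convex_klein_polygon P) auto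
  ultimately have "?y \<in> interior (klein ` P)" using interior_mono[THEN subsetD] by metis
  then have "?y \<in> klein ` interior P" by (simp only: interior_klein_image[OF polygon_subset[OF P]])
  then show ?thesis using that by (elim imageE) metis
qed

text \<open>Two convex sets that share a segment and have interior points on the same side of it
  overlap near the midpoint of the segment: a point moved slightly from the midpoint towards
  \<open>z'\<close> lies in the open triangle \<open>p w z'\<close>, and also in the open
  triangle \<open>p w z\<close>. Hence distinct tiles that share a side lie on opposite sides of
  it.\<close>

lemma interiors_overlap:
  assumes PQ: "convex_polygon P" "convex_polygon Q"
    and V: "p \<in> P \<inter> Q" "w \<in> P \<inter> Q" and z: "z \<in> interior P" "z' \<in> interior Q"
    and o: "\<sigma> * ori p w z > 0" "\<sigma> * ori p w z' > 0"
  shows "interior P \<inter> interior Q \<noteq> {}"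
proof -
  let ?d = "klein w - klein p"
  have V': "p \<in> P" "p \<in> Q" "w \<in> P" "w \<in> Q" using V by auto
  have "ori p w z * ori p w z' > 0"
    using o by (auto simp: zero_less_mult_iff)
  moreover have nz: "ori p w z \<noteq> 0" "ori p w z' \<noteq> 0" using o by auto
  ultimately have B: "ori p w z' / ori p w z > 0" by (auto simp: zero_less_divide_iff zero_less_mult_iff)
  define B where "B = ori p w z' / ori p w z"
  define A where "A = cross (klein z' - klein p) (klein z - klein p) / ori p w z"
  have "ori p w z *\<^sub>R (klein z' - klein p) = ori p w z *\<^sub>R (A *\<^sub>R ?d + B *\<^sub>R (klein z - klein p))"
    using cross_basis[of ?d "klein z - klein p" "klein z' - klein p"] nz(1)
    by (simp add: A_def B_def ori_def scaleR_add_right)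
  then have z': "klein z' - klein p = A *\<^sub>R ?d + B *\<^sub>R (klein z - klein p)" using nz(1) by simp
  \<comment> \<open>with this \<open>\<epsilon>\<close> the coordinates of the moved midpoint in both triangles stay positive\<close>
  define C where "C = \<bar>A\<bar> + B + 1"
  define \<epsilon> where "\<epsilon> = 1 / (4 * C)"
  have B0: "B > 0" using B by (simp add: B_def)
  have C: "C \<ge> 1" "\<bar>A\<bar> \<le> C" "B \<le> C" using B0 by (auto simp: C_def)
  have \<epsilon>: "\<epsilon> > 0" "\<epsilon> * C = 1/4" "\<epsilon> \<le> 1" using C(1) by (auto simp: \<epsilon>_def field_simps)
  have \<epsilon>A: "\<bar>\<epsilon> * A\<bar> \<le> 1/4" "\<epsilon> * B \<le> 1/4"
  proof -
    have "\<epsilon> * \<bar>A\<bar> \<le> \<epsilon> * C" "\<epsilon> * B \<le> \<epsilon> * C"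
      using C \<epsilon>(1) by (auto intro: mult_left_mono)
    then show "\<bar>\<epsilon> * A\<bar> \<le> 1/4" "\<epsilon> * B \<le> 1/4"
      unfolding \<epsilon>(2) using \<epsilon>(1) by (simp_all add: abs_mult)
  qed
  define y where "y = klein p + ((1 - \<epsilon>) / 2 + \<epsilon> * A) *\<^sub>R ?d + (\<epsilon> * B) *\<^sub>R (klein z - klein p)"
  have in_sets: "z \<in> P" "z' \<in> Q" using z subsetD[OF interior_subset] by metis+
  have \<epsilon>4: "\<epsilon> \<le> 1/4" using C(1) by (simp add: \<epsilon>_def field_simps)
  have pos: "(1 - \<epsilon>) / 2 + \<epsilon> * A > 0" 
  proof -
    have "(1 - e) / 2 + x > 0" if "- x \<le> 1/4" "e \<le> 1/4" for x e :: real using that by argo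
    then show ?thesis using abs_le_D2[OF \<epsilon>A(1)] \<epsilon>4 by metis
  qed
  have lt: "((1 - \<epsilon>) / 2 + \<epsilon> * A) + \<epsilon> * B < 1"
    
  proof -
    have "(1 - e) / 2 + x + y < 1" if "x \<le> 1/4" "y \<le> 1/4" "e > 0" for x y e :: real using that by argo
    then show ?thesis using abs_le_D1[OF \<epsilon>A(1)] \<epsilon>A(2) \<epsilon>(1) by metis
  qed
  obtain x where x: "x \<in> interior P" "klein x = y"
    by (rule triangle_interior[OF PQ(1) V'(1,3) in_sets(1) nz(1) pos mult_pos_pos[OF \<epsilon>(1) B0] lt])
       (simp only: y_def)
  have "y = klein p + ((1 - \<epsilon>) / 2) *\<^sub>R ?d + \<epsilon> *\<^sub>R (A *\<^sub>R ?d + B *\<^sub>R (klein z - klein p))"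
    unfolding y_def by (simp add: algebra_simps)
  then have y': "y = klein p + ((1 - \<epsilon>) / 2) *\<^sub>R ?d + \<epsilon> *\<^sub>R (klein z' - klein p)"
    by (simp only: z')
  have "(1 - \<epsilon>) / 2 > 0" "(1 - \<epsilon>) / 2 + \<epsilon> < 1" using \<epsilon>4 \<epsilon>(1) by (auto simp: field_simps)
  then obtain x' where x': "x' \<in> interior Q" "klein x' = y"
    using triangle_interior[OF PQ(2) V'(2,4) in_sets(2) nz(2) _ \<epsilon>(1)] unfolding y' by metis
  have "x \<in> hdisc" "x' \<in> hdisc"
    using x(1) x'(1) subsetD[OF interior_subset] subsetD[OF polygon_subset] PQ by metis+
  then have "x = x'" using x x' klein_eq_iff by metis
  then show ?thesis using x x' by blast
qed

section \<open>The other side at an end of a side\<close>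

lemma cross_zero_parallel:
  assumes "cross d e = 0" "d \<noteq> 0"
  obtains \<mu> where "e = \<mu> *\<^sub>R d"
proof
  let ?x = "e - ((d \<bullet> e) / (d \<bullet> d)) *\<^sub>R d"
  have dd: "d \<bullet> d \<noteq> 0" using assms(2) by simp
  then have 2: "d \<bullet> ?x = 0" by (simp add: inner_diff_right)
  have "cross d ?x = cross d e" by (simp add: cross_def algebra_simps)
  then have "(d \<bullet> d) * (?x \<bullet> ?x) = 0"
    using inner_cross[of d ?x ?x] assms(1) 2 by simp
  then have "?x \<bullet> ?x = 0" using dd by simp
  then show "e = ((d \<bullet> e) / (d \<bullet> d)) *\<^sub>R d" by simp
qed

text \<open>Constraints that are strict at \<open>p\<close> remain valid nearby, so the polygon
  looks near \<open>p\<close> like the cone of the constraints that are active at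
  \<open>p\<close>.\<close>

lemma feasible_direction:
  assumes H: "finite H" and P: "P = hdisc \<inter> (\<Inter>(b, c)\<in>H. half_plane b c)"
    and p: "p \<in> P" and d: "\<And>b c. (b, c) \<in> H \<Longrightarrow> c \<bullet> klein p = b \<Longrightarrow> c \<bullet> d \<le> 0"
  obtains x \<epsilon> where "\<epsilon> > 0" "x \<in> P" "klein x = klein p + \<epsilon> *\<^sub>R d"
proof -
  have kp: "cmod (klein p) < 1" "\<And>b c. (b, c) \<in> H \<Longrightarrow> c \<bullet> klein p \<le> b"
    using p klein_in_hdisc[of p] unfolding P by (auto simp: half_plane_klein)
  have lim: "((\<lambda>\<epsilon>. klein p + \<epsilon> *\<^sub>R d) \<longlongrightarrow> klein p + 0 *\<^sub>R d) (at_right 0)"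
    by (intro tendsto_intros)
  have "((\<lambda>\<epsilon>. cmod (klein p + \<epsilon> *\<^sub>R d)) \<longlongrightarrow> cmod (klein p + 0 *\<^sub>R d)) (at_right 0)"
    using lim by (rule tendsto_norm)
  then have 1: "eventually (\<lambda>\<epsilon>. cmod (klein p + \<epsilon> *\<^sub>R d) < 1) (at_right 0)"
    by (rule order_tendstoD) (use kp in simp)
  have "eventually (\<lambda>\<epsilon>. c \<bullet> (klein p + \<epsilon> *\<^sub>R d) \<le> b) (at_right 0)" if h: "(b, c) \<in> H" for b c
  proof (cases "c \<bullet> klein p = b")
    case True
    have "eventually (\<lambda>\<epsilon>::real. \<epsilon> > 0) (at_right 0)" by (rule eventually_at_right_less)
    then show ?thesis
    proof eventually_elim
      case (elim \<epsilon>)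
      then have "\<epsilon> * (c \<bullet> d) \<le> 0" using d[OF h True] by (simp add: mult_nonneg_nonpos)
      then show ?case using True by (simp add: inner_add_right)
    qed
  next
    case False
    then have "c \<bullet> (klein p + 0 *\<^sub>R d) < b" using kp(2)[OF h] by simp
    then have "eventually (\<lambda>\<epsilon>. c \<bullet> (klein p + \<epsilon> *\<^sub>R d) < b) (at_right 0)"
      using tendsto_inner[OF tendsto_const lim] by (rule order_tendstoD(2)[rotated])
    then show ?thesis by eventually_elim simp
  qed
  then have 2: "eventually (\<lambda>\<epsilon>. \<forall>h\<in>H. snd h \<bullet> (klein p + \<epsilon> *\<^sub>R d) \<le> fst h) (at_right 0)"
    by (intro eventually_ball_finite[OF H]) auto
  have "eventually (\<lambda>\<epsilon>::real. \<epsilon> > 0 \<and> klein p + \<epsilon> *\<^sub>R d \<in> klein ` P) (at_right 0)"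
    using 1 2 eventually_at_right_less
  proof eventually_elim
    case (elim \<epsilon>)
    then show ?case unfolding klein_polygon[OF P] by auto
  qed
  from eventually_happens'[OF _ this]
  obtain \<epsilon> :: real where "\<epsilon> > 0" "klein p + \<epsilon> *\<^sub>R d \<in> klein ` P" by auto
  then show ?thesis using that by (metis imageE)
qed

text \<open>Every end of a side inside the disc is a vertex, where another side ends with the
  opposite orientation. In the cone of active constraints, rotate the direction \<open>d0\<close>
  of the given side towards the interior. The first constraint to become an equality gives the
  other side. It exists because otherwise the side could be prolonged beyond \<open>p\<close>, so
  that \<open>p\<close> would not be its end.\<close>

lemma next_side_exists:
  assumes P: "convex_polygon P" and s: "s \<in> sides P" and \<sigma>: "\<sigma> \<in> {1, -1 :: real}"
    and e: "end_of \<sigma> P s p"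
  obtains t where "t \<in> sides P" "end_of (- \<sigma>) P t p"
proof -
  have neg_left: "a < 0" if "a * b < 0" "b > 0" for a b :: real
    using that by (simp add: mult_less_0_iff)
  have neg_right: "b < 0" if "a * b < 0" "a > 0" for a b :: real
    using that by (simp add: mult_less_0_iff)
  obtain H where H: "finite H" and Hbc: "\<And>b c. (b, c) \<in> H \<Longrightarrow> \<bar>b\<bar> < cmod c"
    and PH: "P = hdisc \<inter> (\<Inter>(b, c)\<in>H. half_plane b c)"
    using P unfolding convex_polygon_def by auto
  have sub: "P \<subseteq> half_plane b c" if "(b, c) \<in> H" for b c
    unfolding PH using that by auto
  obtain w where w: "w \<in> s" "w \<noteq> p" using side_other_point[OF s] by metis
  have ps: "p \<in> s" using e by (simp add: end_of_def)
  have pP: "p \<in> P" "w \<in> P" using ps w subsetD[OF sides_subset[OF s]] by auto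
  then have hd: "p \<in> hdisc" "w \<in> hdisc" using subsetD[OF polygon_subset[OF P]] by metis+
  obtain z where z: "z \<in> interior P" using polygon_interior[OF P] by auto
  define d0 where "d0 = klein w - klein p"
  have d0: "d0 \<noteq> 0" using klein_eq_iff hd w(2) by (auto simp: d0_def)
  have d0d0: "d0 \<bullet> d0 > 0" using d0 by simp
  have \<sigma>z: "\<sigma> * cross d0 (klein z - klein p) > 0"
    using e w z by (auto simp: end_of_def ori_def d0_def)
  have \<sigma>\<sigma>: "\<sigma> * \<sigma> = 1" using \<sigma> by auto
  have le: "c \<bullet> d0 \<le> 0" and lt: "c \<bullet> (klein z - klein p) < 0"
    if "(b, c) \<in> H" "c \<bullet> klein p = b" for b c
  proof -
    have "w \<in> half_plane b c" using sub[OF that(1)] pP by auto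
    then show "c \<bullet> d0 \<le> 0" using that(2) by (simp add: half_plane_klein d0_def inner_diff_right)
    show "c \<bullet> (klein z - klein p) < 0"
      using interior_half_plane_strict[OF sub[OF that(1)] Hbc[OF that(1)] z] that(2)
      by (simp add: inner_diff_right)
  qed
  \<comment> \<open>the constraints active at \<open>p\<close> that cut off the prolongation of \<open>s\<close> beyond \<open>p\<close>\<close>
  define A where "A = {h \<in> H. snd h \<bullet> klein p = fst h \<and> snd h \<bullet> d0 < 0}"
  have "A \<noteq> {}"
  proof
    assume "A = {}"
    then have "c \<bullet> (- d0) \<le> 0" if "(b, c) \<in> H" "c \<bullet> klein p = b" for b c
      using that by (force simp: A_def)
    then obtain x \<epsilon> where x: "\<epsilon> > 0" "x \<in> P" "klein x = klein p + \<epsilon> *\<^sub>R (- d0)"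
      using feasible_direction[OF H PH pP(1), of "- d0"] by metis
    have "ori p w x = 0" unfolding ori_def x(3) by (simp add: d0_def cross_def algebra_simps)
    then have "x \<in> s" using side_line[OF P s ps w(1) w(2)[symmetric]] x(2) by auto
    moreover have "x \<noteq> p" using x(1,3) d0 by auto
    ultimately have "\<sigma> * ori p x z > 0" using e z by (auto simp: end_of_def)
    moreover have "ori p x z = - \<epsilon> * cross d0 (klein z - klein p)"
      unfolding ori_def x(3) by (simp add: cross_def algebra_simps)
    ultimately have "\<epsilon> * (\<sigma> * cross d0 (klein z - klein p)) < 0" by (simp add: algebra_simps)
    then show False using mult_pos_pos[OF x(1) \<sigma>z] by linarith
  qed
  \<comment> \<open>\<open>d0\<close> turned by a right angle towards the interior\<close>
  define n where "n = \<sigma> *\<^sub>R (\<i> * d0)"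
  have cross_n: "cross d0 n = \<sigma> * (d0 \<bullet> d0)"
    by (simp add: n_def cross_def inner_complex_def algebra_simps)
  \<comment> \<open>the constraint \<open>h\<close> allows the direction \<open>k *\<^sub>R d0 + n\<close> exactly for \<open>k \<ge> \<kappa> h\<close>\<close>
  define \<kappa> where "\<kappa> h = (snd h \<bullet> n) / - (snd h \<bullet> d0)" for h :: "real \<times> complex"
  have finA: "finite A" using H by (simp add: A_def)
  define k where "k = Max (\<kappa> ` A)"
  have "k \<in> \<kappa> ` A" unfolding k_def using finA \<open>A \<noteq> {}\<close> by (intro Max_in) simp_all
  then obtain h where h: "h \<in> A" "\<kappa> h = k" by (elim imageE) metis
  have k_max: "\<kappa> h' \<le> k" if "h' \<in> A" for h'
    using that finA by (simp add: k_def)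
  define d1 where "d1 = k *\<^sub>R d0 + n"
  have cross_d: "cross d0 d1 = \<sigma> * (d0 \<bullet> d0)"
    using cross_n by (simp add: d1_def cross_def algebra_simps)
  then have d1: "d1 \<noteq> 0" using \<sigma>\<sigma> d0d0 by (auto simp: cross_def)
  have inner_d1: "snd h' \<bullet> d1 = - (snd h' \<bullet> d0) * (\<kappa> h' - k)" if "snd h' \<bullet> d0 < 0" for h'
    using that by (simp add: d1_def \<kappa>_def inner_add_right field_simps)
  have d1_le: "c \<bullet> d1 \<le> 0" if bc: "(b, c) \<in> H" "c \<bullet> klein p = b" for b c
  proof (cases "c \<bullet> d0 < 0")
    case True
    then have "(b, c) \<in> A" using bc by (simp add: A_def)
    then have "- (c \<bullet> d0) * (\<kappa> (b, c) - k) \<le> 0"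
      using k_max True by (intro mult_nonneg_nonpos) auto
    then show ?thesis using inner_d1[of "(b, c)"] True by simp
  next
    case False
    then have 0: "c \<bullet> d0 = 0" using le[OF bc] by simp
    have "c \<noteq> 0" using Hbc[OF bc(1)] by auto
    then obtain \<rho> where \<rho>: "\<And>x. c \<bullet> x = \<rho> * cross d0 x"
      using normal_cross[OF 0 d0] by metis
    have "\<rho> * cross d0 (klein z - klein p) < 0" using lt[OF bc] \<rho> by simp
    then have "(\<rho> * \<sigma>) * (\<sigma> * cross d0 (klein z - klein p)) < 0"
      using \<sigma>\<sigma> by (metis mult.assoc mult.left_commute mult.right_neutral)
    then have "\<rho> * \<sigma> < 0" using neg_left \<sigma>z by metis
    then have "(\<rho> * \<sigma>) * (d0 \<bullet> d0) < 0" using d0d0 by (rule mult_neg_pos)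
    moreover have "c \<bullet> d1 = (\<rho> * \<sigma>) * (d0 \<bullet> d0)" using \<rho>[of d1] cross_d by simp
    ultimately show ?thesis by simp
  qed
  obtain x \<epsilon> where x: "\<epsilon> > 0" "x \<in> P" "klein x = klein p + \<epsilon> *\<^sub>R d1"
    using feasible_direction[OF H PH pP(1), of d1] d1_le by metis
  obtain b c where bc: "h = (b, c)" by (cases h)
  have hH: "(b, c) \<in> H" "c \<bullet> klein p = b" "c \<bullet> d0 < 0" using h(1) bc by (auto simp: A_def)
  have cd1: "c \<bullet> d1 = 0" using inner_d1[of h] hH h(2) bc by simp
  define t where "t = P \<inter> geodesic b c"
  have "x \<in> hdisc" using x(2) subsetD[OF polygon_subset[OF P]] by metis
  then have xt: "x \<in> t" "p \<in> t"
    using x pP hd hH(2) cd1 by (auto simp: t_def geodesic_klein inner_add_right)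
  have xp: "x \<noteq> p" using x(1,3) d1 by auto
  have "t \<in> sides P"
    unfolding sides_def using Hbc[OF hH(1)] sub[OF hH(1)] xt xp
    by (intro CollectI exI[of _ b] exI[of _ c]) (auto simp: t_def)
  moreover have "end_of (- \<sigma>) P t p"
    unfolding end_of_def
  proof (intro conjI ballI)
    show "p \<in> t" by fact
    fix w' y assume w': "w' \<in> t - {p}" and y: "y \<in> interior P"
    have w'P: "w' \<in> P" "w' \<in> hdisc" "c \<bullet> klein w' = b" "w' \<noteq> p"
      using w' by (auto simp: t_def geodesic_klein)
    have "c \<noteq> 0" using Hbc[OF hH(1)] by auto
    then obtain \<rho> where \<rho>: "\<rho> \<noteq> 0" "\<And>x. c \<bullet> x = \<rho> * cross d1 x"
      using normal_cross[OF cd1 d1] by metis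
    have "c \<bullet> (klein w' - klein p) = 0" using w'P hH(2) by (simp add: inner_diff_right)
    then have "cross d1 (klein w' - klein p) = 0" using \<rho> by auto
    then obtain \<mu> where \<mu>: "klein w' - klein p = \<mu> *\<^sub>R d1" using cross_zero_parallel d1 by metis
    have "\<mu> \<noteq> 0" using \<mu> w'P hd klein_eq_iff by auto
    moreover have "\<mu> \<ge> 0"
    proof -
      have "\<sigma> * ori p w w' \<ge> 0" using end_of_nonneg[OF P e w(1) w'P(1)] .
      moreover have "ori p w w' = \<mu> * cross d0 d1"
        unfolding ori_def \<mu> d0_def[symmetric] by (simp add: cross_def algebra_simps)
      ultimately have "\<mu> * (d0 \<bullet> d0) * (\<sigma> * \<sigma>) \<ge> 0" unfolding cross_d by (simp add: algebra_simps)
      then show ?thesis using d0d0 \<sigma>\<sigma> by (simp add: zero_le_mult_iff)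
    qed
    ultimately have \<mu>0: "\<mu> > 0" by simp
    have "cross d1 d0 = - \<sigma> * (d0 \<bullet> d0)" using cross_d by (simp add: cross_def algebra_simps)
    then have "- (\<rho> * \<sigma>) * (d0 \<bullet> d0) < 0" using \<rho>(2)[of d0] hH(3) by simp
    then have \<rho>\<sigma>: "\<rho> * \<sigma> > 0" using d0d0 neg_left[of "- (\<rho> * \<sigma>)" "d0 \<bullet> d0"] by simp
    have "c \<bullet> (klein y - klein p) < 0"
      using interior_half_plane_strict[OF sub[OF hH(1)] Hbc[OF hH(1)] y] hH(2)
      by (simp add: inner_diff_right)
    then have "\<rho> * cross d1 (klein y - klein p) < 0" using \<rho>(2) by simp
    then have "(\<rho> * \<sigma>) * (\<sigma> * cross d1 (klein y - klein p)) < 0"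
      using \<sigma>\<sigma> by (metis mult.assoc mult.left_commute mult.right_neutral)
    then have "\<sigma> * cross d1 (klein y - klein p) < 0" using \<rho>\<sigma> neg_right by metis
    then have "\<mu> * (\<sigma> * cross d1 (klein y - klein p)) < 0" by (rule mult_pos_neg[OF \<mu>0])
    moreover have "ori p w' y = \<mu> * cross d1 (klein y - klein p)"
      unfolding ori_def \<mu> by (simp add: cross_def algebra_simps)
    ultimately show "- \<sigma> * ori p w' y > 0" by (simp add: algebra_simps)
  qed
  ultimately show ?thesis by (rule that)
qed

section \<open>Isometries\<close>

definition disc_isometries :: "(complex \<Rightarrow> complex) set" where
  "disc_isometries = {disc_isometry t w | t w. cmod w < 1}"

lemma one_minus_cnj_mult_nonzero:
  assumes "cmod w < 1" "cmod z < 1"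
  shows "1 - cnj w * z \<noteq> 0"
proof
  assume "1 - cnj w * z = 0"
  then have "cmod w * cmod z = 1" by (metis complex_mod_cnj eq_iff_diff_eq_0 norm_mult norm_one)
  moreover have "cmod w * cmod z < 1"
    using assms by (metis mult_strict_mono' norm_ge_zero mult_1)
  ultimately show False by simp
qed

lemma isometry_in_hdisc: "m \<in> disc_isometries \<Longrightarrow> z \<in> hdisc \<Longrightarrow> m z \<in> hdisc"
  unfolding disc_isometries_def disc_isometry_def by (auto simp: Moebius_function_norm_lt_1)

lemma continuous_on_isometry:
  assumes "m \<in> disc_isometries"
  shows "continuous_on hdisc m"
proof -
  obtain t w where m: "cmod w < 1" "m = disc_isometry t w"
    using assms by (auto simp: disc_isometries_def)
  have "continuous_on hdisc (Moebius_function t w)"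
    using Moebius_function_holomorphic[OF m(1)] by (rule holomorphic_on_imp_continuous_on)
  then show ?thesis
    by (rule continuous_on_eq) (simp add: m(2) disc_isometry_def)
qed

text \<open>The maps \<open>Moebius_function 0 (m v) \<circ> m\<close> and
  \<open>Moebius_function 0 v\<close> both send \<open>v\<close> to the origin, so they differ
  by a rotation, under which \<open>turn\<close> is invariant.\<close>

lemma turn_isometry:
  assumes "m \<in> disc_isometries" "v \<in> hdisc" "x \<in> hdisc" "z \<in> hdisc"
  shows "turn (m v) (m x) (m z) = turn v x z"
proof -
  obtain t w where m: "cmod w < 1" "m = disc_isometry t w"
    using assms(1) by (auto simp: disc_isometries_def)
  have hd: "cmod v < 1" "cmod x < 1" "cmod z < 1" using assms by auto
  define u where "u = exp (\<i> * of_real t)"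
  have "cmod u = 1" by (simp add: u_def)
  then have u: "u * cnj u = 1" "u \<noteq> 0" using complex_norm_square[of u] by auto
  have cw: "1 - of_real ((cmod w)\<^sup>2) \<noteq> (0 :: complex)"
    using m(1) by (metis abs_norm_cancel abs_square_eq_1 eq_iff_diff_eq_0 less_irrefl of_real_eq_1_iff)
  \<comment> \<open>the rotation by which the two maps differ\<close>
  define U where "U = u * (1 - w * cnj v) / (1 - cnj w * v)"
  have ne: "1 - cnj w * v \<noteq> 0" "1 - w * cnj v \<noteq> 0" "1 - cnj v * w \<noteq> 0"
    using one_minus_cnj_mult_nonzero[OF m(1) hd(1)] one_minus_cnj_mult_nonzero[OF hd(1) m(1)]
    by (simp_all add: mult.commute)
  have ww: "of_real ((cmod w)\<^sup>2) = w * cnj w" by (rule complex_norm_square)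
  have *: "Moebius_function 0 (m v) (m y) = U * Moebius_function 0 v y" if "cmod y < 1" for y
  proof -
    have nz: "1 - cnj w * y \<noteq> 0" "1 - cnj v * y \<noteq> 0"
      using one_minus_cnj_mult_nonzero that m(1) hd(1) by auto
    have my: "m y = u * (y - w) / (1 - cnj w * y)" "m v = u * (v - w) / (1 - cnj w * v)"
      using that hd by (simp_all add: m(2) disc_isometry_def Moebius_function_def u_def)
    have "m y - m v = u * ((y - w) * (1 - cnj w * v) - (v - w) * (1 - cnj w * y)) /
        ((1 - cnj w * y) * (1 - cnj w * v))"
      unfolding my using nz ne by (simp add: field_simps)
    also have "(y - w) * (1 - cnj w * v) - (v - w) * (1 - cnj w * y) = (1 - w * cnj w) * (y - v)"
      by (simp add: algebra_simps)
    finally have 1: "m y - m v = u * ((1 - w * cnj w) * (y - v)) / ((1 - cnj w * y) * (1 - cnj w * v))" .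
    have "1 - cnj (m v) * m y = 1 - (u * cnj u) * ((cnj v - cnj w) * (y - w)) / ((1 - w * cnj v) * (1 - cnj w * y))"
      unfolding my by simp
    also have "\<dots> = ((1 - w * cnj v) * (1 - cnj w * y) - (cnj v - cnj w) * (y - w)) /
        ((1 - w * cnj v) * (1 - cnj w * y))"
      unfolding u(1) using nz ne by (simp add: diff_divide_distrib)
    also have "(1 - w * cnj v) * (1 - cnj w * y) - (cnj v - cnj w) * (y - w) = (1 - w * cnj w) * (1 - cnj v * y)"
      by (simp add: algebra_simps)
    finally have 2: "1 - cnj (m v) * m y = (1 - w * cnj w) * (1 - cnj v * y) /
        ((1 - w * cnj v) * (1 - cnj w * y))" .
    show ?thesis
      unfolding Moebius_function_simple 1 2 U_def
      using nz ne cw unfolding ww by (simp add: divide_simps)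
  qed
  have "cmod u = 1" by (simp add: u_def)
  moreover have "cmod (1 - w * cnj v) = cmod (1 - cnj w * v)"
    by (metis complex_cnj_cnj complex_cnj_diff complex_cnj_mult complex_cnj_one complex_mod_cnj)
  ultimately have "cmod U = 1" using ne by (simp add: U_def norm_mult norm_divide)
  then have UU: "cnj U * U = 1" by (metis complex_norm_square mult.commute of_real_1 one_power2)
  have "cnj (U * a) * (U * b) = (cnj U * U) * (cnj a * b)" for a b by simp
  then show ?thesis unfolding turn_def *[OF hd(2)] *[OF hd(3)] by (simp only: UU mult_1)
qed

text \<open>Isometries act on the pairs \<open>(b, c)\<close> by Lorentz transformations, up to
  scaling: the form \<open>(cmod c)\<^sup>2 - b\<^sup>2\<close> is only multiplied by a
  positive factor.\<close>

lemma isometry_pullback: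
  assumes "m \<in> disc_isometries" "\<bar>b\<bar> < cmod c"
  obtains b' c' where "\<bar>b'\<bar> < cmod c'"
    "\<And>z. z \<in> hdisc \<Longrightarrow> m z \<in> half_plane b c \<longleftrightarrow> z \<in> half_plane b' c'"
    "\<And>z. z \<in> hdisc \<Longrightarrow> m z \<in> geodesic b c \<longleftrightarrow> z \<in> geodesic b' c'"
proof -
  obtain t w where m: "cmod w < 1" "m = disc_isometry t w"
    using assms(1) by (auto simp: disc_isometries_def)
  define u where "u = exp (\<i> * of_real t)"
  have u: "cmod u = 1" by (simp add: u_def)
  define d where "d = cnj u * c"
  have d: "cmod d = cmod c" using u by (simp add: d_def norm_mult)
  define b' where "b' = b * (1 + (cmod w)\<^sup>2) + 2 * (d \<bullet> w)"
  define c' where "c' = 2 * of_real b * w + d + w\<^sup>2 * cnj d"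
  have "(cmod c')\<^sup>2 - b'\<^sup>2 = (1 - (cmod w)\<^sup>2)\<^sup>2 * ((cmod d)\<^sup>2 - b\<^sup>2)"
    unfolding b'_def c'_def cmod_power2 inner_complex_def by (simp add: power2_eq_square algebra_simps)
  moreover have "(1 - (cmod w)\<^sup>2)\<^sup>2 * ((cmod d)\<^sup>2 - b\<^sup>2) > 0"
  proof (rule mult_pos_pos)
    have "(cmod w)\<^sup>2 < 1" using m(1) by (simp add: abs_square_less_1)
    then show "(1 - (cmod w)\<^sup>2)\<^sup>2 > 0" by simp
    have "\<bar>b\<bar>\<^sup>2 < (cmod d)\<^sup>2" using assms(2) d by (intro power_strict_mono) auto
    then show "(cmod d)\<^sup>2 - b\<^sup>2 > 0" by simp
  qed
  ultimately have "\<bar>b'\<bar>\<^sup>2 < (cmod c')\<^sup>2" by simp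
  then have bc': "\<bar>b'\<bar> < cmod c'" by (rule power_less_imp_less_base) simp
  have key: "\<exists>N>0. N * (b * (1 + (cmod (m z))\<^sup>2) - 2 * (c \<bullet> m z)) = b' * (1 + (cmod z)\<^sup>2) - 2 * (c' \<bullet> z)"
    if z: "z \<in> hdisc" for z
  proof -
    have "1 - cnj w * z \<noteq> 0" using one_minus_cnj_mult_nonzero m(1) z by simp
    define N where "N = (cmod (1 - cnj w * z))\<^sup>2"
    have N: "N > 0" using \<open>1 - cnj w * z \<noteq> 0\<close> by (simp add: N_def)
    have "m z = u * ((z - w) / (1 - cnj w * z))"
      using z by (simp add: m(2) disc_isometry_def Moebius_function_def u_def)
    also have "(z - w) / (1 - cnj w * z) = (z - w) * cnj (1 - cnj w * z) / of_real N"
      unfolding N_def by (metis complex_div_cnj)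
    finally have mz: "m z = (1 / N) *\<^sub>R (u * ((z - w) * (1 - w * cnj z)))"
      by (simp add: scaleR_conv_of_real)
    have 1: "N * (cmod (m z))\<^sup>2 = (cmod (z - w))\<^sup>2"
    proof -
      have "cmod (1 - w * cnj z) = cmod (1 - cnj w * z)"
        by (metis complex_cnj_cnj complex_cnj_diff complex_cnj_mult complex_cnj_one complex_mod_cnj)
      then have "(cmod (m z))\<^sup>2 = (1 / N)\<^sup>2 * ((cmod (z - w))\<^sup>2 * N)"
        unfolding mz N_def norm_scaleR norm_mult u by (simp add: power_mult_distrib power_divide)
      then show ?thesis using N by (simp add: power2_eq_square)
    qed
    have inner_u: "c \<bullet> (u * y) = d \<bullet> y" for y
      by (simp add: d_def inner_complex_def algebra_simps)
    have 2: "N * (c \<bullet> m z) = d \<bullet> ((z - w) * (1 - w * cnj z))"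
      unfolding mz inner_scaleR_right inner_u using N by simp
    have "N * (b * (1 + (cmod (m z))\<^sup>2) - 2 * (c \<bullet> m z)) =
        b * (N + N * (cmod (m z))\<^sup>2) - 2 * (N * (c \<bullet> m z))" by (simp add: algebra_simps)
    also have "\<dots> = b * (N + (cmod (z - w))\<^sup>2) - 2 * (d \<bullet> ((z - w) * (1 - w * cnj z)))"
      unfolding 1 2 ..
    also have "\<dots> = b' * (1 + (cmod z)\<^sup>2) - 2 * (c' \<bullet> z)"
      unfolding b'_def c'_def N_def cmod_power2 inner_complex_def
      by (simp add: power2_eq_square algebra_simps)
    finally show ?thesis using N by blast
  qed
  show ?thesis
  proof (rule that[OF bc'])
    fix z assume z: "z \<in> hdisc"
    then have mz: "m z \<in> hdisc" using isometry_in_hdisc assms(1) by metis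
    obtain N where N: "N > 0"
      "N * (b * (1 + (cmod (m z))\<^sup>2) - 2 * (c \<bullet> m z)) = b' * (1 + (cmod z)\<^sup>2) - 2 * (c' \<bullet> z)"
      using key[OF z] by metis
    have "b * (1 + (cmod (m z))\<^sup>2) - 2 * (c \<bullet> m z) \<ge> 0 \<longleftrightarrow> b' * (1 + (cmod z)\<^sup>2) - 2 * (c' \<bullet> z) \<ge> 0"
      unfolding N(2)[symmetric] using N(1) by (simp add: zero_le_mult_iff)
    then show "m z \<in> half_plane b c \<longleftrightarrow> z \<in> half_plane b' c'"
      using z mz by (simp add: half_plane_def)
    have "b * (1 + (cmod (m z))\<^sup>2) - 2 * (c \<bullet> m z) = 0 \<longleftrightarrow> b' * (1 + (cmod z)\<^sup>2) - 2 * (c' \<bullet> z) = 0"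
      unfolding N(2)[symmetric] using N(1) by simp
    then show "m z \<in> geodesic b c \<longleftrightarrow> z \<in> geodesic b' c'"
      using z mz by (auto simp: geodesic_def)
  qed
qed

lemma ori_isometry_sign:
  assumes "m \<in> disc_isometries" "v \<in> hdisc" "x \<in> hdisc" "z \<in> hdisc" "\<sigma> \<in> {1, -1}"
  shows "\<sigma> * ori (m v) (m x) (m z) > 0 \<longleftrightarrow> \<sigma> * ori v x z > 0"
proof -
  have "m v \<in> hdisc" "m x \<in> hdisc" "m z \<in> hdisc" using assms isometry_in_hdisc by metis+
  then have "ori (m v) (m x) (m z) > 0 \<longleftrightarrow> ori v x z > 0" "ori (m v) (m x) (m z) < 0 \<longleftrightarrow> ori v x z < 0"
    using turn_isometry[OF assms(1-4)] turn_sign assms(2-4) by metis+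
  then show ?thesis using assms(5) by auto
qed

section \<open>Tiles and their boundaries\<close>

text \<open>Tiles that are adjacent along a side lie on opposite sides of it, so a left end for
  one is a right end for the other.\<close>

lemma end_of_opposite:
  assumes PQ: "convex_polygon P" "convex_polygon Q" "interior P \<inter> interior Q = {}"
    and s: "s \<in> sides P" "s \<in> sides Q" and \<sigma>: "\<sigma> \<in> {1, -1}" and e: "end_of \<sigma> P s v"
  shows "end_of (- \<sigma>) Q s v"
  unfolding end_of_def
proof (intro conjI ballI)
  show v: "v \<in> s" using e by (simp add: end_of_def)
  fix w z' assume w: "w \<in> s - {v}" and z': "z' \<in> interior Q"
  obtain z where z: "z \<in> interior P" using polygon_interior[OF PQ(1)] by auto
  have pos: "\<sigma> * ori v w z > 0" using e w z by (auto simp: end_of_def)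
  have w': "w \<in> s" "v \<noteq> w" using w by auto
  obtain \<tau> :: real where \<tau>: "\<tau> \<in> {1, -1}" "\<And>z. z \<in> interior Q \<Longrightarrow> \<tau> * ori v w z > 0"
    by (rule side_ori[OF PQ(2) s(2) v w'], rule that, assumption+)
  have vw: "v \<in> P \<inter> Q" "w \<in> P \<inter> Q" using v w' subsetD[OF sides_subset] s by auto
  have "\<tau> \<noteq> \<sigma>"
    using interiors_overlap[OF PQ(1,2) vw z z' pos] \<tau>(2)[OF z'] PQ(3) by auto
  then have "\<tau> = - \<sigma>" using \<tau>(1) \<sigma> by auto
  then show "- \<sigma> * ori v w z' > 0" using \<tau>(2)[OF z'] by simp
qed

text \<open>Polygons that share a side are separated by its line, so all their common points lie
  on that line.\<close>

lemma common_side_unique: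
  assumes PQ: "convex_polygon P" "convex_polygon Q" "interior P \<inter> interior Q = {}"
    and s: "s \<in> sides P" "s \<in> sides Q" and t: "t \<in> sides P" "t \<in> sides Q"
  shows "s = t"
proof -
  obtain p where p: "p \<in> s" using side_other_point[OF s(1)] by metis
  obtain w where w: "w \<in> s" "w \<noteq> p" using side_other_point[OF s(1)] by metis
  note pw = p w(1) w(2)[symmetric]
  obtain \<sigma> :: real where \<sigma>: "\<sigma> \<in> {1, -1}" "\<And>z. z \<in> interior P \<Longrightarrow> \<sigma> * ori p w z > 0"
      "\<And>x. x \<in> P \<Longrightarrow> \<sigma> * ori p w x \<ge> 0"
    by (rule side_ori[OF PQ(1) s(1) pw], rule that, assumption+)
  obtain \<tau> :: real where \<tau>: "\<tau> \<in> {1, -1}" "\<And>z. z \<in> interior Q \<Longrightarrow> \<tau> * ori p w z > 0"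
      "\<And>x. x \<in> Q \<Longrightarrow> \<tau> * ori p w x \<ge> 0"
    by (rule side_ori[OF PQ(2) s(2) pw], rule that, assumption+)
  obtain z z' where z: "z \<in> interior P" "z' \<in> interior Q"
    using polygon_interior[OF PQ(1)] polygon_interior[OF PQ(2)] by auto
  have in_PQ: "p \<in> P \<inter> Q" "w \<in> P \<inter> Q" using pw subsetD[OF sides_subset] s by auto
  have "\<tau> \<noteq> \<sigma>"
    using interiors_overlap[OF PQ(1,2) in_PQ z \<sigma>(2)[OF z(1)]] \<tau>(2)[OF z(2)] PQ(3) by auto
  have ts: "x \<in> s" if "x \<in> t" for x
  proof -
    have "x \<in> P" "x \<in> Q" using that subsetD[OF sides_subset] t by auto
    moreover have "ori p w x = 0"
      using \<sigma>(1,3) \<tau>(1,3) \<open>\<tau> \<noteq> \<sigma>\<close> calculation by force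
    ultimately show ?thesis using side_line[OF PQ(1) s(1) pw] by auto
  qed
  obtain a where a: "a \<in> t" using side_other_point[OF t(1)] by metis
  obtain b where b: "b \<in> t" "b \<noteq> a" using side_other_point[OF t(1)] by metis
  show ?thesis
    using side_line[OF PQ(1) t(1) a b(1) b(2)[symmetric]]
      side_line[OF PQ(1) s(1) ts[OF a] ts[OF b(1)] b(2)[symmetric]] by simp
qed

lemma closure_polygon:
  assumes "convex_polygon P"
  shows "closure P \<inter> hdisc = P"
proof -
  obtain H where PH: "P = hdisc \<inter> (\<Inter>(b, c)\<in>H. half_plane b c)"
    using assms unfolding convex_polygon_def by auto
  let ?C = "\<Inter>(b, c)\<in>H. {z. 2 * (c \<bullet> z) \<le> b * (1 + (cmod z)\<^sup>2)}"
  have "closed {z. 2 * (c \<bullet> z) \<le> b * (1 + (cmod z)\<^sup>2)}" for b c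
    by (intro closed_Collect_le continuous_intros)
  then have "closed ?C" by (intro closed_INT) auto
  moreover have P: "P = hdisc \<inter> ?C" unfolding PH half_plane_def by auto
  ultimately have "closure P \<subseteq> ?C" by (intro closure_minimal) auto
  then have "closure P \<inter> hdisc \<subseteq> P" using P by auto
  moreover have "P \<subseteq> closure P \<inter> hdisc" using closure_subset[of P] P by auto
  ultimately show ?thesis by (rule equalityI)
qed

text \<open>Polygons are closed in the disc. This frees \<open>tile_boundary\<close> from
  closures, which isometries of the disc do not control at infinity.\<close>

lemma frontier_polygon:
  assumes "convex_polygon P"
  shows "frontier P \<inter> hdisc = P - interior P"
  using closure_polygon[OF assms] unfolding frontier_def by auto

context even_corner_tiling
begin

lemma G_subgroup: "subgroup G (BijGroup hdisc)"
  using fuchsian(1) by (simp add: fuchsian_group_def)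

lemma G_isometry: "g \<in> G \<Longrightarrow> g \<in> disc_isometries"
  using fuchsian(1) unfolding fuchsian_group_def disc_isometries_def by blast

lemma G_Bij: "g \<in> G \<Longrightarrow> g \<in> Bij hdisc"
  using subgroup.subset[OF G_subgroup] by (auto simp: BijGroup_def)

lemma linv_G: "g \<in> G \<Longrightarrow> linv g \<in> G"
  using subgroup.m_inv_closed[OF G_subgroup] .

lemma G_carrier: "g \<in> G \<Longrightarrow> g \<in> carrier (BijGroup hdisc)"
  using G_Bij by (simp add: BijGroup_def)

lemma linv_linv: "g \<in> G \<Longrightarrow> linv (linv g) = g"
  by (rule group.inv_inv[OF group_BijGroup G_carrier])

lemma G_bij_betw: "g \<in> G \<Longrightarrow> bij_betw g hdisc hdisc"
  using G_Bij by (simp add: Bij_def)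

lemma G_hdisc: "g \<in> G \<Longrightarrow> z \<in> hdisc \<Longrightarrow> g z \<in> hdisc"
  using isometry_in_hdisc G_isometry by metis

lemma linv_apply:
  assumes "g \<in> G" "z \<in> hdisc"
  shows "linv g (g z) = z"
proof -
  have "linv g (g z) = inv_into hdisc g (g z)"
    unfolding inv_BijGroup[OF G_Bij[OF assms(1)]] by (rule restrict_apply'[OF G_hdisc[OF assms]])
  then show ?thesis using bij_betw_inv_into_left[OF G_bij_betw[OF assms(1)] assms(2)] by simp
qed

lemma apply_linv: "g \<in> G \<Longrightarrow> z \<in> hdisc \<Longrightarrow> g (linv g z) = z"
  using linv_apply[OF linv_G, of g z] linv_linv by simp

lemma G_eqI:
  assumes "g \<in> G" "h \<in> G" "\<And>z. z \<in> hdisc \<Longrightarrow> g z = h z"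
  shows "g = h"
  using assms Bij_imp_extensional[OF G_Bij] by (metis extensionalityI)

lemma G_compose:
  assumes "g \<in> G" "h \<in> G"
  obtains k where "k \<in> G" "\<And>z. z \<in> hdisc \<Longrightarrow> k z = g (h z)"
proof
  show "g \<otimes>\<^bsub>BijGroup hdisc\<^esub> h \<in> G"
    using subgroup.m_closed[OF G_subgroup] assms .
  show "(g \<otimes>\<^bsub>BijGroup hdisc\<^esub> h) z = g (h z)" if "z \<in> hdisc" for z
    using assms that G_Bij by (simp add: BijGroup_def compose_def)
qed

lemma G_one: "\<one>\<^bsub>BijGroup hdisc\<^esub> \<in> G"
  using subgroup.one_closed[OF G_subgroup] .

lemma one_apply: "z \<in> hdisc \<Longrightarrow> \<one>\<^bsub>BijGroup hdisc\<^esub> z = z"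
  by (simp add: BijGroup_def)

lemma linv_image: "g \<in> G \<Longrightarrow> P \<subseteq> hdisc \<Longrightarrow> linv g ` g ` P = P"
  by (force simp: image_image linv_apply subset_iff)

lemma G_image_hdisc: "g \<in> G \<Longrightarrow> P \<subseteq> hdisc \<Longrightarrow> g ` P \<subseteq> hdisc"
  using G_hdisc by (meson image_subsetI subsetD)

lemma G_interior: "g \<in> G \<Longrightarrow> P \<subseteq> hdisc \<Longrightarrow> interior (g ` P) = g ` interior P"
  using G_bij_betw[of g]
  by (intro interior_image_open[of hdisc] continuous_on_isometry G_isometry)
     (auto simp: bij_betw_def)

lemma half_plane_image:
  assumes "g \<in> G" "\<bar>b\<bar> < cmod c"
  obtains b' c' where "\<bar>b'\<bar> < cmod c'"
    "\<And>z. z \<in> hdisc \<Longrightarrow> g z \<in> half_plane b' c' \<longleftrightarrow> z \<in> half_plane b c"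
    "\<And>z. z \<in> hdisc \<Longrightarrow> g z \<in> geodesic b' c' \<longleftrightarrow> z \<in> geodesic b c"
proof -
  obtain b' c' where *: "\<bar>b'\<bar> < cmod c'"
    "\<And>z. z \<in> hdisc \<Longrightarrow> linv g z \<in> half_plane b c \<longleftrightarrow> z \<in> half_plane b' c'"
    "\<And>z. z \<in> hdisc \<Longrightarrow> linv g z \<in> geodesic b c \<longleftrightarrow> z \<in> geodesic b' c'"
    using isometry_pullback[OF G_isometry[OF linv_G[OF assms(1)]] assms(2)] by metis
  show ?thesis
    by (rule that[OF *(1)]) (simp_all only: G_hdisc[OF assms(1)] linv_apply[OF assms(1)] flip: *(2,3))
qed

lemma sides_image:
  assumes g: "g \<in> G" and P: "P \<subseteq> hdisc" and s: "s \<in> sides P"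
  shows "g ` s \<in> sides (g ` P)"
proof -
  obtain b c x y where bc: "\<bar>b\<bar> < cmod c" "P \<subseteq> half_plane b c" "s = P \<inter> geodesic b c"
    and xy: "x \<in> s" "y \<in> s" "x \<noteq> y"
    using s unfolding sides_def by auto
  obtain b' c' where bc': "\<bar>b'\<bar> < cmod c'"
    "\<And>z. z \<in> hdisc \<Longrightarrow> g z \<in> half_plane b' c' \<longleftrightarrow> z \<in> half_plane b c"
    "\<And>z. z \<in> hdisc \<Longrightarrow> g z \<in> geodesic b' c' \<longleftrightarrow> z \<in> geodesic b c"
    using half_plane_image[OF g bc(1)] by metis
  have Pd: "z \<in> hdisc" "z \<in> half_plane b c" if "z \<in> P" for z
    using that subsetD[OF P] subsetD[OF bc(2)] by metis+
  have "g ` P \<subseteq> half_plane b' c'" by (rule image_subsetI) (simp only: bc'(2) Pd)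
  moreover have "g ` s = g ` P \<inter> geodesic b' c'"
  proof -
    have "g z \<in> geodesic b' c' \<longleftrightarrow> z \<in> geodesic b c" if "z \<in> P" for z
      using bc'(3)[OF Pd(1)[OF that]] .
    then show ?thesis unfolding bc(3) by auto
  qed
  moreover have "g x \<noteq> g y"
  proof -
    have "x \<in> hdisc" "y \<in> hdisc" using xy bc(3) P by auto
    then show ?thesis using linv_apply[OF g] xy(3) by metis
  qed
  then have "\<exists>a\<in>g ` s. \<exists>d\<in>g ` s. a \<noteq> d" using xy by auto
  ultimately show ?thesis
    unfolding sides_def using bc'(1) by (intro CollectI exI[of _ b'] exI[of _ c'] conjI)
qed

lemma polygon_image:
  assumes g: "g \<in> G" and P: "convex_polygon P"
  shows "convex_polygon (g ` P)"
proof -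
  obtain H where H: "finite H" and Hbc: "\<And>b c. (b, c) \<in> H \<Longrightarrow> \<bar>b\<bar> < cmod c"
    and PH: "P = hdisc \<inter> (\<Inter>(b, c)\<in>H. half_plane b c)"
    using P unfolding convex_polygon_def by auto
  have "\<forall>h\<in>H. \<exists>h'. \<bar>fst h'\<bar> < cmod (snd h') \<and>
      (\<forall>z\<in>hdisc. g z \<in> half_plane (fst h') (snd h') \<longleftrightarrow> z \<in> half_plane (fst h) (snd h))"
  proof
    fix h assume "h \<in> H"
    then have "\<bar>fst h\<bar> < cmod (snd h)" using Hbc by (cases h) auto
    then obtain b' c' where "\<bar>b'\<bar> < cmod c'"
      "\<And>z. z \<in> hdisc \<Longrightarrow> g z \<in> half_plane b' c' \<longleftrightarrow> z \<in> half_plane (fst h) (snd h)"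
      using half_plane_image[OF g] by metis
    then show "\<exists>h'. \<bar>fst h'\<bar> < cmod (snd h') \<and>
      (\<forall>z\<in>hdisc. g z \<in> half_plane (fst h') (snd h') \<longleftrightarrow> z \<in> half_plane (fst h) (snd h))"
      by (intro exI[of _ "(b', c')"]) simp
  qed
  then obtain f where f: "\<And>h. h \<in> H \<Longrightarrow> \<bar>fst (f h)\<bar> < cmod (snd (f h))"
    "\<And>h z. h \<in> H \<Longrightarrow> z \<in> hdisc \<Longrightarrow>
      g z \<in> half_plane (fst (f h)) (snd (f h)) \<longleftrightarrow> z \<in> half_plane (fst h) (snd h)"
    by metis
  have PH': "z \<in> P \<longleftrightarrow> z \<in> hdisc \<and> (\<forall>h\<in>H. z \<in> half_plane (fst h) (snd h))" for z
    unfolding PH by (simp add: case_prod_beta)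
  have "g ` P = hdisc \<inter> (\<Inter>(b, c)\<in>f ` H. half_plane b c)"
  proof (rule Set.set_eqI)
    fix y
    show "y \<in> g ` P \<longleftrightarrow> y \<in> hdisc \<inter> (\<Inter>(b, c)\<in>f ` H. half_plane b c)"
    proof
      assume "y \<in> g ` P"
      then obtain z where z: "z \<in> P" "y = g z" by (elim imageE)
      then have "z \<in> hdisc" using PH' by simp
      then show "y \<in> hdisc \<inter> (\<Inter>(b, c)\<in>f ` H. half_plane b c)"
        using z PH'[of z] f(2) G_hdisc[OF g] by (simp add: case_prod_beta)
    next
      assume y: "y \<in> hdisc \<inter> (\<Inter>(b, c)\<in>f ` H. half_plane b c)"
      then have yd: "y \<in> hdisc" by (rule IntD1)
      define z where "z = linv g y"
      have z: "z \<in> hdisc" "g z = y" using yd G_hdisc[OF linv_G[OF g]] apply_linv[OF g] by (simp_all only: z_def)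
      have "z \<in> half_plane (fst h) (snd h)" if "h \<in> H" for h
        using y f(2)[OF that z(1)] that z(2) by (auto simp: case_prod_beta)
      then have "z \<in> P" using PH' z(1) by simp
      then show "y \<in> g ` P" using z(2) by auto
    qed
  qed
  moreover have "interior (g ` P) \<noteq> {}"
    using G_interior[OF g polygon_subset[OF P]] polygon_interior[OF P] by simp
  ultimately show ?thesis
    unfolding convex_polygon_def using H f(1)
    by (intro conjI exI[of _ "f ` H"]) (auto simp: case_prod_beta)
qed

lemma end_of_image:
  assumes g: "g \<in> G" and P: "P \<subseteq> hdisc" and s: "s \<subseteq> P" and \<sigma>: "\<sigma> \<in> {1, -1}" and e: "end_of \<sigma> P s v"
  shows "end_of \<sigma> (g ` P) (g ` s) (g v)"
  unfolding end_of_def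
proof (intro conjI ballI)
  have v: "v \<in> s" "v \<in> hdisc" using e s P by (auto simp: end_of_def)
  then show "g v \<in> g ` s" by simp
  fix w z assume w: "w \<in> g ` s - {g v}" and z: "z \<in> interior (g ` P)"
  obtain w' where w': "w' \<in> s" "w = g w'" "w' \<noteq> v" using w by auto
  obtain z' where z': "z' \<in> interior P" "z = g z'" using z G_interior[OF g P] by auto
  have "\<sigma> * ori v w' z' > 0" using e w' z' by (auto simp: end_of_def)
  moreover have "w' \<in> hdisc" "z' \<in> hdisc" using w' z' s P subsetD[OF interior_subset] by (metis subsetD)+
  ultimately show "\<sigma> * ori (g v) w z > 0"
    using ori_isometry_sign[OF G_isometry[OF g] v(2) _ _ \<sigma>] w' z' by metis
qed

lemma R_subset: "R \<subseteq> hdisc"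
  by (rule polygon_subset[OF polygon])

lemma tile_polygon: "g \<in> G \<Longrightarrow> convex_polygon (g ` R)"
  by (rule polygon_image[OF _ polygon])

text \<open>Translates of the fundamental domain overlap only if they come from the same group
  element; in this way a statement about tiles becomes an equation in the group.\<close>

lemma tiles_overlap:
  assumes g: "g \<in> G" and h: "h \<in> G" and o: "interior (g ` R) \<inter> interior (h ` R) \<noteq> {}"
  shows "g = h"
proof -
  obtain k where k: "k \<in> G" "\<And>z. z \<in> hdisc \<Longrightarrow> k z = linv g (h z)"
    using G_compose[OF linv_G[OF g] h] by metis
  have kR: "k ` R = linv g ` h ` R"
    unfolding image_image by (rule image_cong) (use k(2) R_subset in auto)
  obtain x where x: "x \<in> interior (g ` R)" "x \<in> interior (h ` R)" using o by auto
  have "linv g x \<in> interior (linv g ` g ` R)" "linv g x \<in> interior (linv g ` h ` R)"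
    using x by (simp_all add: G_interior[OF linv_G[OF g]] G_image_hdisc g h R_subset)
  then have "linv g x \<in> interior R" "linv g x \<in> interior (k ` R)"
    by (simp_all only: linv_image[OF g R_subset] kR)
  then have "interior R \<inter> interior (k ` R) \<noteq> {}" by auto
  then have k1: "k = \<one>\<^bsub>BijGroup hdisc\<^esub>" using fundamental k(1) by (auto simp: fundamental_domain_def)
  show ?thesis
  proof (rule G_eqI[OF g h])
    fix z assume z: "z \<in> hdisc"
    have "linv g (h z) = z" using k(2)[OF z] k1 one_apply[OF z] by simp
    then show "g z = h z" using apply_linv[OF g G_hdisc[OF h z]] by simp
  qed
qed

section \<open>Labels and vertices\<close>

lemma one_image: "P \<subseteq> hdisc \<Longrightarrow> \<one>\<^bsub>BijGroup hdisc\<^esub> ` P = P"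
  by (force simp: one_apply subset_iff)

lemma neighbour_disjoint:
  assumes "e \<in> G" "e ` R \<noteq> R"
  shows "interior (e ` R) \<inter> interior R = {}"
proof -
  have "e \<noteq> \<one>\<^bsub>BijGroup hdisc\<^esub>" using assms(2) one_image[OF R_subset] by metis
  then show ?thesis using fundamental assms(1) by (simp add: fundamental_domain_def Int_commute)
qed

lemma adjacent_along_unique:
  assumes "e \<in> G" "adjacent_along R (e ` R) s" "adjacent_along R (e ` R) t"
  shows "s = t"
proof -
  have "e ` R \<noteq> R" using assms(2) unfolding adjacent_along_def by metis
  then show ?thesis
    using common_side_unique[OF tile_polygon[OF assms(1)] polygon neighbour_disjoint[OF assms(1)]] assms(2,3)
    by (simp add: adjacent_along_def)
qed

text \<open>Since two tiles have at most one common side, the side chosen in the definition of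
  \<open>side_of\<close> is recognised by its adjacency alone.\<close>

lemma side_of_eqI:
  assumes "e \<in> G" "adjacent_along R (linv e ` R) s"
  shows "side_of e = s"
  unfolding side_of_def using assms adjacent_along_unique[OF linv_G[OF assms(1)]]
  by (intro the_equality) simp_all

text \<open>Side pairings in terms of labels: \<open>e\<close> carries its side to the side of its
  inverse, which is again a label.\<close>

lemma pairs_side_linv:
  assumes s: "s \<in> sides R" and e: "pairs_side s e"
  shows "adjacent_along R (linv e ` R) s" "e \<in> labels" "side_of e = s"
    "pairs_side (e ` s) (linv e)" "linv e \<in> labels" "side_of (linv e) = e ` s"
proof -
  have g: "e \<in> G" "e ` s \<in> sides R" "R \<noteq> e ` R" "e ` s \<in> sides (e ` R)"
    using e by (simp_all add: pairs_side_def adjacent_along_def)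
  have ss: "s \<subseteq> hdisc" using sides_subset[OF s] R_subset by simp
  have "R \<noteq> linv e ` R"
    using g(3) linv_image[OF linv_G[OF g(1)] R_subset] linv_linv[OF g(1)] by metis
  moreover have "s \<in> sides (linv e ` R)"
    using sides_image[OF linv_G[OF g(1)] R_subset g(2)] linv_image[OF g(1) ss] by simp
  ultimately show a: "adjacent_along R (linv e ` R) s" using s by (simp add: adjacent_along_def)
  show "e \<in> labels" using s e by (auto simp: labels_def)
  show "side_of e = s" by (rule side_of_eqI[OF g(1) a])
  show p: "pairs_side (e ` s) (linv e)"
    unfolding pairs_side_def linv_image[OF g(1) ss] using linv_G[OF g(1)] s a by simp
  show "linv e \<in> labels" using p g(2) by (auto simp: labels_def)
  show "side_of (linv e) = e ` s"
    using g linv_linv[OF g(1)] by (intro side_of_eqI linv_G) (simp_all add: adjacent_along_def)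
qed

lemma label_side:
  assumes "e \<in> labels"
  shows "side_of e \<in> sides R" "pairs_side (side_of e) e"
proof -
  obtain s where s: "s \<in> sides R" "pairs_side s e" using assms by (auto simp: labels_def)
  show "side_of e \<in> sides R" "pairs_side (side_of e) e"
    using s pairs_side_linv(3)[OF s] by simp_all
qed

lemma label_G: "e \<in> labels \<Longrightarrow> e \<in> G"
  by (auto simp: labels_def pairs_side_def)

lemma label_linv: "e \<in> labels \<Longrightarrow> linv e \<in> labels"
  and side_of_linv: "e \<in> labels \<Longrightarrow> side_of (linv e) = e ` side_of e"
  using pairs_side_linv(5,6) label_side by metis+

lemma label_linv_linv: "e \<in> labels \<Longrightarrow> linv (linv e) = e"
  using linv_linv label_G by metis

lemma side_of_inj: "e \<in> labels \<Longrightarrow> f \<in> labels \<Longrightarrow> side_of e = side_of f \<Longrightarrow> e = f"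
  using label_side[of e] label_side[of f] pairing[of "side_of e"] by auto

lemma side_has_label:
  assumes "s \<in> sides R"
  obtains e where "e \<in> labels" "side_of e = s"
  using pairing[OF assms] pairs_side_linv(2,3)[OF assms] that by metis

lemma end_of_side:
  assumes "e \<in> labels"
  shows "left_end R (side_of e) v \<longleftrightarrow> end_of 1 R (side_of e) v"
    "right_end R (side_of e) v \<longleftrightarrow> end_of (- 1) R (side_of e) v"
  using ends_end_of[OF R_subset sides_subset[OF label_side(1)[OF assms]]] .

lemma v_L_iff:
  assumes "e \<in> labels"
  shows "v_L e = Some v \<longleftrightarrow> end_of 1 R (side_of e) v"
proof -
  have "(THE v. end_of 1 R (side_of e) v) = v" if "end_of 1 R (side_of e) v" for v
    using that end_of_unique[OF polygon] by (intro the_equality) metis+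
  then show ?thesis unfolding v_L_def end_of_side[OF assms] by auto
qed

lemma v_R_iff:
  assumes "e \<in> labels"
  shows "v_R e = Some v \<longleftrightarrow> end_of (- 1) R (side_of e) v"
proof -
  have "(THE v. end_of (- 1) R (side_of e) v) = v" if "end_of (- 1) R (side_of e) v" for v
    using that end_of_unique[OF polygon] by (intro the_equality) metis+
  then show ?thesis unfolding v_R_def end_of_side[OF assms] by auto
qed

text \<open>Applying \<open>e\<close> keeps orientations but turns \<open>R\<close> into its
  neighbour across the paired side, and changing over to \<open>R\<close> exchanges left and
  right.\<close>

lemma end_of_linv:
  assumes e: "e \<in> labels" and \<sigma>: "\<sigma> \<in> {1, - 1}" and v: "end_of \<sigma> R (side_of e) v"
  shows "end_of (- \<sigma>) R (side_of (linv e)) (e v)"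
proof -
  note g = label_G[OF e] and s = label_side[OF e]
  have "end_of \<sigma> (e ` R) (e ` side_of e) (e v)"
    by (rule end_of_image[OF g R_subset sides_subset[OF s(1)] \<sigma> v])
  moreover have "e ` side_of e \<in> sides (e ` R)" "e ` side_of e \<in> sides R" "e ` R \<noteq> R"
    using s(2) by (auto simp: pairs_side_def adjacent_along_def)
  ultimately show ?thesis
    unfolding side_of_linv[OF e]
    by (intro end_of_opposite[OF tile_polygon[OF g] polygon neighbour_disjoint[OF g] _ _ \<sigma>])
qed

lemma v_linv:
  assumes "e \<in> labels"
  shows "v_R (linv e) = map_option e (v_L e)" "v_L (linv e) = map_option e (v_R e)"
proof -
  have 1: "v_L f = Some v \<Longrightarrow> v_R (linv f) = Some (f v)" "v_R f = Some v \<Longrightarrow> v_L (linv f) = Some (f v)"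
    if "f \<in> labels" for f v
    using end_of_linv[OF that, of 1 v] end_of_linv[OF that, of "- 1" v]
    by (simp_all add: v_L_iff v_R_iff that label_linv)
  note 2 = 1[OF label_linv[OF assms], unfolded label_linv_linv[OF assms]]
  show "v_R (linv e) = map_option e (v_L e)"
    using 1(1)[OF assms] 2(2) by (cases "v_L e"; cases "v_R (linv e)") auto
  show "v_L (linv e) = map_option e (v_R e)"
    using 1(2)[OF assms] 2(1) by (cases "v_R e"; cases "v_L (linv e)") auto
qed

lemma v_hdisc:
  assumes "e \<in> labels"
  shows "v_L e = Some v \<Longrightarrow> v \<in> hdisc" "v_R e = Some v \<Longrightarrow> v \<in> hdisc"
  using assms subsetD[OF sides_subset[OF label_side(1)[OF assms]]] subsetD[OF R_subset]
  by (simp_all add: v_L_iff v_R_iff end_of_def)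

lemma v_L_inj: "e \<in> labels \<Longrightarrow> f \<in> labels \<Longrightarrow> v_L e = Some v \<Longrightarrow> v_L f = Some v \<Longrightarrow> e = f"
  and v_R_inj: "e \<in> labels \<Longrightarrow> f \<in> labels \<Longrightarrow> v_R e = Some v \<Longrightarrow> v_R f = Some v \<Longrightarrow> e = f"
  using side_at_end_unique[OF polygon] label_side(1) side_of_inj v_L_iff v_R_iff by metis+

lemma side_across_vertex:
  assumes e: "e \<in> labels" and \<sigma>: "\<sigma> \<in> {1, - 1}" and v: "end_of \<sigma> R (side_of e) v"
  obtains f where "f \<in> labels" "end_of (- \<sigma>) R (side_of (linv f)) v"
proof -
  obtain t where "t \<in> sides R" "end_of (- \<sigma>) R t v"
    using next_side_exists[OF polygon label_side(1)[OF e] \<sigma> v] by metis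
  then obtain f where "f \<in> labels" "end_of (- \<sigma>) R (side_of f) v" using side_has_label by metis
  then show ?thesis using that[of "linv f"] label_linv label_linv_linv by metis
qed

text \<open>The side required by the definition of \<open>l\<close> is the second side of
  \<open>R\<close> at the vertex \<open>v_L e\<close>.\<close>

lemma l_iff:
  assumes e: "e \<in> labels"
  shows "l e = Some f \<longleftrightarrow> f \<in> labels \<and> (\<exists>v. v_L e = Some v \<and> v_R (linv f) = Some v)"
proof (cases "v_L e")
  case (Some v)
  have uniq: "f = f'" if "f \<in> labels" "f' \<in> labels" "v_R (linv f) = Some v" "v_R (linv f') = Some v" for f f'
    using v_R_inj[OF label_linv label_linv] that label_linv_linv by metis
  obtain f0 where f0: "f0 \<in> labels" "v_R (linv f0) = Some v"
    using side_across_vertex[OF e, of 1 v] Some v_L_iff[OF e] v_R_iff[OF label_linv] by auto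
  then have "(THE f. f \<in> labels \<and> v_R (linv f) = Some v) = f0"
    using uniq by (intro the_equality) auto
  then show ?thesis using Some f0 uniq by (auto simp: l_def)
qed (simp add: l_def)

lemma r_iff:
  assumes e: "e \<in> labels"
  shows "r e = Some f \<longleftrightarrow> f \<in> labels \<and> (\<exists>v. v_R e = Some v \<and> v_L (linv f) = Some v)"
proof (cases "v_R e")
  case (Some v)
  have uniq: "f = f'" if "f \<in> labels" "f' \<in> labels" "v_L (linv f) = Some v" "v_L (linv f') = Some v" for f f'
    using v_L_inj[OF label_linv label_linv] that label_linv_linv by metis
  obtain f0 where f0: "f0 \<in> labels" "v_L (linv f0) = Some v"
    using side_across_vertex[OF e, of "- 1" v] Some v_R_iff[OF e] v_L_iff[OF label_linv] by auto
  then have "(THE f. f \<in> labels \<and> v_L (linv f) = Some v) = f0"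
    using uniq by (intro the_equality) auto
  then show ?thesis using Some f0 uniq by (auto simp: r_def)
qed (simp add: r_def)

lemma l_exists: "e \<in> labels \<Longrightarrow> v_L e = Some v \<Longrightarrow> \<exists>f. l e = Some f"
  by (simp add: l_def)

lemma tile_boundary_iff: "x \<in> tile_boundary \<longleftrightarrow> (\<exists>h\<in>G. x \<in> h ` R - interior (h ` R))"
proof -
  have "tile_boundary = (\<Union>h\<in>G. h ` R - interior (h ` R))"
    unfolding tile_boundary_def by (intro SUP_cong refl frontier_polygon tile_polygon)
  then show ?thesis by simp
qed

lemma tile_boundary_image:
  assumes g: "g \<in> G" and x: "x \<in> tile_boundary"
  shows "g x \<in> tile_boundary"
proof -
  obtain h where h: "h \<in> G" "x \<in> h ` R" "x \<notin> interior (h ` R)"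
    using x by (auto simp: tile_boundary_iff)
  obtain k where k: "k \<in> G" "\<And>z. z \<in> hdisc \<Longrightarrow> k z = g (h z)" using G_compose[OF g h(1)] by metis
  have hR: "h ` R \<subseteq> hdisc" by (rule G_image_hdisc[OF h(1) R_subset])
  have kR: "k ` R = g ` h ` R"
    unfolding image_image by (rule image_cong) (use k(2) R_subset in auto)
  have "g x \<in> k ` R" using h(2) kR by simp
  moreover have "g x \<notin> interior (k ` R)"
  proof
    assume "g x \<in> interior (k ` R)"
    then obtain y where y: "y \<in> interior (h ` R)" "g x = g y"
      unfolding kR G_interior[OF g hR] by (elim imageE)
    moreover have "y \<in> hdisc" "x \<in> hdisc" using y h hR subsetD[OF interior_subset] by (metis subsetD)+
    ultimately show False using linv_apply[OF g] h(3) by metis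
  qed
  ultimately show ?thesis using k(1) by (auto simp: tile_boundary_iff)
qed

lemma tile_boundary_image_set: "g \<in> G \<Longrightarrow> L \<subseteq> tile_boundary \<Longrightarrow> g ` L \<subseteq> tile_boundary"
  using tile_boundary_image by auto

lemma geodesic_line_image:
  assumes g: "g \<in> G" and L: "geodesic_line L"
  shows "geodesic_line (g ` L)"
proof -
  obtain b c where bc: "\<bar>b\<bar> < cmod c" "L = geodesic b c" using L by (auto simp: geodesic_line_def)
  obtain b' c' where bc': "\<bar>b'\<bar> < cmod c'"
    "\<And>z. z \<in> hdisc \<Longrightarrow> g z \<in> geodesic b' c' \<longleftrightarrow> z \<in> geodesic b c"
    using half_plane_image[OF g bc(1)] by metis
  have "g ` L = geodesic b' c'"
  proof (rule Set.set_eqI)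
    fix y show "y \<in> g ` L \<longleftrightarrow> y \<in> geodesic b' c'"
    proof
      assume "y \<in> g ` L"
      then obtain z where "z \<in> L" "y = g z" by (elim imageE)
      moreover have "z \<in> hdisc" using calculation(1) bc(2) geodesic_klein by simp
      ultimately show "y \<in> geodesic b' c'" using bc'(2) bc(2) by simp
    next
      assume y: "y \<in> geodesic b' c'"
      then have "y \<in> hdisc" by (simp add: geodesic_klein)
      then have "linv g y \<in> hdisc" "g (linv g y) = y"
        using apply_linv[OF g] G_hdisc[OF linv_G[OF g]] by simp_all
      then show "y \<in> g ` L" using bc'(2)[of "linv g y"] y bc(2) by (metis imageI)
    qed
  qed
  then show ?thesis using bc'(1) by (auto simp: geodesic_line_def)
qed

lemma geodesic_line_hdisc: "geodesic_line L \<Longrightarrow> L \<subseteq> hdisc"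
  by (auto simp: geodesic_line_def geodesic_def)

lemma num_lines_image:
  assumes g: "g \<in> G" and v: "v \<in> hdisc"
  shows "num_lines (g v) = num_lines v"
proof -
  define \<L> where "\<L> v = {L. geodesic_line L \<and> L \<subseteq> tile_boundary \<and> v \<in> L}" for v
  have img: "(`) h ` \<L> v \<subseteq> \<L> (h v)" if "h \<in> G" for h v
    unfolding \<L>_def
    using geodesic_line_image[OF that] tile_boundary_image_set[OF that] by auto
  have inv_img: "linv h ` h ` L = L" if "L \<in> \<L> v" "h \<in> G" for L v h
    using that linv_image geodesic_line_hdisc by (simp add: \<L>_def)
  have "bij_betw ((`) g) (\<L> v) (\<L> (g v))"
  proof (rule bij_betw_byWitness[where f' = "(`) (linv g)"])
    show "\<forall>L\<in>\<L> v. linv g ` g ` L = L" using inv_img g by simp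
    show "\<forall>L\<in>\<L> (g v). g ` linv g ` L = L"
      using inv_img[OF _ linv_G[OF g]] linv_linv[OF g] by simp
    show "(`) g ` \<L> v \<subseteq> \<L> (g v)" by (rule img[OF g])
    show "(`) (linv g) ` \<L> (g v) \<subseteq> \<L> v"
      using img[OF linv_G[OF g], of "g v"] linv_apply[OF g v] by simp
  qed
  then show ?thesis
    unfolding num_lines_def \<L>_def[symmetric] by (rule bij_betw_same_card[symmetric])
qed

end

section \<open>Geodesics through a vertex\<close>

text \<open>A point set on a circle of length \<open>p\<close> is described by its periodic lift
  \<open>\<Theta>\<close>. If it has \<open>n\<close> points, then moving \<open>n\<close> times
  to the next point goes exactly once round the circle.\<close>

lemma successor_period:
  fixes \<theta> :: "nat \<Rightarrow> real" and \<Theta> :: "real set"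
  assumes per: "\<And>t. t \<in> \<Theta> \<Longrightarrow> t + p \<in> \<Theta>" and p: "p > 0"
    and fin: "finite (\<Theta> \<inter> {\<theta> 0..<\<theta> 0 + p})" "card (\<Theta> \<inter> {\<theta> 0..<\<theta> 0 + p}) = n"
    and \<theta>: "\<And>k. \<theta> k \<in> \<Theta>" "\<And>k. \<theta> k < \<theta> (Suc k)"
    and gap: "\<And>k t. t \<in> \<Theta> \<Longrightarrow> \<theta> k < t \<Longrightarrow> \<theta> (Suc k) \<le> t"
  shows "\<theta> n = \<theta> 0 + p"
proof -
  let ?A = "\<Theta> \<inter> {\<theta> 0..<\<theta> 0 + p}"
  have mono: "strict_mono \<theta>" using \<theta>(2) by (simp add: strict_mono_Suc_iff)
  then have inj: "inj \<theta>" by (rule strict_mono_imp_inj_on)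
  have 0: "\<theta> 0 \<le> \<theta> k" for k using mono by (simp add: strict_mono_less_eq)
  \<comment> \<open>as long as the walk has not gone once round, it visits each point of the set once\<close>
  have main: "\<theta> k \<le> \<theta> 0 + p \<and> \<Theta> \<inter> {\<theta> 0..<\<theta> k} = \<theta> ` {..<k}" if "k \<le> n" for k
    using that
  proof (induction k)
    case 0
    then show ?case using p by simp
  next
    case (Suc k)
    then have IH: "\<theta> k \<le> \<theta> 0 + p" "\<Theta> \<inter> {\<theta> 0..<\<theta> k} = \<theta> ` {..<k}" and k: "k < n" by auto
    have "\<theta> k \<noteq> \<theta> 0 + p"
    proof
      assume "\<theta> k = \<theta> 0 + p"
      then have "card ?A = card (\<theta> ` {..<k})" using IH(2) by simp
      also have "\<dots> = k" using inj by (simp add: card_image inj_on_subset)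
      finally show False using fin(2) k by simp
    qed
    then have "\<theta> (Suc k) \<le> \<theta> 0 + p" using IH(1) per[OF \<theta>(1)] gap by simp
    moreover have "\<Theta> \<inter> {\<theta> 0..<\<theta> (Suc k)} = insert (\<theta> k) (\<Theta> \<inter> {\<theta> 0..<\<theta> k})"
    proof (rule Set.set_eqI)
      fix t
      show "t \<in> \<Theta> \<inter> {\<theta> 0..<\<theta> (Suc k)} \<longleftrightarrow> t \<in> insert (\<theta> k) (\<Theta> \<inter> {\<theta> 0..<\<theta> k})"
        using gap[of t k] \<theta>(1)[of k] \<theta>(2)[of k] 0[of k] by (cases t "\<theta> k" rule: linorder_cases) auto
    qed
    ultimately show ?case using IH(2) by (simp add: lessThan_Suc)
  qed
  have n: "\<theta> n \<le> \<theta> 0 + p" "\<Theta> \<inter> {\<theta> 0..<\<theta> n} = \<theta> ` {..<n}" using main[of n] by auto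
  have "card (\<Theta> \<inter> {\<theta> 0..<\<theta> n}) = n" unfolding n(2) using inj by (simp add: card_image inj_on_subset)
  moreover have "\<Theta> \<inter> {\<theta> 0..<\<theta> n} \<subseteq> ?A" using n(1) by auto
  ultimately have *: "\<Theta> \<inter> {\<theta> 0..<\<theta> n} = ?A" using fin by (intro card_subset_eq) auto
  show ?thesis
  proof (rule ccontr)
    assume "\<theta> n \<noteq> \<theta> 0 + p"
    then have "\<theta> n \<in> ?A" using n(1) \<theta>(1) 0 by simp
    then show False using * by auto
  qed
qed

lemma cross_cis: "cross (cis s) (cis t) = sin (t - s)"
  by (simp add: cross_def sin_diff algebra_simps)

lemma next_angle:
  assumes "d = cmod d *\<^sub>R cis \<theta>" "cross d d' > 0"
  obtains \<theta>' where "\<theta> < \<theta>'" "\<theta>' < \<theta> + pi" "d' = cmod d' *\<^sub>R cis \<theta>'"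
proof -
  define y where "y = d' * cis (- \<theta>)"
  have "cross d d' = cmod d * Im y"
    by (subst assms(1)) (simp add: y_def cross_def algebra_simps)
  then have "Im y > 0" using assms(2) by (auto simp: zero_less_mult_iff)
  then have a: "0 < Arg y" "Arg y < pi" using Arg_lt_pi[of y] by auto
  have "d' = y * cis \<theta>" by (simp add: y_def mult.assoc cis_mult)
  also have "y = cmod y *\<^sub>R cis (Arg y)"
    using rcis_cmod_Arg[of y] by (simp add: rcis_def scaleR_conv_of_real)
  finally have "d' = cmod y *\<^sub>R cis (\<theta> + Arg y)" by (simp add: cis_mult add.commute)
  moreover have "cmod y = cmod d'" by (simp add: y_def norm_mult)
  ultimately show ?thesis using a by (intro that[of "\<theta> + Arg y"]) simp_all
qed

lemma klein_point:
  assumes "v \<in> hdisc" "cmod d \<le> 1"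
  obtains \<epsilon> z where "\<epsilon> > 0" "z \<in> hdisc" "klein z = klein v + \<epsilon> *\<^sub>R d"
proof -
  have "cmod (klein v) < 1" using klein_in_hdisc[OF assms(1)] by simp
  then have \<epsilon>: "(1 - cmod (klein v)) / 2 > 0" by simp
  have "cmod (klein v + ((1 - cmod (klein v)) / 2) *\<^sub>R d) \<le> cmod (klein v) + (1 - cmod (klein v)) / 2"
  proof (rule norm_triangle_le, rule add_left_mono)
    have "(1 - cmod (klein v)) / 2 * cmod d \<le> (1 - cmod (klein v)) / 2 * 1"
      using \<epsilon> assms(2) by (intro mult_left_mono) simp_all
    then show "cmod (((1 - cmod (klein v)) / 2) *\<^sub>R d) \<le> (1 - cmod (klein v)) / 2" using \<epsilon> by simp
  qed
  also have "\<dots> < 1" using \<epsilon> by (simp add: field_simps)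
  finally have "klein v + ((1 - cmod (klein v)) / 2) *\<^sub>R d \<in> klein ` hdisc"
    unfolding klein_surj by simp
  then show ?thesis using that \<epsilon> by (metis imageE)
qed

definition line_at :: "complex \<Rightarrow> real \<Rightarrow> complex set" where
  "line_at v t = {z \<in> hdisc. cross (cis t) (klein z - klein v) = 0}"

lemma line_at_geodesic:
  assumes "v \<in> hdisc"
  shows "geodesic_line (line_at v t)"
  unfolding geodesic_line_def
proof (intro exI conjI)
  let ?c = "\<i> * cis t"
  have c: "?c \<bullet> x = cross (cis t) x" for x by (simp add: inner_complex_def cross_def algebra_simps)
  have "\<bar>?c \<bullet> klein v\<bar> \<le> cmod ?c * cmod (klein v)" by (rule Cauchy_Schwarz_ineq2)
  also have "\<dots> < cmod ?c" using klein_in_hdisc[OF assms] by (simp add: norm_mult)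
  finally show "\<bar>?c \<bullet> klein v\<bar> < cmod ?c" .
  show "line_at v t = geodesic (?c \<bullet> klein v) ?c"
    by (rule Set.set_eqI) (simp add: geodesic_klein line_at_def c[symmetric] inner_diff_right)
qed

lemma line_at_shift: "line_at v (t + of_int k * pi) = line_at v t"
proof -
  have s: "sin (of_int k * pi) = 0" by (simp add: sin_zero_iff_int2)
  then have c: "cos (of_int k * pi) \<noteq> 0" using sin_cos_squared_add[of "of_int k * pi"] by auto
  have "cis (t + of_int k * pi) = cos (of_int k * pi) *\<^sub>R cis t"
    using s by (simp add: complex_eq_iff cos_add sin_add)
  then show ?thesis using c by (simp add: line_at_def)
qed

text \<open>Up to multiples of \<open>pi\<close>, which reverse the direction, geodesics through a
  point correspond to angles.\<close>

lemma geodesic_line_at: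
  assumes "geodesic_line L" "v \<in> L"
  obtains t where "t \<in> {a..<a + pi}" "L = line_at v t"
proof -
  obtain b c where bc: "\<bar>b\<bar> < cmod c" "L = geodesic b c" using assms(1) by (auto simp: geodesic_line_def)
  have c0: "cmod c > 0" using bc(1) by linarith
  have v: "c \<bullet> klein v = b" using assms(2) bc(2) geodesic_klein by simp
  define t where "t = Arg (- \<i> * c)"
  have "- \<i> * c = cmod c *\<^sub>R cis t"
    using rcis_cmod_Arg[of "- \<i> * c"] by (simp add: t_def rcis_def scaleR_conv_of_real norm_mult)
  then have "cross (- \<i> * c) x = cmod c * cross (cis t) x" for x by simp
  moreover have "cross (- \<i> * c) x = c \<bullet> x" for x by (simp add: cross_def inner_complex_def)
  ultimately have cx: "c \<bullet> x = cmod c * cross (cis t) x" for x by simp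
  have L: "L = line_at v t"
  proof (rule Set.set_eqI)
    fix z
    have "c \<bullet> klein z = b \<longleftrightarrow> c \<bullet> (klein z - klein v) = 0" by (simp add: inner_diff_right v)
    also have "\<dots> \<longleftrightarrow> cross (cis t) (klein z - klein v) = 0" using cx c0 by simp
    finally show "z \<in> L \<longleftrightarrow> z \<in> line_at v t" by (simp add: bc(2) geodesic_klein line_at_def)
  qed
  define k where "k = \<lfloor>(t - a) / pi\<rfloor>"
  have "of_int k \<le> (t - a) / pi" "(t - a) / pi < of_int k + 1" by (simp_all add: k_def)
  then have "of_int k * pi \<le> t - a" "t - a < of_int k * pi + pi"
    by (simp_all add: pos_le_divide_eq pos_divide_less_eq distrib_right)
  then have "t + of_int (- k) * pi \<in> {a..<a + pi}" by simp
  moreover have "L = line_at v (t + of_int (- k) * pi)" unfolding line_at_shift by (fact L)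
  ultimately show ?thesis by (rule that)
qed

lemma inj_on_line_at:
  assumes "v \<in> hdisc"
  shows "inj_on (line_at v) {a..<a + pi}"
proof (rule inj_onI)
  fix t t' assume t: "t \<in> {a..<a + pi}" "t' \<in> {a..<a + pi}" and eq: "line_at v t = line_at v t'"
  obtain \<epsilon> z where z: "\<epsilon> > 0" "z \<in> hdisc" "klein z = klein v + \<epsilon> *\<^sub>R cis t"
    using klein_point[OF assms, of "cis t"] by auto
  have "cross (cis t) (klein z - klein v) = 0" unfolding z(3) by (simp add: cross_cis)
  then have "z \<in> line_at v t" using z(2) by (simp add: line_at_def)
  then have "z \<in> line_at v t'" using eq by simp
  then have "\<epsilon> * sin (t - t') = 0" unfolding line_at_def by (simp add: z(3) cross_cis)
  then have s: "sin (t - t') = 0" using z(1) by simp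
  have "\<not> t' < t" using s t sin_gt_zero[of "t - t'"] by auto
  moreover have "\<not> t < t'" using s t sin_gt_zero[of "t' - t"] sin_minus[of "t - t'"] by auto
  ultimately show "t = t'" by simp
qed

lemma line_through_points:
  assumes L: "geodesic_line L" "v \<in> L" "w \<in> L" "v \<noteq> w" and d: "klein w - klein v = a *\<^sub>R cis t" "a \<noteq> 0"
  shows "L = line_at v t"
proof -
  obtain b c where bc: "\<bar>b\<bar> < cmod c" "L = geodesic b c" using L(1) by (auto simp: geodesic_line_def)
  obtain \<rho> where \<rho>: "\<rho> \<noteq> 0" "\<And>x. c \<bullet> klein x - b = \<rho> * ori v w x"
    using geodesic_ori[OF bc(1)] L(2-4) unfolding bc(2) by metis
  show ?thesis
  proof (rule Set.set_eqI)
    fix z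
    have "c \<bullet> klein z = b \<longleftrightarrow> \<rho> * (a * cross (cis t) (klein z - klein v)) = 0"
      using \<rho>(2)[of z] by (simp only: ori_def d(1) cross_scaleR) (metis eq_iff_diff_eq_0)
    then show "z \<in> L \<longleftrightarrow> z \<in> line_at v t"
      using \<rho>(1) d(2) by (simp add: bc(2) geodesic_klein line_at_def)
  qed
qed

text \<open>Two sides that start at \<open>v\<close> in the same direction share the shorter of
  the two, and both polygons lie on the same side \<open>\<sigma>\<close> of it.\<close>

lemma same_ray_overlap:
  assumes PQ: "convex_polygon P" "convex_polygon Q"
    and e: "end_of \<sigma> P s v" "end_of \<sigma> Q t v" and st: "s \<subseteq> P" "t \<subseteq> Q"
    and w: "w \<in> s" "w \<noteq> v" "w' \<in> t" "w' \<noteq> v"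
    and a: "klein w - klein v = a *\<^sub>R (klein w' - klein v)" "0 < a" "a \<le> 1"
  shows "interior P \<inter> interior Q \<noteq> {}"
proof -
  have v: "v \<in> P" "v \<in> Q" using e st by (auto simp: end_of_def)
  have wP: "w \<in> P" "w' \<in> Q" using w st by auto
  have "klein w = (1 - a) *\<^sub>R klein v + a *\<^sub>R klein w'"
    using a(1) by (simp add: algebra_simps)
  also have "\<dots> \<in> klein ` Q"
    using convex_klein_polygon[OF PQ(2)] v(2) wP(2) a(2,3) by (intro convexD_alt) simp_all
  finally obtain w'' where "w'' \<in> Q" "klein w = klein w''" by (elim imageE)
  then have wQ: "w \<in> Q"
    using klein_eq_iff subsetD[OF polygon_subset] PQ wP(1) by metis
  obtain z z' where z: "z \<in> interior P" "z' \<in> interior Q"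
    using polygon_interior[OF PQ(1)] polygon_interior[OF PQ(2)] by auto
  have 1: "\<sigma> * ori v w z > 0" using e(1) w z by (auto simp: end_of_def)
  have "\<sigma> * ori v w' z' > 0" using e(2) w z by (auto simp: end_of_def)
  moreover have "ori v w z' = a * ori v w' z'" by (simp add: ori_def a(1))
  ultimately have "\<sigma> * ori v w z' > 0"
    using mult_pos_pos[OF a(2)] by (metis mult.left_commute)
  with 1 show ?thesis using interiors_overlap[OF PQ _ _ z] v wP wQ by (metis IntI)
qed

context even_corner_tiling
begin

text \<open>A point of another tile is a limit of interior points of that tile, so it cannot be
  interior to this one.\<close>

lemma interior_tile_boundary:
  assumes g: "g \<in> G" and x: "x \<in> interior (g ` R)"
  shows "x \<notin> tile_boundary"
proof
  assume "x \<in> tile_boundary"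
  then obtain h where h: "h \<in> G" "x \<in> h ` R" "x \<notin> interior (h ` R)" by (auto simp: tile_boundary_iff)
  have "open (klein ` interior (g ` R))"
    using interior_klein_image[OF polygon_subset[OF tile_polygon[OF g]]] open_interior by metis
  moreover have "klein x \<in> closure (klein ` interior (h ` R))"
    by (rule polygon_in_closure_interior[OF tile_polygon[OF h(1)] h(2)])
  ultimately have "klein ` interior (g ` R) \<inter> klein ` interior (h ` R) \<noteq> {}"
    using x open_Int_closure_eq_empty by blast
  then obtain y y' where y: "y \<in> interior (g ` R)" "y' \<in> interior (h ` R)" "klein y = klein y'"
    by auto
  have "y \<in> hdisc" "y' \<in> hdisc"
    using y subsetD[OF interior_subset] subsetD[OF polygon_subset[OF tile_polygon]] g h(1) by metis+
  then have "y = y'" using y(3) klein_eq_iff by metis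
  then have "g = h" using tiles_overlap[OF g h(1)] y by auto
  then show False using x h(3) by simp
qed

text \<open>The directions at \<open>v\<close> of the geodesics contained in the union of the tile
  boundaries. Each geodesic appears with its two opposite directions, so
  \<open>num_lines v\<close> counts them modulo \<open>pi\<close>.\<close>

definition directions :: "complex \<Rightarrow> real set" where
  "directions v = {t. line_at v t \<subseteq> tile_boundary}"

lemma directions_pi: "t \<in> directions v \<Longrightarrow> t + pi \<in> directions v"
  using line_at_shift[of v t 1] by (simp add: directions_def)

text \<open>Where there are infinitely many geodesics, \<open>num_lines v\<close> has the default
  value 0; a positive value therefore gives finiteness.\<close>

lemma directions_num_lines:
  assumes v: "v \<in> hdisc" and n: "num_lines v > 0"
  shows "finite (directions v \<inter> {a..<a + pi})" "card (directions v \<inter> {a..<a + pi}) = num_lines v"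
proof -
  let ?L = "{L. geodesic_line L \<and> L \<subseteq> tile_boundary \<and> v \<in> L}"
  have "bij_betw (line_at v) (directions v \<inter> {a..<a + pi}) ?L"
    unfolding bij_betw_def
  proof (intro conjI)
    show "inj_on (line_at v) (directions v \<inter> {a..<a + pi})"
      using inj_on_line_at[OF v, of a] by (rule inj_on_subset) simp
    have "v \<in> line_at v t" for t using v by (simp add: line_at_def cross_def)
    then have "line_at v ` (directions v \<inter> {a..<a + pi}) \<subseteq> ?L"
      using line_at_geodesic[OF v] by (auto simp: directions_def)
    moreover have "L \<in> line_at v ` (directions v \<inter> {a..<a + pi})" if "L \<in> ?L" for L
    proof -
      have "geodesic_line L" "v \<in> L" using that by simp_all
      then obtain t where "t \<in> {a..<a + pi}" "L = line_at v t" by (rule geodesic_line_at)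
      then show ?thesis using that by (auto simp: directions_def)
    qed
    ultimately show "line_at v ` (directions v \<inter> {a..<a + pi}) = ?L" by auto
  qed
  then have "card (directions v \<inter> {a..<a + pi}) = card ?L" "finite (directions v \<inter> {a..<a + pi}) = finite ?L"
    by (rule bij_betw_same_card, rule bij_betw_finite)
  moreover have "finite ?L" using n unfolding num_lines_def by (rule card_ge_0_finite)
  ultimately show "finite (directions v \<inter> {a..<a + pi})" "card (directions v \<inter> {a..<a + pi}) = num_lines v"
    by (simp_all add: num_lines_def)
qed

text \<open>The heart of the matter: around a vertex there are \<open>2 * num_lines v\<close>
  tiles. Tile number \<open>k\<close> is a sector at \<open>v\<close> between the directions
  \<open>\<theta> k\<close> and \<open>\<theta> (Suc k)\<close> of the sides
  \<open>S k\<close> and \<open>S (Suc k)\<close>. By the even corner property these directions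
  belong to the set \<open>directions v\<close>, which is invariant under \<open>pi\<close>. No
  direction of this set points into the interior of the sector, so
  \<open>\<theta> (Suc k)\<close> is the successor of \<open>\<theta> k\<close> in it. Hence
  \<open>num_lines v\<close> steps make a half turn and twice as many make a full turn, after
  which the tile overlaps the initial one.\<close>

lemma full_turn:
  fixes g :: "nat \<Rightarrow> label" and S :: "nat \<Rightarrow> complex set"
  assumes g: "\<And>k. g k \<in> G" and S: "\<And>k. S k \<in> sides (g k ` R)" "\<And>k. S (Suc k) \<in> sides (g k ` R)"
    and e: "\<And>k. end_of 1 (g k ` R) (S k) v" "\<And>k. end_of (- 1) (g k ` R) (S (Suc k)) v"
    and even: "\<And>k. \<exists>L. geodesic_line L \<and> L \<subseteq> tile_boundary \<and> S k \<subseteq> L"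
    and n: "num_lines v > 0"
  shows "g (2 * num_lines v) = g 0"
proof -
  note T = tile_polygon[OF g]
  have vS: "v \<in> S k" for k using e(1)[of k] by (simp add: end_of_def)
  have ST: "S k \<subseteq> g k ` R" "S (Suc k) \<subseteq> g k ` R" for k using S sides_subset by metis+
  have v: "v \<in> hdisc" by (rule subsetD[OF polygon_subset[OF T] subsetD[OF ST(1) vS]])
  have "\<exists>w. w \<in> S k \<and> w \<noteq> v" for k using side_other_point[OF S(1)] by metis
  then obtain w where w: "\<And>k. w k \<in> S k" "\<And>k. w k \<noteq> v" by metis
  have wd: "w k \<in> hdisc" for k by (rule subsetD[OF polygon_subset[OF T] subsetD[OF ST(1) w(1)]])
  define d where "d k = klein (w k) - klein v" for k
  have d0: "d k \<noteq> 0" for k using klein_eq_iff[OF wd v] w(2) by (simp add: d_def)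
  have d_ori: "ori v (w k) x = cross (d k) (klein x - klein v)" for k x by (simp add: ori_def d_def)
  have turn_pos: "cross (d k) (d (Suc k)) > 0" for k
  proof -
    have in_T: "w (Suc k) \<in> g k ` R" by (rule subsetD[OF ST(2) w(1)])
    have "1 * ori v (w k) (w (Suc k)) \<ge> 0" by (rule end_of_nonneg[OF T e(1) w(1) in_T])
    moreover have "ori v (w k) (w (Suc k)) \<noteq> 0"
    proof
      assume "ori v (w k) (w (Suc k)) = 0"
      then have "w (Suc k) \<in> S k"
        using side_line[OF T S(1) vS w(1) w(2)[symmetric]] in_T by auto
      then have "S k = S (Suc k)"
        using side_line[OF T S(1) vS _ w(2)[symmetric]] side_line[OF T S(2) vS w(1) w(2)[symmetric]] by metis
      then have "w k \<in> S (Suc k)" using w(1) by metis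
      moreover obtain z where "z \<in> interior (g k ` R)" using polygon_interior[OF T] by auto
      ultimately have "1 * ori v (w k) z > 0" "- 1 * ori v (w k) z > 0"
        using e(1)[of k] e(2)[of k] w(1)[of k] w(2)[of k] by (simp_all add: end_of_def)
      then show False by simp
    qed
    ultimately show ?thesis unfolding d_ori d_def[symmetric] by simp
  qed
  have "\<exists>\<theta>. \<forall>k. d k = cmod (d k) *\<^sub>R cis (\<theta> k) \<and> (\<theta> k < \<theta> (Suc k) \<and> \<theta> (Suc k) < \<theta> k + pi)"
  proof (rule dependent_nat_choice)
    show "\<exists>t. d 0 = cmod (d 0) *\<^sub>R cis t"
      using rcis_cmod_Arg[of "d 0"] by (intro exI[of _ "Arg (d 0)"]) (simp add: rcis_def scaleR_conv_of_real)
    show "\<exists>t'. d (Suc k) = cmod (d (Suc k)) *\<^sub>R cis t' \<and> t < t' \<and> t' < t + pi"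
      if "d k = cmod (d k) *\<^sub>R cis t" for t k
      using next_angle[OF that turn_pos] by metis
  qed
  then obtain \<theta> where \<theta>: "\<And>k. d k = cmod (d k) *\<^sub>R cis (\<theta> k)" "\<And>k. \<theta> k < \<theta> (Suc k)"
    "\<And>k. \<theta> (Suc k) < \<theta> k + pi" by metis
  have dir: "\<theta> k \<in> directions v" for k
  proof -
    obtain L where L: "geodesic_line L" "L \<subseteq> tile_boundary" "S k \<subseteq> L" using even by metis
    have "L = line_at v (\<theta> k)"
      using line_through_points[OF L(1) _ _ w(2)[symmetric], of k "cmod (d k)" "\<theta> k"]
        subsetD[OF L(3)] vS w(1) \<theta>(1)[of k] d0[of k] by (simp add: d_def)
    then show ?thesis using L(2) by (simp add: directions_def)
  qed
  have gap: "\<theta> (Suc k) \<le> t" if t: "t \<in> directions v" "\<theta> k < t" for k t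
  proof (rule ccontr)
    assume "\<not> \<theta> (Suc k) \<le> t"
    then have t': "t < \<theta> (Suc k)" by simp
    let ?D = "cross (d k) (d (Suc k))"
    \<comment> \<open>in this case \<open>cis t\<close> is a positive combination of the two sides and points into the interior of the tile\<close>
    define a where "a = cross (cis t) (d (Suc k)) / ?D"
    define b where "b = cross (d k) (cis t) / ?D"
    have "cross (cis t) (d (Suc k)) = cmod (d (Suc k)) * sin (\<theta> (Suc k) - t)"
      by (subst \<theta>(1)) (simp add: cross_cis)
    moreover have "sin (\<theta> (Suc k) - t) > 0" using t t' \<theta>(3)[of k] by (intro sin_gt_zero) simp_all
    ultimately have a: "a > 0" using turn_pos[of k] d0 by (simp add: a_def)
    have "cross (d k) (cis t) = cmod (d k) * sin (t - \<theta> k)"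
      by (subst \<theta>(1)) (simp add: cross_cis)
    moreover have "sin (t - \<theta> k) > 0" using t t' \<theta>(3)[of k] by (intro sin_gt_zero) simp_all
    ultimately have b: "b > 0" using turn_pos[of k] d0 by (simp add: b_def)
    have "?D *\<^sub>R cis t = cross (cis t) (d (Suc k)) *\<^sub>R d k + cross (d k) (cis t) *\<^sub>R d (Suc k)"
      by (rule cross_basis)
    also have "\<dots> = ?D *\<^sub>R (a *\<^sub>R d k + b *\<^sub>R d (Suc k))"
      using turn_pos[of k] by (simp add: a_def b_def scaleR_add_right)
    finally have comb: "cis t = a *\<^sub>R d k + b *\<^sub>R d (Suc k)" using turn_pos[of k] by simp
    define \<epsilon> where "\<epsilon> = 1 / (a + b + 1)"
    have \<epsilon>: "\<epsilon> > 0" "\<epsilon> * a + \<epsilon> * b < 1"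
      using a b by (simp_all add: \<epsilon>_def add_pos_pos flip: add_divide_distrib)
    have "v \<in> g k ` R" "w k \<in> g k ` R" "w (Suc k) \<in> g k ` R"
      using subsetD[OF ST(1) vS] subsetD[OF ST(1) w(1)] subsetD[OF ST(2) w(1)] .
    moreover have "ori v (w k) (w (Suc k)) \<noteq> 0" unfolding d_ori d_def[symmetric] using turn_pos[of k] by simp
    ultimately obtain x where x: "x \<in> interior (g k ` R)"
      "klein x = klein v + (\<epsilon> * a) *\<^sub>R (klein (w k) - klein v) + (\<epsilon> * b) *\<^sub>R (klein (w (Suc k)) - klein v)"
      using triangle_interior[OF T _ _ _ _ mult_pos_pos[OF \<epsilon>(1) a] mult_pos_pos[OF \<epsilon>(1) b] \<epsilon>(2)] by metis
    have "klein x - klein v = \<epsilon> *\<^sub>R cis t"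
      unfolding x(2) comb d_def by (simp add: algebra_simps)
    then have "cross (cis t) (klein x - klein v) = 0" by (simp add: cross_cis)
    moreover have "x \<in> hdisc"
      using x(1) subsetD[OF interior_subset] subsetD[OF polygon_subset[OF T]] by metis
    ultimately have "x \<in> tile_boundary" using t(1) by (auto simp: directions_def line_at_def)
    then show False using interior_tile_boundary[OF g x(1)] by simp
  qed
  define n where "n = num_lines v"
  have half: "\<theta> (n + m) = \<theta> m + pi" for m
    using successor_period[of "directions v" pi "\<lambda>k. \<theta> (k + m)" n]
      directions_pi directions_num_lines[OF v n, of "\<theta> m"] dir \<theta>(2) gap by (simp add: n_def)
  have "\<theta> (2 * n) = \<theta> 0 + 2 * pi" 
    unfolding mult_2 half[of n] using half[of 0] by simp
  then have cis: "cis (\<theta> (2 * n)) = cis (\<theta> 0)" by (simp add: complex_eq_iff)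
  have pos: "cmod (d k) > 0" for k using d0 by simp
  have ray: "interior (g i ` R) \<inter> interior (g j ` R) \<noteq> {}"
    if ij: "cis (\<theta> i) = cis (\<theta> j)" "cmod (d i) \<le> cmod (d j)" for i j
  proof (rule same_ray_overlap[OF T T e(1) e(1) ST(1) ST(1) w(1) w(2) w(1) w(2)])
    have "d i = (cmod (d i) / cmod (d j)) *\<^sub>R (cmod (d j) *\<^sub>R cis (\<theta> j))"
      using \<theta>(1)[of i] ij(1) pos[of j] by simp
    then have "d i = (cmod (d i) / cmod (d j)) *\<^sub>R d j" by (simp only: \<theta>(1)[of j, symmetric])
    then show "klein (w i) - klein v = (cmod (d i) / cmod (d j)) *\<^sub>R (klein (w j) - klein v)"
      by (simp only: d_def)
    show "0 < cmod (d i) / cmod (d j)" "cmod (d i) / cmod (d j) \<le> 1"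
      using pos[of i] pos[of j] ij(2) by simp_all
  qed
  show ?thesis
  proof (cases "cmod (d (2 * n)) \<le> cmod (d 0)")
    case True
    then show ?thesis using tiles_overlap[OF g g ray[OF cis]] by (simp add: n_def)
  next
    case False
    then show ?thesis using tiles_overlap[OF g g ray[OF cis[symmetric]]] by (simp add: n_def)
  qed
qed

end

section \<open>The walk around a vertex\<close>

context even_corner_tiling
begin

lemma num_lines_map:
  assumes "e \<in> labels"
  shows "v_L e = Some v \<Longrightarrow> \<exists>u. v_R (linv e) = Some u \<and> num_lines u = num_lines v"
    "v_R e = Some v \<Longrightarrow> \<exists>u. v_L (linv e) = Some u \<and> num_lines u = num_lines v"
  using v_linv[OF assms] num_lines_image[OF label_G[OF assms]] v_hdisc[OF assms] by simp_all

text \<open>The maps \<open>l\<close> and \<open>r\<close> are inverse to each other up to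
  inversion of labels, and they do not change the number of lines at the vertex. The reversals of
  transitions at a vertex rest on these two facts.\<close>

lemma l_props:
  assumes e: "e \<in> labels" and f: "l e = Some f"
  shows "f \<in> labels" "r (linv f) = Some (linv e)"
    "\<exists>v u. v_L e = Some v \<and> v_R (linv f) = Some v \<and> v_L f = Some u \<and> num_lines u = num_lines v"
proof -
  obtain v where v: "f \<in> labels" "v_L e = Some v" "v_R (linv f) = Some v" using f l_iff[OF e] by auto
  show "f \<in> labels" by fact
  show "r (linv f) = Some (linv e)"
    using v r_iff[OF label_linv[OF v(1)]] label_linv[OF e] label_linv_linv[OF e] by simp
  show "\<exists>v u. v_L e = Some v \<and> v_R (linv f) = Some v \<and> v_L f = Some u \<and> num_lines u = num_lines v"
    using num_lines_map(2)[OF label_linv[OF v(1)] v(3)] v label_linv_linv[OF v(1)] by auto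
qed

lemma r_props:
  assumes e: "e \<in> labels" and f: "r e = Some f"
  shows "f \<in> labels" "l (linv f) = Some (linv e)"
    "\<exists>v u. v_R e = Some v \<and> v_L (linv f) = Some v \<and> v_R f = Some u \<and> num_lines u = num_lines v"
proof -
  obtain v where v: "f \<in> labels" "v_R e = Some v" "v_L (linv f) = Some v" using f r_iff[OF e] by auto
  show "f \<in> labels" by fact
  show "l (linv f) = Some (linv e)"
    using v l_iff[OF label_linv[OF v(1)]] label_linv[OF e] label_linv_linv[OF e] by simp
  show "\<exists>v u. v_R e = Some v \<and> v_L (linv f) = Some v \<and> v_R f = Some u \<and> num_lines u = num_lines v"
    using num_lines_map(1)[OF label_linv[OF v(1)] v(3)] v label_linv_linv[OF v(1)] by auto
qed

lemma l_iter_0: "l_iter 0 e = Some e"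
  and l_iter_Suc: "l_iter (Suc m) e = Option.bind (l_iter m e) l"
  by (simp_all add: l_iter_def)

lemma l_iter_add: "l_iter (m + k) e = Option.bind (l_iter m e) (l_iter k)"
  by (induction k) (simp_all add: l_iter_0 l_iter_Suc Option.bind_assoc)

lemma l_iter_props:
  assumes e: "e \<in> labels" and v: "v_L e = Some v"
  shows "l_iter m e = Some f \<Longrightarrow> f \<in> labels \<and> (\<exists>u. v_L f = Some u \<and> num_lines u = num_lines v)"
proof (induction m arbitrary: f)
  case 0
  then show ?case using assms by (simp add: l_iter_0)
next
  case (Suc m)
  then obtain f' where f': "l_iter m e = Some f'" "l f' = Some f"
    by (auto simp: l_iter_Suc bind_eq_Some_conv)
  then show ?case using Suc.IH[OF f'(1)] l_props[of f' f] by auto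
qed

text \<open>Iterating \<open>l\<close> from \<open>e\<close> means to walk around the vertex
  \<open>v\<close>: if \<open>f k\<close> is the \<open>k\<close>-th label, then the
  \<open>k\<close>-th tile is \<open>g k ` R\<close> with \<open>g k\<close> the product of
  \<open>f 1\<close> to \<open>f k\<close>, entered through the side \<open>S k\<close>. After
  a full turn \<open>g\<close> is the identity, so \<open>R\<close> is entered through the same
  side as at the beginning.\<close>

lemma l_iter_period:
  assumes e: "e \<in> labels" and v: "v_L e = Some v" and n: "num_lines v > 0"
  shows "l_iter (2 * num_lines v) e = Some e"
proof -
  have ex: "\<exists>f. l_iter k e = Some f" for k
  proof (induction k)
    case (Suc k)
    then show ?case using l_iter_props[OF e v] l_exists by (fastforce simp: l_iter_Suc)
  qed (simp add: l_iter_0)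
  define f where "f k = the (l_iter k e)" for k
  have f: "l_iter k e = Some (f k)" for k using ex[of k] by (auto simp: f_def)
  have f0: "f 0 = e" by (simp add: f_def l_iter_0)
  have flab: "f k \<in> labels" for k using l_iter_props[OF e v f] by blast
  have fstep: "l (f k) = Some (f (Suc k))" for k using f[of "Suc k"] f[of k] by (simp add: l_iter_Suc)
  obtain u where u: "\<And>k. v_L (f k) = Some (u k)" using l_iter_props[OF e v f] by metis
  have u0: "u 0 = v" using u[of 0] v f0 by simp
  have uR: "v_R (linv (f (Suc k))) = Some (u k)" for k
    using l_props(3)[OF flab fstep[of k]] u[of k] by auto
  have fu: "f (Suc k) (u (Suc k)) = u k" for k
    using uR[of k] v_linv(1)[OF flab[of "Suc k"]] u[of "Suc k"] by simp
  define g where "g = rec_nat (\<one>\<^bsub>BijGroup hdisc\<^esub>) (\<lambda>k h. h \<otimes>\<^bsub>BijGroup hdisc\<^esub> f (Suc k))"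
  have g0: "g 0 = \<one>\<^bsub>BijGroup hdisc\<^esub>" and gSuc: "g (Suc k) = g k \<otimes>\<^bsub>BijGroup hdisc\<^esub> f (Suc k)" for k
    by (simp_all add: g_def)
  have gG: "g k \<in> G" for k
    by (induction k) (simp_all only: g0 gSuc G_one subgroup.m_closed[OF G_subgroup] label_G[OF flab])
  have g_apply: "g (Suc k) z = g k (f (Suc k) z)" if "z \<in> hdisc" for k z
    using G_Bij[OF gG[of k]] G_Bij[OF label_G[OF flab[of "Suc k"]]] that
    unfolding gSuc by (simp add: BijGroup_def compose_def)
  have ud: "u k \<in> hdisc" for k using v_hdisc(1)[OF flab u] .
  have gu: "g k (u k) = v" for k
  proof (induction k)
    case 0
    then show ?case using u0 ud[of 0] by (simp only: g0 one_apply)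
  next
    case (Suc k)
    then show ?case by (simp only: g_apply[OF ud] fu)
  qed
  define S where "S k = g k ` side_of (f k)" for k
  have side_d: "side_of (f k) \<subseteq> hdisc" for k
    using sides_subset[OF label_side(1)[OF flab]] R_subset by (rule order_trans)
  have SSuc: "S (Suc k) = g k ` side_of (linv (f (Suc k)))" for k
    unfolding S_def side_of_linv[OF flab] image_image
    by (rule image_cong[OF refl]) (rule g_apply[OF subsetD[OF side_d]])
  have S_sides: "S k \<in> sides (g k ` R)" "S (Suc k) \<in> sides (g k ` R)" for k
    unfolding SSuc unfolding S_def
    by (intro sides_image gG R_subset label_side label_linv flab)+
  have S_end: "end_of 1 (g k ` R) (S k) v" "end_of (- 1) (g k ` R) (S (Suc k)) v" for k
  proof -
    have "end_of 1 R (side_of (f k)) (u k)" using u v_L_iff[OF flab] by simp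
    then have "end_of 1 (g k ` R) (g k ` side_of (f k)) (g k (u k))"
      by (intro end_of_image[OF gG R_subset]) (simp_all add: sides_subset label_side flab)
    then show "end_of 1 (g k ` R) (S k) v" by (simp only: S_def gu)
    have "end_of (- 1) R (side_of (linv (f (Suc k)))) (u k)" using uR v_R_iff[OF label_linv[OF flab]] by simp
    then have "end_of (- 1) (g k ` R) (g k ` side_of (linv (f (Suc k)))) (g k (u k))"
      by (intro end_of_image[OF gG R_subset]) (simp_all add: sides_subset label_side flab label_linv)
    then show "end_of (- 1) (g k ` R) (S (Suc k)) v" by (simp only: SSuc gu)
  qed
  have even: "\<exists>L. geodesic_line L \<and> L \<subseteq> tile_boundary \<and> S k \<subseteq> L" for k
  proof -
    have s: "side_of (f k) \<in> sides R" by (rule label_side[OF flab])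
    then obtain b c where "\<bar>b\<bar> < cmod c" "side_of (f k) = R \<inter> geodesic b c"
      unfolding sides_def by auto
    then have L: "geodesic_line (geodesic b c)" "side_of (f k) \<subseteq> geodesic b c"
      by (auto simp: geodesic_line_def)
    then have "geodesic b c \<subseteq> tile_boundary" using even_corners[OF s] by metis
    then show ?thesis
      using L geodesic_line_image[OF gG L(1)] tile_boundary_image_set[OF gG]
      by (intro exI[of _ "g k ` geodesic b c"]) (simp add: S_def image_mono)
  qed
  let ?m = "2 * num_lines v"
  have "g ?m = g 0" by (rule full_turn[of g S v, OF gG S_sides S_end even n])
  then have "u ?m = v" using gu[of ?m] one_apply[OF ud] by (simp add: g0)
  then have "f ?m = e" using v_L_inj[OF flab e] u[of ?m] v by simp
  then show ?thesis using f by simp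
qed

section \<open>The involution on states\<close>

text \<open>The group elements are homeomorphisms of the disc, so paired sides are compact at the
  same time.\<close>

lemma special_linv:
  assumes "e \<in> labels"
  shows "special (linv e) \<longleftrightarrow> special e"
proof -
  have imp: "compact (side_of (linv f))" if f: "f \<in> labels" "compact (side_of f)" for f
    unfolding side_of_linv[OF f(1)]
    by (rule compact_continuous_image[OF _ f(2)],
        rule continuous_on_subset[OF continuous_on_isometry[OF G_isometry[OF label_G[OF f(1)]]]],
        rule order_trans[OF sides_subset[OF label_side(1)[OF f(1)]] R_subset])
  then have "compact (side_of (linv e)) \<longleftrightarrow> compact (side_of e)"
    using label_linv[OF assms] label_linv_linv[OF assms] assms by metis
  then show ?thesis using assms label_linv[OF assms] by (simp add: special_def)
qed

text \<open>The condition under which \<open>n_lab\<close> can be read off from either label; it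
  holds for the pairs that occur in the \<open>B\<close>- and \<open>C\<close>-states.\<close>

definition balanced :: "label \<Rightarrow> label \<Rightarrow> bool" where
  "balanced eL eR \<longleftrightarrow> eL \<in> labels \<and> eR \<in> labels \<and>
     (\<exists>u w. v_R eL = Some u \<and> v_L eR = Some w \<and> num_lines u = num_lines w)"

lemma balanced_linv:
  assumes "balanced eL eR"
  shows "balanced (linv eR) (linv eL)" "n_lab (linv eR) (linv eL) = n_lab eL eR"
proof -
  obtain u w where *: "eL \<in> labels" "eR \<in> labels" "v_R eL = Some u" "v_L eR = Some w" "num_lines u = num_lines w"
    using assms by (auto simp: balanced_def)
  then show "balanced (linv eR) (linv eL)" "n_lab (linv eR) (linv eL) = n_lab eL eR"
    using num_lines_map(2)[OF *(1,3)] num_lines_map(1)[OF *(2,4)] label_linv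
    by (auto simp: balanced_def n_lab_def)
qed

lemma balanced_B:
  assumes "is_state (B eL eR)"
  shows "balanced eL eR"
proof -
  obtain v where v: "eL \<in> labels" "eR \<in> labels" "v_L (linv eL) = Some v" "v_R (linv eR) = Some v"
    using assms by auto
  show ?thesis
    using num_lines_map(1)[OF label_linv[OF v(1)] v(3)] num_lines_map(2)[OF label_linv[OF v(2)] v(4)] v
    by (auto simp: balanced_def label_linv_linv)
qed

text \<open>Here the full turn is used: \<open>eR\<close> is reached from \<open>linv eL\<close>
  by \<open>2 * k + 1\<close> steps around the vertex, and the remaining
  \<open>2 * n - (2 * k + 1) = 2 * (n - k - 1) + 1\<close> steps lead back to
  \<open>linv eL\<close>.\<close>

lemma C_state:
  assumes "is_state (C k eL eR)"
  shows "balanced eL eR" "l_iter (2 * (n_lab eL eR - k - 1) + 1) eR = Some (linv eL)"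
proof -
  have *: "eL \<in> labels" "eR \<in> labels" "1 \<le> k" "k + 2 \<le> n_lab eL eR" "l_iter (2 * k + 1) (linv eL) = Some eR"
    using assms by auto
  note eL = label_linv[OF *(1)]
  have "l_iter (1 + 2 * k) (linv eL) = Some eR" using *(5) by (simp add: add.commute)
  then obtain f where "l (linv eL) = Some f"
    unfolding l_iter_add by (auto simp: bind_eq_Some_conv l_iter_def)
  then obtain v where v: "v_L (linv eL) = Some v" using l_iff[OF eL] by auto
  obtain u where u: "v_R eL = Some u" "num_lines u = num_lines v"
    using num_lines_map(1)[OF eL v] label_linv_linv[OF *(1)] by auto
  obtain w where w: "v_L eR = Some w" "num_lines w = num_lines v"
    using l_iter_props[OF eL v *(5)] by auto
  show "balanced eL eR" using * u w by (simp add: balanced_def)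
  have n: "n_lab eL eR = num_lines v" using u by (simp add: n_lab_def)
  then have "l_iter (2 * n_lab eL eR) (linv eL) = Some (linv eL)"
    using l_iter_period[OF eL v] *(4) by simp
  moreover have "2 * n_lab eL eR = (2 * k + 1) + (2 * (n_lab eL eR - k - 1) + 1)" using *(4) by simp
  ultimately show "l_iter (2 * (n_lab eL eR - k - 1) + 1) eR = Some (linv eL)"
    using *(5) l_iter_add[of "2 * k + 1" "2 * (n_lab eL eR - k - 1) + 1" "linv eL"] by simp
qed

lemma iota_state:
  assumes "is_state j"
  shows "is_state (\<iota> j)" "\<iota> (\<iota> j) = j"
proof -
  have "is_state (\<iota> j) \<and> \<iota> (\<iota> j) = j"
  proof (cases j)
    case (C k eL eR)
    then have *: "eL \<in> labels" "eR \<in> labels" "1 \<le> k" "k + 2 \<le> n_lab eL eR" using assms by auto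
    have st: "is_state (C k eL eR)" using assms C by simp
    show ?thesis
      using C_state[OF st] balanced_linv(2)[OF C_state(1)[OF st]] * by (auto simp: C label_linv label_linv_linv)
  next
    case (A_LR i p e)
    then obtain v w where "e \<in> labels" "v_L e = Some v" "v_R e = Some w" using assms by auto
    then show ?thesis
      using num_lines_map(1)[of e v] num_lines_map(2)[of e w] assms
      by (auto simp: A_LR label_linv label_linv_linv)
  next
    case (A_RL i p e)
    then obtain v w where "e \<in> labels" "v_L e = Some v" "v_R e = Some w" using assms by auto
    then show ?thesis
      using num_lines_map(1)[of e v] num_lines_map(2)[of e w] assms
      by (auto simp: A_RL label_linv label_linv_linv)
  qed (use assms in \<open>auto simp: label_linv label_linv_linv special_linv add.commute dest: num_lines_map\<close>)
  then show "is_state (\<iota> j)" "\<iota> (\<iota> j) = j" by auto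
qed

section \<open>Reversed transitions\<close>

context
  notes One_nat_def [simp del]
begin

lemma adjacent_sym: "adjacent a b \<longleftrightarrow> adjacent b a"
  and adjacent_via_sym: "adjacent_via v a b \<longleftrightarrow> adjacent_via v b a"
  unfolding adjacent_def adjacent_via_def by auto

text \<open>The states \<open>X\<close> are the images of those that have the same transitions as
  \<open>A_0 e\<close>. What has to be seen is that non-adjacency is a symmetric
  relation.\<close>

lemma reverse_A_0:
  assumes "e \<in> labels" "is_state k" "admissible (A_0 e) k"
    and X: "X = A_0 (linv e) \<or> (\<exists>i. X = A_L 1 i (linv e)) \<or> (\<exists>i. X = A_R 1 i (linv e))"
  shows "admissible (\<iota> k) X"
  using assms(3)
proof cases
  case (A_0_A_0 e')
  then have "\<not> adjacent (linv e) (linv (linv e'))"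
    using assms(2) adjacent_sym by (simp add: label_linv_linv)
  then show ?thesis using A_0_A_0 X by (auto intro: admissible.intros)
next
  case (A_0_A_L e' p)
  then have "\<not> adjacent (linv e) (linv (linv e'))"
    using assms(2) adjacent_sym by (simp add: label_linv_linv)
  then show ?thesis using A_0_A_L X by (auto intro: A_R_end A_0_A_0 admissible.A_0_A_L admissible.A_0_A_R)
next
  case (A_0_A_R e' p)
  then have "\<not> adjacent (linv e) (linv (linv e'))"
    using assms(2) adjacent_sym by (simp add: label_linv_linv)
  then show ?thesis using A_0_A_R X by (auto intro: A_L_end A_0_A_0 admissible.A_0_A_L admissible.A_0_A_R)
next
  case (A_0_B eL eR)
  then have "\<not> adjacent (linv e) (linv (linv eR))" "\<not> adjacent (linv e) (linv (linv eL))"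
    using assms(2) adjacent_sym by (simp_all add: label_linv_linv)
  then show ?thesis using A_0_B X by (auto intro: D_A_0 D_A_L D_A_R)
qed

text \<open>The two forms of \<open>X\<close> are the images of \<open>A_L j p e\<close> and,
  for \<open>j = 1\<close>, of \<open>A_RL i p e\<close>, which has the same
  transitions.\<close>

lemma reverse_A_L:
  assumes e: "e \<in> labels" and v: "v_L e = Some v" "num_lines v > 2" and p: "1 < p" and j: "1 \<le> j"
    and adm: "admissible (A_L j p e) k"
    and X: "X = A_R p j (linv e) \<or> (j = 1 \<and> X = A_RL p i (linv e))"
  shows "admissible (\<iota> k) X"
  using adm
proof cases
  case (A_L_A_L f)
  note f = l_props[OF e A_L_A_L(3)]
  have "admissible (A_R (p - 1) (j + 1) (linv f)) (A_R p j (linv e))"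
    using A_R_A_R[of "j + 1" "linv f" "linv e" "p - 1"] f(2) j p by simp
  moreover have "admissible (A_R (p - 1) 2 (linv f)) (A_RL p i (linv e))"
    using A_R_A_RL[of "linv f" "linv e" "p - 1" i] f(2) p by simp
  ultimately show ?thesis using A_L_A_L X by auto
next
  case (A_L_A_LR f q)
  note f = l_props[OF e A_L_A_LR(3)]
  have "admissible (A_R 1 (j + 1) (linv f)) (A_R p j (linv e))"
    using A_R_A_R[of "j + 1" "linv f" "linv e" 1] f(2) j A_L_A_LR by simp
  moreover have "admissible (A_R 1 2 (linv f)) (A_RL p i (linv e))"
    using A_R_A_RL[of "linv f" "linv e" 1 i] f(2) A_L_A_LR by simp
  ultimately show ?thesis using A_L_A_LR X by (auto intro: A_LR)
next
  case (A_L_B f f')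
  note f = l_props[OF e A_L_B(3)]
  have "v_R (linv f) = Some v" using f(3) v by auto
  then show ?thesis
    using A_L_B X f(2) v(2) by (auto intro: D_A_R2 D_A_RL)
next
  case A_L_end
  then show ?thesis using p by simp
qed

lemma reverse_A_R:
  assumes e: "e \<in> labels" and v: "v_R e = Some v" "num_lines v > 2" and p: "1 < p" and j: "1 \<le> j"
    and adm: "admissible (A_R j p e) k"
    and X: "X = A_L p j (linv e) \<or> (j = 1 \<and> X = A_LR p i (linv e))"
  shows "admissible (\<iota> k) X"
  using adm
proof cases
  case (A_R_A_R f)
  note f = r_props[OF e A_R_A_R(3)]
  have "admissible (A_L (p - 1) (j + 1) (linv f)) (A_L p j (linv e))"
    using A_L_A_L[of "j + 1" "linv f" "linv e" "p - 1"] f(2) j p by simp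
  moreover have "admissible (A_L (p - 1) 2 (linv f)) (A_LR p i (linv e))"
    using A_L_A_LR[of "linv f" "linv e" "p - 1" i] f(2) p by simp
  ultimately show ?thesis using A_R_A_R X by auto
next
  case (A_R_A_RL f q)
  note f = r_props[OF e A_R_A_RL(3)]
  have "admissible (A_L 1 (j + 1) (linv f)) (A_L p j (linv e))"
    using A_L_A_L[of "j + 1" "linv f" "linv e" 1] f(2) j A_R_A_RL by simp
  moreover have "admissible (A_L 1 2 (linv f)) (A_LR p i (linv e))"
    using A_L_A_LR[of "linv f" "linv e" 1 i] f(2) A_R_A_RL by simp
  ultimately show ?thesis using A_R_A_RL X by (auto intro: A_RL)
next
  case (A_R_B f f')
  note f = r_props[OF e A_R_B(3)]
  have "v_L (linv f) = Some v" using f(3) v by auto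
  then show ?thesis
    using A_R_B X f(2) v(2) by (auto intro: D_A_L2 D_A_LR)
next
  case A_R_end
  then show ?thesis using p by simp
qed

lemma balanced_step:
  assumes b: "balanced eL eR" and f: "r eL = Some fL" "l eR = Some fR"
  shows "fL \<in> labels" "fR \<in> labels" "r (linv fR) = Some (linv eR)" "l (linv fL) = Some (linv eL)"
    "n_lab fL fR = n_lab eL eR" "n_lab (linv fR) (linv fL) = n_lab eL eR"
proof -
  have e: "eL \<in> labels" "eR \<in> labels" using b by (auto simp: balanced_def)
  note L = r_props[OF e(1) f(1)] and R = l_props[OF e(2) f(2)]
  show "fL \<in> labels" "fR \<in> labels" "r (linv fR) = Some (linv eR)" "l (linv fL) = Some (linv eL)"
    using L R by simp_all
  show "n_lab fL fR = n_lab eL eR" "n_lab (linv fR) (linv fL) = n_lab eL eR"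
    using b L(3) R(3) by (auto simp: n_lab_def balanced_def)
qed

text \<open>The images of all states that have the transitions of \<open>B eL eR\<close>, namely
  \<open>B eL eR\<close> itself and the states \<open>E_L eL eR g'\<close> and
  \<open>E_R g' eL eR\<close>, where \<open>g = linv g'\<close>. In reversed time they are
  the possible ends of a chain of \<open>C\<close>-states.\<close>

definition closes_to :: "label \<Rightarrow> label \<Rightarrow> label state \<Rightarrow> bool" where
  "closes_to eL eR X \<longleftrightarrow>
     X = D (linv eR) (linv eL) \<or>
     (\<exists>g. r eR = Some g \<and> X = E_L g (linv eR) (linv eL)) \<or>
     (\<exists>g. l eL = Some g \<and> X = E_R (linv eR) (linv eL) g)"

lemma C_closes:
  assumes "eL \<in> labels" "eR \<in> labels" "r gL = Some (linv eR)" "l gR = Some (linv eL)"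
    "i + 2 = n_lab gL gR" "closes_to eL eR X"
  shows "admissible (C i gL gR) X"
  using assms unfolding closes_to_def
  by (auto intro: C_D C_E_L C_E_R simp: label_linv_linv)

text \<open>For \<open>n_lab eL eR = 2\<close> the rule for \<open>B eL eR\<close> passes
  through the term \<open>C 0 eL eR\<close>, and so does its reversal.\<close>

lemma reverse_B:
  assumes b: "balanced eL eR" and adm: "admissible (B eL eR) k" and k: "is_state k"
    and X: "closes_to eL eR X"
  shows "admissible (\<iota> k) X"
proof -
  have e: "eL \<in> labels" "eR \<in> labels" using b by (auto simp: balanced_def)
  show ?thesis
    using adm
  proof cases
    case (B_C fL fR)
    note s = balanced_step[OF b B_C(3,4)]
    show ?thesis
      using B_C s by (auto intro!: C_closes[OF e s(3,4) _ X])
  next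
    case B_2
    have short: "admissible (B (linv fR) (linv fL)) X" if "r eL = Some fL" "l eR = Some fR" for fL fR
      using balanced_step[OF b that] B_2(1) by (auto intro!: admissible.B_2 C_closes[OF e _ _ _ X])
    show ?thesis
      using B_2(2)
    proof cases
      case C_C
      then show ?thesis using B_2(1) by simp
    next
      case (C_D fL fR)
      then show ?thesis using short by simp
    next
      case (C_E_L fL fR f)
      then show ?thesis using short by (auto intro: E_L)
    next
      case (C_E_R fL fR f)
      then show ?thesis using short by (auto intro: E_R)
    qed
  qed
qed

lemma reverse_C:
  assumes st: "is_state (C i eL eR)" and adm: "admissible (C i eL eR) k"
  shows "admissible (\<iota> k) (\<iota> (C i eL eR))"
proof -
  note b = C_state(1)[OF st]
  have i: "1 \<le> i" "i + 2 \<le> n_lab eL eR" using st by auto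
  have first: "admissible (B (linv fR) (linv fL)) (\<iota> (C i eL eR))"
    if "i + 2 = n_lab eL eR" "r eL = Some fL" "l eR = Some fR" for fL fR
  proof -
    have "n_lab eL eR - i - 1 = 1" using that(1) by simp
    then show ?thesis
      using balanced_step[OF b that(2,3)] i that(1) by (auto intro: B_C)
  qed
  show ?thesis
    using adm
  proof cases
    case (C_C fL fR)
    note s = balanced_step[OF b C_C(3,4)]
    let ?i = "n_lab eL eR - (i + 1) - 1"
    have "?i + 2 < n_lab (linv fR) (linv fL)" using s(6) i C_C(2) by simp
    then have "admissible (C ?i (linv fR) (linv fL)) (C (?i + 1) (linv eR) (linv eL))"
      using s(3,4) by (rule admissible.C_C)
    moreover have "?i + 1 = n_lab eL eR - i - 1" using C_C(2) by simp
    ultimately show ?thesis using C_C(1) s(5) by simp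
  next
    case (C_D fL fR)
    then show ?thesis using first by simp
  next
    case (C_E_L fL fR f)
    then show ?thesis using first by (auto intro: E_L)
  next
    case (C_E_R fL fR f)
    then show ?thesis using first by (auto intro: E_R)
  qed
qed

text \<open>The labels of a \<open>D\<close>-state determine each other by
  \<open>r eL = Some (linv eR)\<close> and \<open>l eR = Some (linv eL)\<close>; this
  supplies the second label of the \<open>B\<close>-state in the reversed transition.\<close>

lemma reverse_D:
  assumes st: "is_state (D eL eR)" and adm: "admissible (D eL eR) k" and k: "is_state k"
  shows "admissible (\<iota> k) (B (linv eR) (linv eL))"
proof -
  obtain v where e: "eL \<in> labels" "eR \<in> labels" "v_R eL = Some v" "v_L eR = Some v" using st by auto
  have r: "r eL = Some (linv eR)" using r_iff[OF e(1)] e label_linv label_linv_linv by simp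
  have l: "l eR = Some (linv eL)" using l_iff[OF e(2)] e label_linv label_linv_linv by simp
  have na: "\<not> adjacent (linv eL) (linv (linv e'))" "\<not> adjacent (linv eR) (linv (linv e'))"
    if "\<not> adjacent e' (linv eL)" "\<not> adjacent e' (linv eR)" "e' \<in> labels" for e'
    using that adjacent_sym by (simp_all add: label_linv_linv)
  show ?thesis
    using adm
  proof cases
    case (D_A_0 e')
    then show ?thesis using na[of e'] k by (auto intro: A_0_B)
  next
    case (D_A_L e' p)
    then show ?thesis using na[of e'] k by (auto intro: A_R_end A_0_B)
  next
    case (D_A_R e' p)
    then show ?thesis using na[of e'] k by (auto intro: A_L_end A_0_B)
  next
    case (D_B eL' eR')
    have e': "eL' \<in> labels" "eR' \<in> labels" using k D_B(1) by auto
    have "admissible (D (linv eR') (linv eL')) (B (linv eR) (linv eL))"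
    proof (rule admissible.D_B)
      fix a b assume "a \<in> {linv eR, linv eL}" "b \<in> {linv (linv eR'), linv (linv eL')}"
      then have "\<not> adjacent b a \<or> (b \<noteq> a \<and> (\<forall>v. adjacent_via v b a \<longrightarrow> num_lines v > 2))"
        using e' by (intro D_B(2)) (auto simp: label_linv_linv)
      then show "\<not> adjacent a b \<or> (a \<noteq> b \<and> (\<forall>v. adjacent_via v a b \<longrightarrow> num_lines v > 2))"
        using adjacent_sym adjacent_via_sym by metis
    qed
    then show ?thesis using D_B(1) by simp
  next
    case (D_A_L2 v f p)
    then show ?thesis
      using l_props[OF e(1) D_A_L2(4)] r e by (auto intro: A_R_B simp: label_linv_linv)
  next
    case (D_A_LR v f p)
    have "admissible (A_R 1 2 (linv f)) (B (linv eR) (linv eL))"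
      using l_props(2)[OF e(1) D_A_LR(4)] r e(1) by (intro A_R_B) (simp_all add: label_linv_linv)
    then show ?thesis using D_A_LR(1) A_LR by simp
  next
    case (D_A_R2 v f p)
    then show ?thesis
      using r_props[OF e(2) D_A_R2(4)] l e by (auto intro: A_L_B simp: label_linv_linv)
  next
    case (D_A_RL v f p)
    have "admissible (A_L 1 2 (linv f)) (B (linv eR) (linv eL))"
      using r_props(2)[OF e(2) D_A_RL(4)] l e(2) by (intro A_L_B) (simp_all add: label_linv_linv)
    then show ?thesis using D_A_RL(1) A_RL by simp
  qed
qed

lemma reverse_admissible:
  assumes j: "is_state j" and k: "is_state k" and adm: "admissible j k"
  shows "admissible (\<iota> k) (\<iota> j)"
proof (cases j)
  case (A_0 e)
  then show ?thesis using reverse_A_0[OF _ k, of e] j adm by auto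
next
  case (A_L i p e)
  then obtain v where v: "e \<in> labels" "1 \<le> i" "1 \<le> p" "v_L e = Some v" "3 \<le> i + p" "i + p \<le> num_lines v"
    using j by auto
  show ?thesis
  proof (cases "p = 1")
    case True
    then have "admissible (A_0 e) k"
      using adm unfolding A_L by (auto elim: admissible.cases)
    then show ?thesis using reverse_A_0[OF v(1) k] A_L True by auto
  next
    case False
    then have "1 < p" "num_lines v > 2" using v by simp_all
    then show ?thesis
      using reverse_A_L[OF v(1,4) _ _ v(2), of p k "\<iota> j" i] adm A_L by simp
  qed
next
  case (A_R i p e)
  then obtain v where v: "e \<in> labels" "1 \<le> i" "1 \<le> p" "v_R e = Some v" "3 \<le> i + p" "i + p \<le> num_lines v"
    using j by auto
  show ?thesis
  proof (cases "p = 1")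
    case True
    then have "admissible (A_0 e) k"
      using adm unfolding A_R by (auto elim: admissible.cases)
    then show ?thesis using reverse_A_0[OF v(1) k] A_R True by auto
  next
    case False
    then have "1 < p" "num_lines v > 2" using v by simp_all
    then show ?thesis
      using reverse_A_R[OF v(1,4) _ _ v(2), of p k "\<iota> j" i] adm A_R by simp
  qed
next
  case (A_LR i p e)
  then obtain w where w: "e \<in> labels" "v_R e = Some w" "2 \<le> p" "p + 1 \<le> num_lines w" using j by auto
  have "admissible (A_R 1 p e) k" using adm unfolding A_LR by (auto elim: admissible.cases)
  then show ?thesis using reverse_A_R[OF w(1,2), of p 1 k "\<iota> j" i] w A_LR by simp
next
  case (A_RL i p e)
  then obtain v where v: "e \<in> labels" "v_L e = Some v" "2 \<le> p" "p + 1 \<le> num_lines v" using j by auto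
  have "admissible (A_L 1 p e) k" using adm unfolding A_RL by (auto elim: admissible.cases)
  then show ?thesis using reverse_A_L[OF v(1,2), of p 1 k "\<iota> j" i] v A_RL by simp
next
  case (B eL eR)
  then show ?thesis
    using reverse_B[OF balanced_B _ k, of eL eR "\<iota> j"] j adm by (simp add: closes_to_def)
next
  case (C i eL eR)
  then show ?thesis using reverse_C j adm by metis
next
  case (D eL eR)
  then show ?thesis using reverse_D[OF _ _ k, of eL eR] j adm by simp
next
  case (E_L eL eM eR)
  then obtain v w where e: "eL \<in> labels" "eM \<in> labels" "eR \<in> labels" "v_L (linv eL) = Some v" "v_R (linv eM) = Some v"
    "v_R eM = Some w" "v_L eR = Some w" using j by auto
  have "admissible (B eL eM) k" using adm unfolding E_L by (auto elim: admissible.cases)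
  moreover have "is_state (B eL eM)" using e by simp
  moreover have "r eM = Some (linv eR)" using r_iff[OF e(2)] e label_linv label_linv_linv by simp
  then have "closes_to eL eM (\<iota> j)" using E_L by (simp add: closes_to_def)
  ultimately show ?thesis using reverse_B[OF balanced_B _ k] by simp
next
  case (E_R eL eM eR)
  then obtain v w where e: "eL \<in> labels" "eM \<in> labels" "eR \<in> labels" "v_R eL = Some v" "v_L eM = Some v"
    "v_L (linv eM) = Some w" "v_R (linv eR) = Some w" using j by auto
  have "admissible (B eM eR) k" using adm unfolding E_R by (auto elim: admissible.cases)
  moreover have "is_state (B eM eR)" using e by simp
  moreover have "l eM = Some (linv eL)" using l_iff[OF e(2)] e label_linv label_linv_linv by simp
  then have "closes_to eM eR (\<iota> j)" using E_R by (simp add: closes_to_def)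
  ultimately show ?thesis using reverse_B[OF balanced_B _ k] by simp
qed

end

lemma iota_\<Xi>: "j \<in> \<Xi> \<Longrightarrow> \<iota> j \<in> \<Xi>" "j \<in> \<Xi> \<Longrightarrow> \<iota> (\<iota> j) = j"
  using iota_state by (simp_all add: \<Xi>_def)

text \<open>One implication suffices: applied to the images, it gives the converse because
  \<open>\<iota>\<close> is an involution.\<close>

lemma trans_matrix_iota:
  assumes "j \<in> \<Xi>" "k \<in> \<Xi>"
  shows "trans_matrix (\<iota> j) (\<iota> k) = trans_matrix k j"
proof -
  have "admissible (\<iota> j) (\<iota> k) \<longleftrightarrow> admissible k j"
    using assms reverse_admissible[of k j] reverse_admissible[of "\<iota> j" "\<iota> k"] iota_state
    unfolding \<Xi>_def mem_Collect_eq by metis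
  then show ?thesis using assms iota_\<Xi> by (simp add: trans_matrix_def)
qed

lemma iota_start: "j \<in> \<Xi>_S \<Longrightarrow> \<iota> j \<in> \<Xi>_F"
  and iota_end: "j \<in> \<Xi>_F \<Longrightarrow> \<iota> j \<in> \<Xi>_S"
proof -
  have special: "special (linv e)" if "special e" for e
    using that special_linv by (simp add: special_def)
  show "\<iota> j \<in> \<Xi>_F" if "j \<in> \<Xi>_S"
    using that iota_\<Xi>(1)[of j] special unfolding \<Xi>_S_def \<Xi>_F_def Int_iff
    by (cases j) simp_all
  show "\<iota> j \<in> \<Xi>_S" if "j \<in> \<Xi>_F"
    using that iota_\<Xi>(1)[of j] special unfolding \<Xi>_S_def \<Xi>_F_def Int_iff
    by (cases j) simp_all
qed

lemma iota_image_\<Xi>_S: "\<iota> ` \<Xi>_S = \<Xi>_F"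
  and iota_image_\<Xi>_F: "\<iota> ` \<Xi>_F = \<Xi>_S"
proof -
  have "j \<in> \<Xi>" if "j \<in> \<Xi>_S \<or> j \<in> \<Xi>_F" for j using that by (auto simp: \<Xi>_S_def \<Xi>_F_def)
  then have inv: "\<iota> (\<iota> j) = j" if "j \<in> \<Xi>_S \<or> j \<in> \<Xi>_F" for j using that iota_\<Xi>(2) by blast
  show "\<iota> ` \<Xi>_S = \<Xi>_F"
  proof
    show "\<iota> ` \<Xi>_S \<subseteq> \<Xi>_F" using iota_start by auto
    show "\<Xi>_F \<subseteq> \<iota> ` \<Xi>_S"
    proof
      fix j assume "j \<in> \<Xi>_F"
      then show "j \<in> \<iota> ` \<Xi>_S" using iota_end inv by (metis imageI)
    qed
  qed
  show "\<iota> ` \<Xi>_F = \<Xi>_S"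
  proof
    show "\<iota> ` \<Xi>_F \<subseteq> \<Xi>_S" using iota_end by auto
    show "\<Xi>_S \<subseteq> \<iota> ` \<Xi>_F"
    proof
      fix j assume "j \<in> \<Xi>_S"
      then show "j \<in> \<iota> ` \<Xi>_F" using iota_start inv by (metis imageI)
    qed
  qed
qed

end

theorem proposition4p12:
  fixes G :: "(complex \<Rightarrow> complex) set" and R :: "complex set"
  assumes "even_corner_tiling G R"
  shows "(\<forall>j \<in> tiling.\<Xi> G R. tiling.\<iota> G R j \<in> tiling.\<Xi> G R \<and> tiling.\<iota> G R (tiling.\<iota> G R j) = j) \<and>
         (\<forall>j \<in> tiling.\<Xi> G R. \<forall>k \<in> tiling.\<Xi> G R.
            tiling.trans_matrix G R (tiling.\<iota> G R j) (tiling.\<iota> G R k) = tiling.trans_matrix G R k j) \<and>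
         tiling.\<iota> G R ` tiling.\<Xi>_S G R = tiling.\<Xi>_F G R \<and>
         tiling.\<iota> G R ` tiling.\<Xi>_F G R = tiling.\<Xi>_S G R"
proof -
  interpret even_corner_tiling G R by (fact assms)
  show ?thesis
    by (intro conjI ballI iota_\<Xi> trans_matrix_iota iota_image_\<Xi>_S iota_image_\<Xi>_F)
qed

end
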